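(* Let $(A,\mathfrak{m})$ be a Noetherian local ring, $M$ a finitely generated $A$-module, and $I$ a proper ideal of $A$ (not necessarily an ideal of definition for $M$) with $\operatorname{grade}(I,M) > 0$. If $\operatorname{depth} G_I(M) < \operatorname{depth} M$, then $\operatorname{depth} R(I,M) = \operatorname{depth} G_I(M) + 1$.
   Context: $R(I) = \bigoplus_{n\geq 0}I^nt^n$ is the Rees ring, with graded maximal ideal $\mathfrak{M} = \mathfrak{m}\oplus R(I)_+$, and $R(I,M) = \bigoplus_{n\geq 0} I^nM$ is the Rees module, a finitely generated graded $R(I)$-module; $\operatorname{depth} R(I,M) = \operatorname{grade}(\mathfrak{M},R(I,M))$. $G_I(M) = \bigoplus_{n\geq 0} I^nM/I^{n+1}M$ is a graded module over $G_I(A) = \bigoplus_{n\geq 0}I^n/I^{n+1}$, and $\operatorname{depth} G_I(M) = \operatorname{grade}(\mathfrak{M}_G,G_I(M))$ with $\mathfrak{M}_G = \mathfrak{m}/I\oplus\bigoplus_{n\geq 1}I^n/I^{n+1}$. An ideal of definition for $M$ is an ideal $J$ with $M/JM$ of finite length. *)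

theory Defs
  imports "HOL-Algebra.Ring_Divisibility" "HOL-Algebra.Ideal_Product" "HOL-Algebra.UnivPoly"
    "HOL-Library.Extended_Nat"
begin

section \<open>Submodules, quotients and the grade of a module\<close>

definition noetherian_local_ring :: "('a, 'r) ring_scheme \<Rightarrow> 'a set \<Rightarrow> bool" where
  "noetherian_local_ring A \<mm> \<longleftrightarrow>
     cring A \<and> noetherian_ring A \<and> maximalideal \<mm> A \<and> (\<forall>J. maximalideal J A \<longrightarrow> J = \<mm>)"

definition module_span ::
    "('a, 'r) ring_scheme \<Rightarrow> ('a, 'm, 's) module_scheme \<Rightarrow> 'm set \<Rightarrow> 'm set" where
  "module_span R M S = \<Inter>{N. submodule N R M \<and> S \<subseteq> N}"

definition fin_gen_module :: "('a, 'r) ring_scheme \<Rightarrow> ('a, 'm, 's) module_scheme \<Rightarrow> bool" where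
  "fin_gen_module R M \<longleftrightarrow>
     module R M \<and> (\<exists>S. finite S \<and> S \<subseteq> carrier M \<and> module_span R M S = carrier M)"

text \<open>The submodule \<open>J M\<close>; it only depends on the ideal generated by the set \<open>J\<close>.\<close>

definition set_smult ::
    "('a, 'r) ring_scheme \<Rightarrow> 'a set \<Rightarrow> ('a, 'm, 's) module_scheme \<Rightarrow> 'm set" where
  "set_smult R J M = module_span R M {a \<odot>\<^bsub>M\<^esub> x | a x. a \<in> J \<and> x \<in> carrier M}"

text \<open>
  The record type of modules extends that of rings, but the locale \<^locale>\<open>module\<close> puts no
  condition on the fields \<open>mult\<close> and \<open>one\<close> of a module; they are left undefined below.
\<close>

definition coset_smult :: "('a, 'm, 's) module_scheme \<Rightarrow> 'm set \<Rightarrow> 'a \<Rightarrow> 'm set \<Rightarrow> 'm set" where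
  "coset_smult M N a C = (\<Union>x\<in>C. N +>\<^bsub>M\<^esub> (a \<odot>\<^bsub>M\<^esub> x))"

definition quot_module :: "('a, 'm, 's) module_scheme \<Rightarrow> 'm set \<Rightarrow> ('a, 'm set) module" where
  "quot_module M N =
     \<lparr>carrier = a_rcosets\<^bsub>M\<^esub> N, mult = undefined, one = undefined,
      zero = N, add = set_add M, smult = coset_smult M N\<rparr>"

definition regular_element :: "('a, 'm, 's) module_scheme \<Rightarrow> 'a \<Rightarrow> bool" where
  "regular_element M a \<longleftrightarrow> (\<forall>x\<in>carrier M. a \<odot>\<^bsub>M\<^esub> x = \<zero>\<^bsub>M\<^esub> \<longrightarrow> x = \<zero>\<^bsub>M\<^esub>)"

definition regular_sequence ::
    "('a, 'r) ring_scheme \<Rightarrow> ('a, 'm, 's) module_scheme \<Rightarrow> 'a list \<Rightarrow> bool" where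
  "regular_sequence R M as \<longleftrightarrow>
     set as \<subseteq> carrier R \<and>
     (\<forall>i<length as. regular_element (quot_module M (set_smult R (set (take i as)) M)) (as ! i)) \<and>
     set_smult R (set as) M \<noteq> carrier M"

text \<open>
  For a finitely generated module over a Noetherian ring all maximal regular sequences in \<open>J\<close>
  have the same length if \<open>J M \<noteq> M\<close>, so that the supremum below is that length. The usual
  convention is \<open>grade(J, M) = \<infinity>\<close> if \<open>J M = M\<close>; in particular the zero module has infinite grade.
\<close>

definition grade ::
    "('a, 'r) ring_scheme \<Rightarrow> 'a set \<Rightarrow> ('a, 'm, 's) module_scheme \<Rightarrow> enat" where
  "grade R J M =
     (if set_smult R J M = carrier M then \<infinity>
      else Sup {enat (length as) | as. set as \<subseteq> J \<and> regular_sequence R M as})"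


section \<open>The Rees ring and the Rees module\<close>

abbreviation ideal_power :: "('a, 'r) ring_scheme \<Rightarrow> 'a set \<Rightarrow> nat \<Rightarrow> 'a set" where
  "ideal_power A I n \<equiv> I [^]\<^bsub>ideals_set A\<^esub> n"

abbreviation power_smult ::
    "('a, 'r) ring_scheme \<Rightarrow> 'a set \<Rightarrow> ('a, 'm, 's) module_scheme \<Rightarrow> nat \<Rightarrow> 'm set" where
  "power_smult A I M n \<equiv> set_smult A (ideal_power A I n) M"

text \<open>
  Elements of a graded object are represented by the sequences of their homogeneous components.
  The Rees ring is the subring of the polynomial ring \<open>A[t]\<close> of all polynomials whose coefficient
  of \<open>t\<^sup>n\<close> lies in \<open>I\<^sup>n\<close>; polynomials of \<^const>\<open>UP\<close> are sequences of coefficients.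
\<close>

definition rees_ring :: "('a, 'r) ring_scheme \<Rightarrow> 'a set \<Rightarrow> ('a, nat \<Rightarrow> 'a) up_ring" where
  "rees_ring A I = (UP A)\<lparr>carrier := {f \<in> up A. \<forall>n. f n \<in> ideal_power A I n}\<rparr>"

definition rees_max_ideal :: "('a, 'r) ring_scheme \<Rightarrow> 'a set \<Rightarrow> 'a set \<Rightarrow> (nat \<Rightarrow> 'a) set" where
  "rees_max_ideal A \<mm> I = {f \<in> carrier (rees_ring A I). f 0 \<in> \<mm>}"

definition rees_module ::
    "('a, 'r) ring_scheme \<Rightarrow> 'a set \<Rightarrow> ('a, 'm, 's) module_scheme \<Rightarrow> (nat \<Rightarrow> 'a, nat \<Rightarrow> 'm) module"
  where
  "rees_module A I M =
     \<lparr>carrier = {f. (\<forall>n. f n \<in> power_smult A I M n) \<and> finite {n. f n \<noteq> \<zero>\<^bsub>M\<^esub>}},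
      mult = undefined, one = undefined,
      zero = (\<lambda>n. \<zero>\<^bsub>M\<^esub>),
      add = (\<lambda>f g n. f n \<oplus>\<^bsub>M\<^esub> g n),
      smult = (\<lambda>r f n. \<Oplus>\<^bsub>M\<^esub>i\<in>{..n}. r i \<odot>\<^bsub>M\<^esub> f (n - i))\<rparr>"


section \<open>The associated graded ring and module\<close>

text \<open>
  The component of degree \<open>n\<close> is the subgroup \<open>I\<^sup>n/I\<^sup>n\<^sup>+\<^sup>1\<close> of \<open>A/I\<^sup>n\<^sup>+\<^sup>1\<close>. For \<open>a \<in> I\<^sup>i\<close> and
  \<open>b \<in> I\<^sup>j\<close> with \<open>i + j = n\<close>, the product of the cosets of \<open>a\<close> modulo \<open>I\<^sup>i\<^sup>+\<^sup>1\<close> and of \<open>b\<close> modulo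
  \<open>I\<^sup>j\<^sup>+\<^sup>1\<close> is the coset of \<open>a b\<close> modulo \<open>I\<^sup>n\<^sup>+\<^sup>1\<close>: this is the value of \<^const>\<open>rcoset_mult\<close> for
  the ideal \<open>I\<^sup>n\<^sup>+\<^sup>1\<close> on these two cosets. Likewise for \<^const>\<open>coset_smult\<close>.
\<close>

definition assoc_graded_ring :: "('a, 'r) ring_scheme \<Rightarrow> 'a set \<Rightarrow> (nat \<Rightarrow> 'a set) ring" where
  "assoc_graded_ring A I =
     \<lparr>carrier = {f. (\<forall>n. \<exists>a\<in>ideal_power A I n. f n = ideal_power A I (Suc n) +>\<^bsub>A\<^esub> a) \<and>
                    finite {n. f n \<noteq> ideal_power A I (Suc n)}},
      mult = (\<lambda>f g n. \<Oplus>\<^bsub>A Quot ideal_power A I (Suc n)\<^esub>i\<in>{..n}.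
                rcoset_mult A (ideal_power A I (Suc n)) (f i) (g (n - i))),
      one = (\<lambda>n. if n = 0 then ideal_power A I (Suc 0) +>\<^bsub>A\<^esub> \<one>\<^bsub>A\<^esub> else ideal_power A I (Suc n)),
      zero = (\<lambda>n. ideal_power A I (Suc n)),
      add = (\<lambda>f g n. f n <+>\<^bsub>A\<^esub> g n)\<rparr>"

definition assoc_graded_max_ideal ::
    "('a, 'r) ring_scheme \<Rightarrow> 'a set \<Rightarrow> 'a set \<Rightarrow> (nat \<Rightarrow> 'a set) set" where
  "assoc_graded_max_ideal A \<mm> I =
     {f \<in> carrier (assoc_graded_ring A I). \<exists>a\<in>\<mm>. f 0 = I +>\<^bsub>A\<^esub> a}"

definition assoc_graded_module ::
    "('a, 'r) ring_scheme \<Rightarrow> 'a set \<Rightarrow> ('a, 'm, 's) module_scheme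
      \<Rightarrow> (nat \<Rightarrow> 'a set, nat \<Rightarrow> 'm set) module" where
  "assoc_graded_module A I M =
     \<lparr>carrier = {f. (\<forall>n. \<exists>x\<in>power_smult A I M n. f n = power_smult A I M (Suc n) +>\<^bsub>M\<^esub> x) \<and>
                    finite {n. f n \<noteq> power_smult A I M (Suc n)}},
      mult = undefined, one = undefined,
      zero = (\<lambda>n. power_smult A I M (Suc n)),
      add = (\<lambda>f g n. f n <+>\<^bsub>M\<^esub> g n),
      smult = (\<lambda>r f n. \<Oplus>\<^bsub>quot_module M (power_smult A I M (Suc n))\<^esub>i\<in>{..n}.
                 (\<Union>a\<in>r i. coset_smult M (power_smult A I M (Suc n)) a (f (n - i))))\<rparr>"


section \<open>Depth\<close>

definition depth :: "('a, 'r) ring_scheme \<Rightarrow> 'a set \<Rightarrow> ('a, 'm, 's) module_scheme \<Rightarrow> enat" where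
  "depth A \<mm> M = grade A \<mm> M"

definition depth_rees ::
    "('a, 'r) ring_scheme \<Rightarrow> 'a set \<Rightarrow> 'a set \<Rightarrow> ('a, 'm, 's) module_scheme \<Rightarrow> enat" where
  "depth_rees A \<mm> I M = grade (rees_ring A I) (rees_max_ideal A \<mm> I) (rees_module A I M)"

definition depth_assoc_graded ::
    "('a, 'r) ring_scheme \<Rightarrow> 'a set \<Rightarrow> 'a set \<Rightarrow> ('a, 'm, 's) module_scheme \<Rightarrow> enat" where
  "depth_assoc_graded A \<mm> I M =
     grade (assoc_graded_ring A I) (assoc_graded_max_ideal A \<mm> I) (assoc_graded_module A I M)"

end

theory Submission
  imports Defs "HOL-Algebra.Subrings"
begin

text \<open>
  Depth is the least degree in which Koszul cohomology \<open>H\<^sup>i\<close> on generators of the maximal ideal does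
  not vanish. Over the Rees ring these generators can be chosen homogeneous of degrees \<open>0\<close> and \<open>1\<close>.
  Write \<open>N = R(I,M)\<close>, let \<open>N\<^sub>+\<close> be its part of positive degree and \<open>g = depth G\<^sub>I(M)\<close>, and consider the
  exact sequences \<open>0 \<rightarrow> N\<^sub>+ \<rightarrow> N \<rightarrow> M \<rightarrow> 0\<close> and \<open>0 \<rightarrow> N\<^sub>+(1) \<rightarrow> N \<rightarrow> G\<^sub>I(M) \<rightarrow> 0\<close>.

  If \<open>H\<^sup>i(M) = 0\<close> and \<open>H\<^sup>i\<^sup>-\<^sup>1(G\<^sub>I(M)) = 0\<close>, then a class in \<open>H\<^sup>i(N)\<close> comes from \<open>N\<^sub>+\<close>, the map
  \<open>H\<^sup>i(N\<^sub>+)(1) \<rightarrow> H\<^sup>i(N)\<close> is injective and lowers degrees by one; as degrees are bounded below,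
  \<open>H\<^sup>i(N) = 0\<close>. As \<open>g < depth M\<close>, this applies to all \<open>i \<le> g\<close>. Conversely \<open>H\<^sup>g(G\<^sub>I(M))\<close> embeds into
  \<open>H\<^sup>g\<^sup>+\<^sup>1(N\<^sub>+)\<close> up to a shift, since \<open>H\<^sup>g(N) = 0\<close>, and \<open>H\<^sup>g\<^sup>+\<^sup>1(N\<^sub>+)\<close> embeds into \<open>H\<^sup>g\<^sup>+\<^sup>1(N)\<close>, since
  \<open>H\<^sup>g(M) = 0\<close>; so \<open>H\<^sup>g\<^sup>+\<^sup>1(N) \<noteq> 0\<close>.

  Both \<open>M\<close> and \<open>G\<^sub>I(M)\<close> are quotients of \<open>N\<close> compatibly with surjections of the Rees ring, under
  which grade is invariant. So the cohomological description of grade is only needed for the quotients of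
  \<open>N\<close>, and of Noetherianity only the chain condition for the submodules of \<open>N\<close>.
\<close>

section \<open>Koszul cohomology modulo a submodule\<close>

text \<open>The two exact sequences fit together because the degree shift identifies
  \<open>N_pos\<close>, the sequences without constant term, with \<open>N_gr\<close>, the sequences
  whose \<open>n\<close>-th term lies in the submodule of exponent \<open>n + 1\<close>. So all
  three modules are quotients \<open>N/L\<close>, with \<open>L\<close> zero, \<open>N_pos\<close>
  or \<open>N_gr\<close>. Their cohomology is computed with cochains of \<open>N\<close> that are
  cocycles modulo \<open>L\<close>, and connecting maps become explicit lifts. That degrees run out
  needs a grading preserved by the differential. A generator of degree one raises the degree of a
  component, so the component at \<open>T\<close> is counted in degree \<open>n - wt T\<close>,
  where \<open>wt T\<close> is the number of indices in \<open>T\<close> that belong to generators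
  of degree one. This quantity is at least \<open>-s\<close>, which is the lower bound; finite
  support gives the upper bound on which the induction runs. Regular sequences need not be
  homogeneous. The chain condition enters through the finiteness of the set of maximal annihilators,
  which yields a regular element as soon as cohomology in degree zero vanishes.\<close>

lemma (in cring) ideal_diffI:
  assumes "\<And>a. a \<in> K \<Longrightarrow> a \<in> carrier R" "\<zero>\<^bsub>R\<^esub> \<in> K" "\<And>a b. \<lbrakk>a \<in> K; b \<in> K\<rbrakk> \<Longrightarrow> a \<ominus> b \<in> K"
    and "\<And>r a. \<lbrakk>r \<in> carrier R; a \<in> K\<rbrakk> \<Longrightarrow> r \<otimes> a \<in> K"
  shows "ideal K R"
proof (rule idealI)
  show "ring R" by (rule ring_axioms)
  have neg: "\<ominus> a \<in> K" if "a \<in> K" for a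
    using assms(3)[OF assms(2) that] assms(1)[OF that] by (simp add: minus_eq)
  have "a \<oplus> b \<in> K" if "a \<in> K" "b \<in> K" for a b
    using assms(3)[OF that(1) neg[OF that(2)]] assms(1)[OF that(2)] by (simp add: minus_eq)
  thus "subgroup K (add_monoid R)"
    using assms(1,2) neg by (intro add.subgroupI) auto
  show "x \<otimes> a \<in> K" if "a \<in> K" "x \<in> carrier R" for a x using assms(4) that by blast
  show "a \<otimes> x \<in> K" if "a \<in> K" "x \<in> carrier R" for a x
    using assms(4)[OF that(2,1)] that assms(1) m_comm[of a x] by simp
qed

section \<open>Arithmetic in a module and closure properties of submodules\<close>

context module
begin

lemma minus_zero [simp]: "\<ominus>\<^bsub>M\<^esub> \<zero>\<^bsub>M\<^esub> = \<zero>\<^bsub>M\<^esub>"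
  by (rule M.minus_equality) auto

text \<open>
  Lets the method \<open>algebra\<close> normalise expressions in the group of a module; the fields \<open>one\<close> and
  \<open>mult\<close> of \<open>M\<close> only fill argument positions.
\<close>

lemmas module_simprules [algebra cring "zero M" "add M" "a_inv M" "a_minus M" "one M" "mult M"] =
  M.a_closed M.zero_closed M.a_inv_closed M.minus_closed
  M.a_assoc M.l_zero M.l_neg M.a_comm M.minus_eq
  M.r_zero M.r_neg M.r_neg2 M.r_neg1 M.minus_add M.minus_minus minus_zero M.a_lcomm
  smult_closed smult_r_distr smult_r_minus smult_r_null

lemma zero_diff_zero [simp]: "\<zero>\<^bsub>M\<^esub> \<ominus>\<^bsub>M\<^esub> \<zero>\<^bsub>M\<^esub> = \<zero>\<^bsub>M\<^esub>"
  by algebra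

lemma diff_zero [simp]: "u \<in> carrier M \<Longrightarrow> u \<ominus>\<^bsub>M\<^esub> \<zero>\<^bsub>M\<^esub> = u"
  by algebra

lemma smult_r_diff:
  "\<lbrakk>a \<in> carrier R; x \<in> carrier M; y \<in> carrier M\<rbrakk> \<Longrightarrow> a \<odot>\<^bsub>M\<^esub> (x \<ominus>\<^bsub>M\<^esub> y) = a \<odot>\<^bsub>M\<^esub> x \<ominus>\<^bsub>M\<^esub> a \<odot>\<^bsub>M\<^esub> y"
  by algebra

lemma smult_diff_diff:
  "\<lbrakk>r \<in> carrier R; a \<in> carrier M; b \<in> carrier M; p \<in> carrier M; q \<in> carrier M\<rbrakk>
    \<Longrightarrow> r \<odot>\<^bsub>M\<^esub> (a \<ominus>\<^bsub>M\<^esub> b) \<ominus>\<^bsub>M\<^esub> (p \<ominus>\<^bsub>M\<^esub> q) = r \<odot>\<^bsub>M\<^esub> a \<ominus>\<^bsub>M\<^esub> p \<ominus>\<^bsub>M\<^esub> (r \<odot>\<^bsub>M\<^esub> b \<ominus>\<^bsub>M\<^esub> q)"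
  by algebra

lemma minus_diff: "\<lbrakk>p \<in> carrier M; q \<in> carrier M\<rbrakk> \<Longrightarrow> \<ominus>\<^bsub>M\<^esub> (p \<ominus>\<^bsub>M\<^esub> q) = \<ominus>\<^bsub>M\<^esub> p \<ominus>\<^bsub>M\<^esub> \<ominus>\<^bsub>M\<^esub> q"
  by algebra

lemma smult_left_comm:
  "\<lbrakk>a \<in> carrier R; b \<in> carrier R; x \<in> carrier M\<rbrakk> \<Longrightarrow> a \<odot>\<^bsub>M\<^esub> (b \<odot>\<^bsub>M\<^esub> x) = b \<odot>\<^bsub>M\<^esub> (a \<odot>\<^bsub>M\<^esub> x)"
  by (metis smult_assoc1 R.m_comm)

lemma diff_zero_imp_eq:
  assumes "x \<in> carrier M" "y \<in> carrier M" "x \<ominus>\<^bsub>M\<^esub> y = \<zero>\<^bsub>M\<^esub>"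
  shows "x = y"
proof -
  have "x = (x \<ominus>\<^bsub>M\<^esub> y) \<oplus>\<^bsub>M\<^esub> y" using assms(1,2) by algebra
  thus ?thesis using assms by simp
qed

lemma submodule_zero: "submodule L R M \<Longrightarrow> \<zero>\<^bsub>M\<^esub> \<in> L"
  using subgroup.one_closed[of L "add_monoid M"] by (simp add: submodule_def)

lemma submodule_diff:
  "\<lbrakk>submodule L R M; u \<in> L; v \<in> L\<rbrakk> \<Longrightarrow> u \<ominus>\<^bsub>M\<^esub> v \<in> L"
  unfolding M.minus_eq using submoduleE(3,5) by blast

lemma submodule_carrier: "\<lbrakk>submodule L R M; u \<in> L\<rbrakk> \<Longrightarrow> u \<in> carrier M"
  using submoduleE(1) by blast

lemma submodule_mem_of_diff:
  assumes L: "submodule L R M" and "u \<in> carrier M" "v \<in> carrier M" "u \<ominus>\<^bsub>M\<^esub> v \<in> L" "v \<in> L"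
  shows "u \<in> L"
proof -
  have "u = (u \<ominus>\<^bsub>M\<^esub> v) \<oplus>\<^bsub>M\<^esub> v" using assms(2,3) by algebra
  thus ?thesis using submoduleE(5)[OF L assms(4,5)] by simp
qed

lemma submoduleI_diff:
  assumes "H \<subseteq> carrier M" "\<zero>\<^bsub>M\<^esub> \<in> H" "\<And>a b. a \<in> H \<Longrightarrow> b \<in> H \<Longrightarrow> a \<ominus>\<^bsub>M\<^esub> b \<in> H"
    and "\<And>a x. a \<in> carrier R \<Longrightarrow> x \<in> H \<Longrightarrow> a \<odot>\<^bsub>M\<^esub> x \<in> H"
  shows "submodule H R M"
proof (rule submoduleI)
  fix a assume a: "a \<in> H"
  hence "a \<in> carrier M" using assms(1) by blast
  hence "\<zero>\<^bsub>M\<^esub> \<ominus>\<^bsub>M\<^esub> a = \<ominus>\<^bsub>M\<^esub> a" by algebra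
  thus n: "\<ominus>\<^bsub>M\<^esub> a \<in> H" using assms(3)[OF assms(2) a] by simp
next
  fix a b assume a: "a \<in> H" and b: "b \<in> H"
  hence c: "a \<in> carrier M" "b \<in> carrier M" using assms(1) by auto
  have "a \<oplus>\<^bsub>M\<^esub> b = a \<ominus>\<^bsub>M\<^esub> (\<zero>\<^bsub>M\<^esub> \<ominus>\<^bsub>M\<^esub> b)" using c by algebra
  thus "a \<oplus>\<^bsub>M\<^esub> b \<in> H" using assms(3)[OF a assms(3)[OF assms(2) b]] by simp
qed (use assms in auto)

lemma submodule_singleton_zero: "submodule {\<zero>\<^bsub>M\<^esub>} R M"
  by (rule submoduleI_diff) (auto simp: M.minus_eq)

end

text \<open>
  A cochain is a function on the subsets of \<open>{..<s}\<close>. Restricting it to the sets without and with the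
  index \<open>s\<close> exhibits the complex on \<open>s + 1\<close> elements as the cone of multiplication by \<open>y s\<close> on the
  complex on \<open>s\<close> elements, which gives the recursion below; \<open>homotopy M j\<close> is the null homotopy of
  multiplication by \<open>y j\<close>.
\<close>

primrec koszul :: "('a, 'b, 'c) module_scheme \<Rightarrow> (nat \<Rightarrow> 'a) \<Rightarrow> nat \<Rightarrow> (nat set \<Rightarrow> 'b) \<Rightarrow> nat set \<Rightarrow> 'b"
  where
    "koszul M y 0 c = (\<lambda>S. \<zero>\<^bsub>M\<^esub>)"
  | "koszul M y (Suc s) c = (\<lambda>S. if s \<in> S
       then y s \<odot>\<^bsub>M\<^esub> c (S - {s}) \<ominus>\<^bsub>M\<^esub> koszul M y s (\<lambda>T. c (insert s T)) (S - {s})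
       else koszul M y s c S)"

primrec homotopy ::
    "('a, 'b, 'c) module_scheme \<Rightarrow> nat \<Rightarrow> nat \<Rightarrow> (nat set \<Rightarrow> 'b) \<Rightarrow> nat set \<Rightarrow> 'b"
  where
    "homotopy M j 0 c = (\<lambda>S. \<zero>\<^bsub>M\<^esub>)"
  | "homotopy M j (Suc s) c = (\<lambda>S. if j = s then (if s \<in> S then \<zero>\<^bsub>M\<^esub> else c (insert s S))
       else if s \<in> S then \<ominus>\<^bsub>M\<^esub> homotopy M j s (\<lambda>T. c (insert s T)) (S - {s})
       else homotopy M j s c S)"

text \<open>Cochains are total functions on sets of naturals, forced to vanish off the index sets of
  size \<open>d\<close>. Statements can then quantify over all \<open>S\<close>, and for negative
  \<open>d\<close> the zero cochain alone remains.\<close>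

definition cochains :: "('a, 'b, 'c) module_scheme \<Rightarrow> nat \<Rightarrow> int \<Rightarrow> (nat set \<Rightarrow> 'b) set" where
  "cochains M s d = {c. (\<forall>S. c S \<in> carrier M) \<and>
     (\<forall>S. \<not> (S \<subseteq> {..<s} \<and> int (card S) = d) \<longrightarrow> c S = \<zero>\<^bsub>M\<^esub>)}"

text \<open>
  The cohomology of \<open>M/L\<close> in degree \<open>d\<close> vanishes. No quotient is formed, as all modules of interest
  are quotients of one module. Degrees are integers so that degree \<open>-1\<close> needs no special treatment.
\<close>

definition koszul_exact ::
    "('a, 'b, 'c) module_scheme \<Rightarrow> (nat \<Rightarrow> 'a) \<Rightarrow> nat \<Rightarrow> 'b set \<Rightarrow> int \<Rightarrow> bool" where
  "koszul_exact M y s L d \<longleftrightarrow> (\<forall>c\<in>cochains M s d. (\<forall>S. koszul M y s c S \<in> L) \<longrightarrow>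
     (\<exists>b\<in>cochains M s (d - 1). \<forall>S. c S \<ominus>\<^bsub>M\<^esub> koszul M y s b S \<in> L))"

text \<open>Inside the recursion \<open>insert s T - {s}\<close> equals \<open>T\<close> only for
  \<open>T\<close> without \<open>s\<close>. Since subsets of the argument alone matter, the
  differential on \<open>S - {s}\<close> never sees another \<open>T\<close>.\<close>

lemma koszul_cong:
  "(\<And>T. T \<subseteq> S \<Longrightarrow> c T = d T) \<Longrightarrow> koszul M y s c S = koszul M y s d S"
proof (induction s arbitrary: c d S)
  case (Suc s)
  have "koszul M y s (\<lambda>T. c (insert s T)) (S - {s}) = koszul M y s (\<lambda>T. d (insert s T)) (S - {s})"
    if "s \<in> S" by (rule Suc.IH) (use that in \<open>auto intro!: Suc.prems\<close>)
  moreover have "koszul M y s c S = koszul M y s d S" by (rule Suc.IH) (rule Suc.prems)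
  ultimately show ?case using Suc.prems by auto
qed simp

text \<open>As for the differential, except that the homotopy also looks at sets enlarged by
  \<open>j\<close>.\<close>

lemma homotopy_cong:
  "(\<And>T. T \<subseteq> insert j S \<Longrightarrow> c T = d T) \<Longrightarrow> homotopy M j s c S = homotopy M j s d S"
proof (induction s arbitrary: c d S)
  case (Suc s)
  have "homotopy M j s (\<lambda>T. c (insert s T)) (S - {s}) = homotopy M j s (\<lambda>T. d (insert s T)) (S - {s})"
    if "s \<in> S" by (rule Suc.IH) (use that in \<open>auto intro!: Suc.prems\<close>)
  moreover have "homotopy M j s c S = homotopy M j s d S" by (rule Suc.IH) (rule Suc.prems)
  ultimately show ?case using Suc.prems by auto
qed simp

section \<open>Formal properties of the differential and of the null homotopies\<close>

context module
begin

text \<open>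
  Used with families that encode supports, submodules and bounds on degrees.
\<close>
lemma koszul_mem:
  assumes "\<And>T. c T \<in> P T" "\<And>S. \<zero>\<^bsub>M\<^esub> \<in> Q S"
    and "\<And>S u v. u \<in> Q S \<Longrightarrow> v \<in> Q S \<Longrightarrow> u \<ominus>\<^bsub>M\<^esub> v \<in> Q S"
    and "\<And>j S u. \<lbrakk>j < s; j \<in> S; u \<in> P (S - {j})\<rbrakk> \<Longrightarrow> y j \<odot>\<^bsub>M\<^esub> u \<in> Q S"
  shows "koszul M y s c S \<in> Q S"
  using assms
proof (induction s arbitrary: c P Q S)
  case (Suc s)
  show ?case
  proof (cases "s \<in> S")
    case True
    have "koszul M y s (\<lambda>T. c (insert s T)) (S - {s}) \<in> (\<lambda>T. Q (insert s T)) (S - {s})"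
    proof (rule Suc.IH)
      fix j S u assume *: "j < s" "j \<in> S" "u \<in> P (insert s (S - {j}))"
      hence "insert s S - {j} = insert s (S - {j})" by auto
      thus "y j \<odot>\<^bsub>M\<^esub> u \<in> Q (insert s S)" using Suc.prems(4)[of j "insert s S" u] * by simp
    qed (use Suc.prems in auto)
    moreover have "insert s (S - {s}) = S" using True by auto
    ultimately show ?thesis using True Suc.prems by simp
  next
    case False
    have "koszul M y s c S \<in> Q S" by (rule Suc.IH[of c P]) (use Suc.prems in auto)
    thus ?thesis using False by simp
  qed
qed simp

lemma koszul_closed:
  assumes "\<And>j. j < s \<Longrightarrow> y j \<in> carrier R" "\<And>T. c T \<in> carrier M"
  shows "koszul M y s c S \<in> carrier M"
  by (rule koszul_mem[where P = "\<lambda>_. carrier M" and Q = "\<lambda>_. carrier M"]) (use assms in auto)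

lemma koszul_submodule:
  assumes "\<And>j. j < s \<Longrightarrow> y j \<in> carrier R" "submodule L R M" "\<And>T. c T \<in> L"
  shows "koszul M y s c S \<in> L"
  by (rule koszul_mem[where P = "\<lambda>_. L" and Q = "\<lambda>_. L"])
    (use assms submodule_zero submodule_diff submoduleE(4) in auto)

lemma koszul_cochains:
  assumes y: "\<And>j. j < s \<Longrightarrow> y j \<in> carrier R" and c: "c \<in> cochains M s d"
  shows "koszul M y s c \<in> cochains M s (d + 1)"
proof -
  \<comment> \<open>Support and closedness in one family of sets, so that \<open>koszul_mem\<close>
    does the induction; raising the degree is the passage from \<open>P d\<close> to
    \<open>P (d + 1)\<close>.\<close>
  define P where "P e S = {u \<in> carrier M. \<not> (S \<subseteq> {..<s} \<and> int (card S) = e) \<longrightarrow> u = \<zero>\<^bsub>M\<^esub>}" for e S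
  have PI: "y j \<odot>\<^bsub>M\<^esub> u \<in> P (d + 1) S" if j: "j < s" "j \<in> S" and u: "u \<in> P d (S - {j})" for j S u
  proof (cases "S - {j} \<subseteq> {..<s} \<and> int (card (S - {j})) = d")
    case True
    hence "S \<subseteq> {..<s}" using j by auto
    moreover from this have "finite S" using finite_subset by blast
    ultimately have "S \<subseteq> {..<s} \<and> int (card S) = d + 1"
      using True j card_Suc_Diff1[of S j] by linarith
    thus ?thesis using u y[OF j(1)] unfolding P_def by simp
  next
    case False
    hence "u = \<zero>\<^bsub>M\<^esub>" using u unfolding P_def by blast
    thus ?thesis using y[OF j(1)] unfolding P_def by simp
  qed
  have "koszul M y s c S \<in> P (d + 1) S" for S
  proof (rule koszul_mem[where P = "P d"])
    show "c T \<in> P d T" for T using c unfolding cochains_def P_def by blast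
    show "u \<ominus>\<^bsub>M\<^esub> v \<in> P (d + 1) S" if "u \<in> P (d + 1) S" "v \<in> P (d + 1) S" for S u v
      using that unfolding P_def by (simp add: M.minus_eq)
  qed (use PI in \<open>auto simp: P_def\<close>)
  thus ?thesis unfolding cochains_def P_def by blast
qed

text \<open>Up to sign the value at \<open>S\<close> is zero or \<open>c (insert j S)\<close>, and
  it can be nonzero only for \<open>j\<close> outside \<open>S\<close>. Closure under negation
  therefore replaces closure under differences.\<close>

lemma homotopy_mem:
  assumes "\<And>S. \<zero>\<^bsub>M\<^esub> \<in> Q S" "\<And>S u. u \<in> Q S \<Longrightarrow> \<ominus>\<^bsub>M\<^esub> u \<in> Q S"
    and "\<And>S. j \<notin> S \<Longrightarrow> c (insert j S) \<in> Q S"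
  shows "homotopy M j s c S \<in> Q S"
  using assms
proof (induction s arbitrary: c Q S)
  case (Suc s)
  have "homotopy M j s (\<lambda>T. c (insert s T)) (S - {s}) \<in> Q (insert s (S - {s}))" if "s \<noteq> j"
  proof (rule Suc.IH[where Q = "\<lambda>T. Q (insert s T)"])
    fix S assume "j \<notin> S"
    thus "c (insert s (insert j S)) \<in> Q (insert s S)"
      using Suc.prems(3)[of "insert s S"] that by (simp add: insert_commute)
  qed (use Suc.prems(1,2) in blast)+
  moreover have "insert s (S - {s}) = S" if "s \<in> S" using that by auto
  moreover have "homotopy M j s c S \<in> Q S" by (rule Suc.IH[where Q = Q]) (use Suc.prems in blast)+
  ultimately show ?case using Suc.prems by auto
qed simp

lemma homotopy_closed:
  assumes "\<And>T. c T \<in> carrier M"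
  shows "homotopy M j s c S \<in> carrier M"
  by (rule homotopy_mem[where Q = "\<lambda>_. carrier M"]) (use assms in \<open>auto simp del: homotopy.simps\<close>)

lemma homotopy_submodule:
  assumes "submodule L R M" "\<And>T. c T \<in> L"
  shows "homotopy M j s c S \<in> L"
  by (rule homotopy_mem[where Q = "\<lambda>_. L"]) (use assms submodule_zero submoduleE(3) in auto)

lemma homotopy_cochains:
  assumes j: "j < s" and c: "c \<in> cochains M s d"
  shows "homotopy M j s c \<in> cochains M s (d - 1)"
proof -
  define P where "P S = {u \<in> carrier M. \<not> (S \<subseteq> {..<s} \<and> int (card S) = d - 1) \<longrightarrow> u = \<zero>\<^bsub>M\<^esub>}" for S
  have PI: "c (insert j S) \<in> P S" if jS: "j \<notin> S" for S
  proof (cases "insert j S \<subseteq> {..<s} \<and> int (card (insert j S)) = d")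
    case True
    hence "finite S" using finite_subset[of S "{..<s}"] by simp
    hence "S \<subseteq> {..<s} \<and> int (card S) = d - 1" using True jS by simp
    moreover have "c (insert j S) \<in> carrier M" using c unfolding cochains_def by blast
    ultimately show ?thesis unfolding P_def by simp
  next
    case False
    hence "c (insert j S) = \<zero>\<^bsub>M\<^esub>" using c unfolding cochains_def by blast
    thus ?thesis unfolding P_def by simp
  qed
  have "homotopy M j s c S \<in> P S" for S
  proof (rule homotopy_mem[where Q = P])
    show "\<ominus>\<^bsub>M\<^esub> u \<in> P S" if "u \<in> P S" for S u
      using that unfolding P_def by simp
    show "\<zero>\<^bsub>M\<^esub> \<in> P S" for S unfolding P_def by simp
    show "c (insert j S) \<in> P S" if "j \<notin> S" for S by (fact PI[OF that])
  qed
  thus ?thesis unfolding cochains_def P_def by blast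
qed

text \<open>Linearity of \<open>h\<close> is demanded on \<open>P\<close> alone: multiplication by a
  scalar is used with \<open>P = carrier M\<close>, while the degree shift commutes with generators
  of degree one on sequences without constant term.\<close>

lemma koszul_hom:
  assumes "\<And>j. j < s \<Longrightarrow> y j \<in> carrier R"
    and "P \<subseteq> carrier M" "\<zero>\<^bsub>M\<^esub> \<in> P" "\<And>u v. u \<in> P \<Longrightarrow> v \<in> P \<Longrightarrow> u \<ominus>\<^bsub>M\<^esub> v \<in> P"
    and "\<And>j u. j < s \<Longrightarrow> u \<in> P \<Longrightarrow> y j \<odot>\<^bsub>M\<^esub> u \<in> P"
    and "h \<zero>\<^bsub>M\<^esub> = \<zero>\<^bsub>M\<^esub>" "\<And>u v. u \<in> P \<Longrightarrow> v \<in> P \<Longrightarrow> h (u \<ominus>\<^bsub>M\<^esub> v) = h u \<ominus>\<^bsub>M\<^esub> h v"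
    and "\<And>j u. j < s \<Longrightarrow> u \<in> P \<Longrightarrow> h (y j \<odot>\<^bsub>M\<^esub> u) = y j \<odot>\<^bsub>M\<^esub> h u"
    and "\<And>T. c T \<in> P"
  shows "h (koszul M y s c S) = koszul M y s (\<lambda>T. h (c T)) S"
  using assms
proof (induction s arbitrary: c S)
  case (Suc s)
  have IH: "h (koszul M y s c' U) = koszul M y s (\<lambda>T. h (c' T)) U" if "\<And>T. c' T \<in> P" for c' U
  proof (rule Suc.IH)
    show "y j \<in> carrier R" if "j < s" for j using Suc.prems(1) that by simp
    show "y j \<odot>\<^bsub>M\<^esub> u \<in> P" if "j < s" "u \<in> P" for j u using Suc.prems(5) that by simp
    show "h (y j \<odot>\<^bsub>M\<^esub> u) = y j \<odot>\<^bsub>M\<^esub> h u" if "j < s" "u \<in> P" for j u using Suc.prems(8) that by simp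
  qed (fact Suc.prems that)+
  have kP: "koszul M y s (\<lambda>T. c (insert s T)) (S - {s}) \<in> P"
  proof (rule koszul_mem[where P = "\<lambda>_. P" and Q = "\<lambda>_. P"])
    show "y j \<odot>\<^bsub>M\<^esub> u \<in> P" if "j < s" "j \<in> S" "u \<in> P" for j S u using Suc.prems(5) that by simp
  qed (fact Suc.prems)+
  have yP: "y s \<odot>\<^bsub>M\<^esub> c (S - {s}) \<in> P" using Suc.prems(5)[of s] Suc.prems(9) by simp
  have "h (y s \<odot>\<^bsub>M\<^esub> c (S - {s}) \<ominus>\<^bsub>M\<^esub> koszul M y s (\<lambda>T. c (insert s T)) (S - {s})) =
      y s \<odot>\<^bsub>M\<^esub> h (c (S - {s})) \<ominus>\<^bsub>M\<^esub> koszul M y s (\<lambda>T. h (c (insert s T))) (S - {s})"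
    using Suc.prems(7)[OF yP kP] Suc.prems(8)[OF _ Suc.prems(9)] IH[of "\<lambda>T. c (insert s T)", OF Suc.prems(9)]
    by simp
  thus ?case using IH[of c, OF Suc.prems(9)] by simp
qed simp

lemma koszul_smult:
  assumes "\<And>j. j < s \<Longrightarrow> y j \<in> carrier R" "x \<in> carrier R" "\<And>T. c T \<in> carrier M"
  shows "koszul M y s (\<lambda>T. x \<odot>\<^bsub>M\<^esub> c T) S = x \<odot>\<^bsub>M\<^esub> koszul M y s c S"
  by (rule koszul_hom[symmetric, where P = "carrier M" and h = "\<lambda>u. x \<odot>\<^bsub>M\<^esub> u"])
    (use assms in \<open>auto simp: smult_r_diff smult_left_comm\<close>)

lemma koszul_diff:
  assumes "\<And>j. j < s \<Longrightarrow> y j \<in> carrier R" "\<And>T. c T \<in> carrier M" "\<And>T. d T \<in> carrier M"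
  shows "koszul M y s (\<lambda>T. c T \<ominus>\<^bsub>M\<^esub> d T) S = koszul M y s c S \<ominus>\<^bsub>M\<^esub> koszul M y s d S"
  using assms
proof (induction s arbitrary: c d S)
  case 0
  show ?case by simp
next
  case (Suc s)
  have *: "koszul M y s (\<lambda>T. c (insert s T)) U \<in> carrier M" "koszul M y s (\<lambda>T. d (insert s T)) U \<in> carrier M"
    "y s \<odot>\<^bsub>M\<^esub> c U \<in> carrier M" "y s \<odot>\<^bsub>M\<^esub> d U \<in> carrier M" for U
    using koszul_closed Suc.prems by auto
  have "y s \<odot>\<^bsub>M\<^esub> (c U \<ominus>\<^bsub>M\<^esub> d U) \<ominus>\<^bsub>M\<^esub> (koszul M y s (\<lambda>T. c (insert s T)) U \<ominus>\<^bsub>M\<^esub> koszul M y s (\<lambda>T. d (insert s T)) U)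
    = y s \<odot>\<^bsub>M\<^esub> c U \<ominus>\<^bsub>M\<^esub> koszul M y s (\<lambda>T. c (insert s T)) U
      \<ominus>\<^bsub>M\<^esub> (y s \<odot>\<^bsub>M\<^esub> d U \<ominus>\<^bsub>M\<^esub> koszul M y s (\<lambda>T. d (insert s T)) U)" for U
    using *[of U] Suc.prems(1)[of s] Suc.prems(2)[of U] Suc.prems(3)[of U] by (simp add: smult_diff_diff)
  thus ?case using Suc.IH Suc.prems by simp
qed

lemma koszul_zero:
  assumes "\<And>j. j < s \<Longrightarrow> y j \<in> carrier R"
  shows "koszul M y s (\<lambda>S. \<zero>\<^bsub>M\<^esub>) S = \<zero>\<^bsub>M\<^esub>"
  by (rule singletonD, rule koszul_submodule[OF assms submodule_singleton_zero]) auto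

lemma homotopy_diff:
  assumes "\<And>T. c T \<in> carrier M" "\<And>T. d T \<in> carrier M"
  shows "homotopy M j s (\<lambda>T. c T \<ominus>\<^bsub>M\<^esub> d T) S = homotopy M j s c S \<ominus>\<^bsub>M\<^esub> homotopy M j s d S"
  using assms
proof (induction s arbitrary: c d S)
  case 0
  show ?case by simp
next
  case (Suc s)
  have *: "homotopy M j s (\<lambda>T. c (insert s T)) U \<in> carrier M" "homotopy M j s (\<lambda>T. d (insert s T)) U \<in> carrier M" for U
    using homotopy_closed Suc.prems by auto
  have "\<ominus>\<^bsub>M\<^esub> (homotopy M j s (\<lambda>T. c (insert s T)) U \<ominus>\<^bsub>M\<^esub> homotopy M j s (\<lambda>T. d (insert s T)) U) =
    \<ominus>\<^bsub>M\<^esub> homotopy M j s (\<lambda>T. c (insert s T)) U \<ominus>\<^bsub>M\<^esub> \<ominus>\<^bsub>M\<^esub> homotopy M j s (\<lambda>T. d (insert s T)) U" for U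
    using *[of U] by (simp add: minus_diff)
  thus ?case using Suc.IH Suc.prems by simp
qed

lemma homotopy_smult:
  assumes "x \<in> carrier R" "\<And>T. c T \<in> carrier M"
  shows "homotopy M j s (\<lambda>T. x \<odot>\<^bsub>M\<^esub> c T) S = x \<odot>\<^bsub>M\<^esub> homotopy M j s c S"
  using assms by (induction s arbitrary: c S) (simp_all add: smult_r_minus homotopy_closed)

text \<open>In the cone, the component of the square with index \<open>s\<close> is y_s dc - d(y_s c
  - dv), where v is the half of c with index \<open>s\<close>. Linearity and the induction
  hypothesis for v cancel everything.\<close>

lemma koszul_koszul:
  assumes "\<And>j. j < s \<Longrightarrow> y j \<in> carrier R" "\<And>T. c T \<in> carrier M"
  shows "koszul M y s (koszul M y s c) S = \<zero>\<^bsub>M\<^esub>"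
  using assms
proof (induction s arbitrary: c S)
  case (Suc s)
  let ?d = "koszul M y s"
  show ?case
  proof (cases "s \<in> S")
    case True
    define v where "v T = c (insert s T)" for T
    define U where "U = S - {s}"
    have sU0: "s \<notin> U" unfolding U_def by simp
    have sU: "insert s T - {s} = T" if "T \<subseteq> U" for T using that unfolding U_def by auto
    have cl: "c T \<in> carrier M" "v T \<in> carrier M" "?d c T \<in> carrier M" "?d v T \<in> carrier M" for T
      using Suc.prems koszul_closed unfolding v_def by auto
    have "?d (\<lambda>T. koszul M y (Suc s) c (insert s T)) U = ?d (\<lambda>T. y s \<odot>\<^bsub>M\<^esub> c T \<ominus>\<^bsub>M\<^esub> ?d v T) U"
      by (rule koszul_cong) (auto simp: v_def[abs_def] sU[simplified])
    also have "\<dots> = ?d (\<lambda>T. y s \<odot>\<^bsub>M\<^esub> c T) U \<ominus>\<^bsub>M\<^esub> ?d (?d v) U"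
      by (rule koszul_diff) (use Suc.prems cl in auto)
    also have "\<dots> = y s \<odot>\<^bsub>M\<^esub> ?d c U \<ominus>\<^bsub>M\<^esub> \<zero>\<^bsub>M\<^esub>"
      using Suc.IH[of v] Suc.prems cl koszul_smult[of s y "y s" c U] by simp
    finally have "?d (\<lambda>T. koszul M y (Suc s) c (insert s T)) U = y s \<odot>\<^bsub>M\<^esub> ?d c U \<ominus>\<^bsub>M\<^esub> \<zero>\<^bsub>M\<^esub>" .
    moreover have "koszul M y (Suc s) c U = ?d c U" by (simp add: U_def)
    ultimately have "koszul M y (Suc s) (koszul M y (Suc s) c) S = y s \<odot>\<^bsub>M\<^esub> ?d c U \<ominus>\<^bsub>M\<^esub> (y s \<odot>\<^bsub>M\<^esub> ?d c U \<ominus>\<^bsub>M\<^esub> \<zero>\<^bsub>M\<^esub>)"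
      using True sU0 by (simp add: U_def[symmetric])
    also have "\<dots> = \<zero>\<^bsub>M\<^esub>" using cl Suc.prems(1)[of s] by simp algebra
    finally show ?thesis .
  next
    case False
    have "koszul M y (Suc s) (koszul M y (Suc s) c) S = ?d (koszul M y (Suc s) c) S"
      using False by simp
    also have "\<dots> = ?d (?d c) S" by (rule koszul_cong) (use False in auto)
    finally show ?thesis using Suc by simp
  qed
qed simp

text \<open>For the last index the homotopy moves the half of the cone with that index to the half
  without it, and the anticommutator leaves y_s times the identity. For earlier indices the sign on
  the half containing \<open>s\<close> matches the sign in the cone differential, so that the claim
  reduces to the two halves.\<close>

lemma koszul_homotopy:
  assumes "\<And>j. j < s \<Longrightarrow> y j \<in> carrier R" "\<And>T. c T \<in> carrier M" "j < s"
  shows "koszul M y s (homotopy M j s c) S \<oplus>\<^bsub>M\<^esub> homotopy M j s (koszul M y s c) S = y j \<odot>\<^bsub>M\<^esub> c S"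
  using assms
proof (induction s arbitrary: c S)
  case (Suc s)
  let ?d = "koszul M y s" and ?d' = "koszul M y (Suc s)" and ?h = "homotopy M j s" and ?h' = "homotopy M j (Suc s)"
  define v where "v T = c (insert s T)" for T
  define U where "U = S - {s}"
  have sU0: "s \<notin> U" unfolding U_def by simp
  have sU: "insert s T - {s} = T" if "T \<subseteq> U" for T using that unfolding U_def by auto
  have sjU: "insert s T - {s} = T" if "T \<subseteq> insert j U" "j \<noteq> s" for T using that unfolding U_def by auto
  have cl: "c T \<in> carrier M" "v T \<in> carrier M" for T
    using Suc.prems unfolding v_def by auto
  have cl': "?d c T \<in> carrier M" "?d v T \<in> carrier M" "?h c T \<in> carrier M" "?h v T \<in> carrier M" for T
    using Suc.prems koszul_closed homotopy_closed cl by auto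
  have cl'': "?d (?h v) T \<in> carrier M" "?h (?d v) T \<in> carrier M" "?h (?d c) T \<in> carrier M" for T
    using Suc.prems koszul_closed homotopy_closed cl' by auto
  have ys: "y s \<in> carrier R" and yj: "y j \<in> carrier R" using Suc.prems by auto
  show ?case
  proof (cases "j = s")
    case True
    show ?thesis
    proof (cases "s \<in> S")
      case sS: True
      have "?d (\<lambda>T. ?h' c (insert s T)) U = ?d (\<lambda>T. \<zero>\<^bsub>M\<^esub> \<ominus>\<^bsub>M\<^esub> \<zero>\<^bsub>M\<^esub>) U"
        by (rule koszul_cong) (use True in auto)
      also have "\<dots> = \<zero>\<^bsub>M\<^esub>" using Suc.prems koszul_closed[of s y "\<lambda>_. \<zero>\<^bsub>M\<^esub>"] by (subst koszul_diff) (auto simp: M.minus_eq M.r_neg)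
      finally have 1: "?d (\<lambda>T. ?h' c (insert s T)) U = \<zero>\<^bsub>M\<^esub>" .
      have "?h' c U = c S" using True sS by (auto simp: U_def insert_absorb)
      hence "?d' (?h' c) S = y s \<odot>\<^bsub>M\<^esub> c S \<ominus>\<^bsub>M\<^esub> \<zero>\<^bsub>M\<^esub>"
        using sS 1 True sU0 by (simp add: U_def[symmetric])
      moreover have "?h' (?d' c) S = \<zero>\<^bsub>M\<^esub>" using True sS by simp
      moreover have "y s \<odot>\<^bsub>M\<^esub> c S \<ominus>\<^bsub>M\<^esub> \<zero>\<^bsub>M\<^esub> \<oplus>\<^bsub>M\<^esub> \<zero>\<^bsub>M\<^esub> = y s \<odot>\<^bsub>M\<^esub> c S" using cl(1)[of S] ys by algebra
      ultimately show ?thesis using True by simp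
    next
      case sS: False
      have "?d' (?h' c) S = ?d v S"
        using sS True by (auto simp: v_def intro!: koszul_cong)
      moreover have "S - {s} = S" using sS by auto
      hence "?h' (?d' c) S = y s \<odot>\<^bsub>M\<^esub> c S \<ominus>\<^bsub>M\<^esub> ?d v S" using True sS by (simp add: v_def[abs_def])
      moreover have "?d v S \<oplus>\<^bsub>M\<^esub> (y s \<odot>\<^bsub>M\<^esub> c S \<ominus>\<^bsub>M\<^esub> ?d v S) = y s \<odot>\<^bsub>M\<^esub> c S" using cl(1)[of S] cl'(2)[of S] ys by algebra
      ultimately show ?thesis using True by simp
    qed
  next
    case False
    hence j: "j < s" using Suc.prems by simp
    show ?thesis
    proof (cases "s \<in> S")
      case True
      have "?d (\<lambda>T. ?h' c (insert s T)) U = ?d (\<lambda>T. \<zero>\<^bsub>M\<^esub> \<ominus>\<^bsub>M\<^esub> ?h v T) U"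
        by (rule koszul_cong) (use False cl' in \<open>auto simp: v_def[abs_def] sU[simplified] M.minus_eq\<close>)
      also have "\<dots> = ?d (\<lambda>T. \<zero>\<^bsub>M\<^esub>) U \<ominus>\<^bsub>M\<^esub> ?d (?h v) U"
        by (rule koszul_diff) (use Suc.prems cl' in auto)
      also have "?d (\<lambda>T. \<zero>\<^bsub>M\<^esub>) U = \<zero>\<^bsub>M\<^esub>" by (rule koszul_zero) (use Suc.prems in auto)
      finally have 1: "?d (\<lambda>T. ?h' c (insert s T)) U = \<zero>\<^bsub>M\<^esub> \<ominus>\<^bsub>M\<^esub> ?d (?h v) U" .
      have "?h' c U = ?h c U" using False by (simp add: U_def)
      hence A: "?d' (?h' c) S = y s \<odot>\<^bsub>M\<^esub> ?h c U \<ominus>\<^bsub>M\<^esub> (\<zero>\<^bsub>M\<^esub> \<ominus>\<^bsub>M\<^esub> ?d (?h v) U)"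
        using True 1 False sU0 by (simp add: U_def[symmetric])
      have "?h (\<lambda>T. ?d' c (insert s T)) U = ?h (\<lambda>T. y s \<odot>\<^bsub>M\<^esub> c T \<ominus>\<^bsub>M\<^esub> ?d v T) U"
        by (rule homotopy_cong) (use False in \<open>auto simp: v_def[abs_def] sjU[simplified]\<close>)
      also have "\<dots> = ?h (\<lambda>T. y s \<odot>\<^bsub>M\<^esub> c T) U \<ominus>\<^bsub>M\<^esub> ?h (?d v) U"
        by (rule homotopy_diff) (use cl cl' ys in auto)
      also have "?h (\<lambda>T. y s \<odot>\<^bsub>M\<^esub> c T) U = y s \<odot>\<^bsub>M\<^esub> ?h c U"
        by (rule homotopy_smult) (use cl ys in auto)
      finally have B: "?h' (?d' c) S = \<ominus>\<^bsub>M\<^esub> (y s \<odot>\<^bsub>M\<^esub> ?h c U \<ominus>\<^bsub>M\<^esub> ?h (?d v) U)"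
        using True False sU0 by (simp add: U_def[symmetric])
      have "?d (?h v) U \<oplus>\<^bsub>M\<^esub> ?h (?d v) U = y j \<odot>\<^bsub>M\<^esub> v U"
        by (rule Suc.IH) (use Suc.prems cl j in auto)
      moreover have "v U = c S" using True by (auto simp: v_def U_def insert_absorb)
      moreover have "y s \<odot>\<^bsub>M\<^esub> ?h c U \<ominus>\<^bsub>M\<^esub> (\<zero>\<^bsub>M\<^esub> \<ominus>\<^bsub>M\<^esub> ?d (?h v) U) \<oplus>\<^bsub>M\<^esub> \<ominus>\<^bsub>M\<^esub> (y s \<odot>\<^bsub>M\<^esub> ?h c U \<ominus>\<^bsub>M\<^esub> ?h (?d v) U)
          = ?d (?h v) U \<oplus>\<^bsub>M\<^esub> ?h (?d v) U"
        using cl'(3)[of U] cl''(1,2)[of U] ys by algebra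
      ultimately show ?thesis using A B by simp
    next
      case sS: False
      have "?d' (?h' c) S = ?d (?h c) S"
        using sS False by (auto intro!: koszul_cong)
      moreover have "?h' (?d' c) S = ?h (?d c) S"
        using sS False by (auto intro!: homotopy_cong)
      moreover have "?d (?h c) S \<oplus>\<^bsub>M\<^esub> ?h (?d c) S = y j \<odot>\<^bsub>M\<^esub> c S"
        by (rule Suc.IH) (use Suc.prems cl j in auto)
      ultimately show ?thesis by simp
    qed
  qed
qed simp


lemma cochains_closed: "c \<in> cochains M s d \<Longrightarrow> c S \<in> carrier M"
  unfolding cochains_def by blast

lemma cochains_diff:
  assumes "b \<in> cochains M s d" "c \<in> cochains M s d"
  shows "(\<lambda>S. b S \<ominus>\<^bsub>M\<^esub> c S) \<in> cochains M s d"
proof -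
  have "b S \<ominus>\<^bsub>M\<^esub> c S = \<zero>\<^bsub>M\<^esub>" if "\<not> (S \<subseteq> {..<s} \<and> int (card S) = d)" for S
  proof -
    have "b S = \<zero>\<^bsub>M\<^esub>" "c S = \<zero>\<^bsub>M\<^esub>" using assms that unfolding cochains_def by blast+
    thus ?thesis by simp
  qed
  moreover have "b S \<ominus>\<^bsub>M\<^esub> c S \<in> carrier M" for S using assms cochains_closed by simp
  ultimately show ?thesis unfolding cochains_def by blast
qed

lemma cochains_smult:
  assumes "c \<in> cochains M s d" "x \<in> carrier R"
  shows "(\<lambda>S. x \<odot>\<^bsub>M\<^esub> c S) \<in> cochains M s d"
proof -
  have "x \<odot>\<^bsub>M\<^esub> c S = \<zero>\<^bsub>M\<^esub>" if "\<not> (S \<subseteq> {..<s} \<and> int (card S) = d)" for S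
  proof -
    have "c S = \<zero>\<^bsub>M\<^esub>" using assms that unfolding cochains_def by blast
    thus ?thesis using assms by simp
  qed
  moreover have "x \<odot>\<^bsub>M\<^esub> c S \<in> carrier M" for S using assms cochains_closed by simp
  ultimately show ?thesis unfolding cochains_def by blast
qed

lemma cochains_zero: "(\<lambda>S. \<zero>\<^bsub>M\<^esub>) \<in> cochains M s d"
  unfolding cochains_def by simp

text \<open>Values chosen pointwise are reset to zero off the index sets of size \<open>d\<close>;
  that \<open>Q\<close> holds at zero makes the reset harmless.\<close>

lemma cochains_choice:
  assumes "c \<in> cochains M s d" "\<And>S. \<exists>e\<in>carrier M. Q (c S) e" "Q \<zero>\<^bsub>M\<^esub> \<zero>\<^bsub>M\<^esub>"
  shows "\<exists>e\<in>cochains M s d. \<forall>S. Q (c S) (e S)"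
proof -
  obtain e where e: "\<And>S. e S \<in> carrier M \<and> Q (c S) (e S)" using assms(2) by metis
  let ?e = "\<lambda>S. if S \<subseteq> {..<s} \<and> int (card S) = d then e S else \<zero>\<^bsub>M\<^esub>"
  have "?e \<in> cochains M s d" unfolding cochains_def using e by simp
  moreover have "Q (c S) (?e S)" for S
  proof (cases "S \<subseteq> {..<s} \<and> int (card S) = d")
    case False
    hence "c S = \<zero>\<^bsub>M\<^esub>" using assms(1) unfolding cochains_def by blast
    thus ?thesis using assms(3) False by auto
  qed (use e in simp)
  ultimately show ?thesis by (intro bexI[of _ ?e] allI)
qed

lemma module_span_submodule:
  assumes "S \<subseteq> carrier M"
  shows "submodule (module_span R M S) R M"
proof (rule submoduleI_diff)
  show "module_span R M S \<subseteq> carrier M"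
    unfolding module_span_def using carrier_is_submodule assms by blast
qed (auto simp: module_span_def submodule_zero submodule_diff submoduleE(4))

end

text \<open>The submodule \<open>L + S M\<close>.\<close>

definition adjoin :: "('a, 'r) ring_scheme \<Rightarrow> ('a, 'b, 'c) module_scheme \<Rightarrow> 'b set \<Rightarrow> 'a set \<Rightarrow> 'b set"
  where "adjoin R M L S = module_span R M (L \<union> {a \<odot>\<^bsub>M\<^esub> x | a x. a \<in> S \<and> x \<in> carrier M})"

lemma module_span_superset: "S \<subseteq> module_span R M S"
  unfolding module_span_def by blast

lemma module_span_minimal: "submodule N R M \<Longrightarrow> S \<subseteq> N \<Longrightarrow> module_span R M S \<subseteq> N"
  unfolding module_span_def by blast

lemma adjoin_superset: "L \<subseteq> adjoin R M L S"
  unfolding adjoin_def using module_span_superset by fast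

lemma adjoin_mem: "a \<in> S \<Longrightarrow> x \<in> carrier M \<Longrightarrow> a \<odot>\<^bsub>M\<^esub> x \<in> adjoin R M L S"
  unfolding adjoin_def by (rule subsetD[OF module_span_superset]) blast

lemma adjoin_minimal:
  assumes "submodule N R M" "L \<subseteq> N" "\<And>a x. a \<in> S \<Longrightarrow> x \<in> carrier M \<Longrightarrow> a \<odot>\<^bsub>M\<^esub> x \<in> N"
  shows "adjoin R M L S \<subseteq> N"
  unfolding adjoin_def by (rule module_span_minimal[OF assms(1)]) (use assms(2,3) in blast)

section \<open>Adjoining multiples, and the long exact sequence of a regular element\<close>

context module
begin

lemma adjoin_submodule:
  assumes "L \<subseteq> carrier M" "S \<subseteq> carrier R"
  shows "submodule (adjoin R M L S) R M"
  unfolding adjoin_def by (rule module_span_submodule) (use assms in auto)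

lemma adjoin_empty:
  assumes "submodule L R M"
  shows "adjoin R M L {} = L"
  using adjoin_minimal[OF assms, of L "{}"] adjoin_superset[of L R M "{}"] by blast

lemma adjoin_mono:
  assumes "L \<subseteq> carrier M" "L' \<subseteq> L" "S \<subseteq> carrier R" "S' \<subseteq> S"
  shows "adjoin R M L' S' \<subseteq> adjoin R M L S"
  by (rule adjoin_minimal[OF adjoin_submodule[OF assms(1,3)]])
    (use assms adjoin_superset[of L R M S] adjoin_mem[of _ S _ M R L] in blast)+

lemma adjoin_adjoin:
  assumes "L \<subseteq> carrier M" "S \<subseteq> carrier R" "T \<subseteq> carrier R"
  shows "adjoin R M (adjoin R M L S) T = adjoin R M L (S \<union> T)"
proof -
  let ?L = "adjoin R M L S"
  have 1: "submodule ?L R M" "submodule (adjoin R M L (S \<union> T)) R M"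
    using assms by (auto intro!: adjoin_submodule)
  have L: "?L \<subseteq> carrier M" using submoduleE(1)[OF 1(1)] .
  have 2: "submodule (adjoin R M ?L T) R M" using adjoin_submodule[OF L assms(3)] .
  show ?thesis
  proof
    show "adjoin R M ?L T \<subseteq> adjoin R M L (S \<union> T)"
      by (rule adjoin_minimal[OF 1(2)]) (use adjoin_mono[of L L "S \<union> T" S] assms in \<open>auto intro: adjoin_mem\<close>)
    show "adjoin R M L (S \<union> T) \<subseteq> adjoin R M ?L T"
      by (rule adjoin_minimal[OF 2])
        (use adjoin_superset[of ?L R M T] adjoin_superset[of L R M S] in \<open>auto intro: adjoin_mem\<close>)
  qed
qed

text \<open>For a single scalar the set of sums from \<open>L\<close> and \<open>x M\<close> is
  already a submodule. This makes division by \<open>x\<close> modulo \<open>L\<close>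
  explicit.\<close>

lemma adjoin_singleton:
  assumes L: "submodule L R M" and x: "x \<in> carrier R"
  shows "u \<in> adjoin R M L {x} \<longleftrightarrow> (\<exists>n\<in>carrier M. u \<in> carrier M \<and> u \<ominus>\<^bsub>M\<^esub> x \<odot>\<^bsub>M\<^esub> n \<in> L)"
proof
  define N where "N = {u. \<exists>n\<in>carrier M. u \<in> carrier M \<and> u \<ominus>\<^bsub>M\<^esub> x \<odot>\<^bsub>M\<^esub> n \<in> L}"
  have "submodule N R M"
  proof (rule submoduleI_diff)
    have "\<zero>\<^bsub>M\<^esub> \<ominus>\<^bsub>M\<^esub> x \<odot>\<^bsub>M\<^esub> \<zero>\<^bsub>M\<^esub> \<in> L" using x submodule_zero[OF L] by simp
    thus "\<zero>\<^bsub>M\<^esub> \<in> N" unfolding N_def by blast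
    fix a b assume "a \<in> N" "b \<in> N"
    then obtain m n where c: "m \<in> carrier M" "n \<in> carrier M" "a \<in> carrier M" "b \<in> carrier M"
      and l: "a \<ominus>\<^bsub>M\<^esub> x \<odot>\<^bsub>M\<^esub> m \<in> L" "b \<ominus>\<^bsub>M\<^esub> x \<odot>\<^bsub>M\<^esub> n \<in> L" unfolding N_def by blast
    have "(a \<ominus>\<^bsub>M\<^esub> b) \<ominus>\<^bsub>M\<^esub> x \<odot>\<^bsub>M\<^esub> (m \<ominus>\<^bsub>M\<^esub> n) = (a \<ominus>\<^bsub>M\<^esub> x \<odot>\<^bsub>M\<^esub> m) \<ominus>\<^bsub>M\<^esub> (b \<ominus>\<^bsub>M\<^esub> x \<odot>\<^bsub>M\<^esub> n)" using c x by algebra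
    hence "(a \<ominus>\<^bsub>M\<^esub> b) \<ominus>\<^bsub>M\<^esub> x \<odot>\<^bsub>M\<^esub> (m \<ominus>\<^bsub>M\<^esub> n) \<in> L" using submodule_diff[OF L l] by simp
    thus "a \<ominus>\<^bsub>M\<^esub> b \<in> N" unfolding N_def using c M.minus_closed by blast
  next
    fix r a assume r: "r \<in> carrier R" and "a \<in> N"
    then obtain m where c: "m \<in> carrier M" "a \<in> carrier M" and l: "a \<ominus>\<^bsub>M\<^esub> x \<odot>\<^bsub>M\<^esub> m \<in> L"
      unfolding N_def by blast
    have "r \<odot>\<^bsub>M\<^esub> a \<ominus>\<^bsub>M\<^esub> x \<odot>\<^bsub>M\<^esub> (r \<odot>\<^bsub>M\<^esub> m) = r \<odot>\<^bsub>M\<^esub> (a \<ominus>\<^bsub>M\<^esub> x \<odot>\<^bsub>M\<^esub> m)"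
      using c r x by (simp add: smult_r_diff smult_left_comm)
    hence "r \<odot>\<^bsub>M\<^esub> a \<ominus>\<^bsub>M\<^esub> x \<odot>\<^bsub>M\<^esub> (r \<odot>\<^bsub>M\<^esub> m) \<in> L" using submoduleE(4)[OF L r l] by simp
    thus "r \<odot>\<^bsub>M\<^esub> a \<in> N" unfolding N_def using c r smult_closed by blast
  qed (auto simp: N_def)
  moreover have "L \<subseteq> N"
  proof
    fix u assume u: "u \<in> L"
    hence "u \<in> carrier M" using submodule_carrier L by blast
    moreover from this have "u \<ominus>\<^bsub>M\<^esub> x \<odot>\<^bsub>M\<^esub> \<zero>\<^bsub>M\<^esub> = u" using x by simp
    ultimately show "u \<in> N" unfolding N_def using u by (intro CollectI bexI[of _ "\<zero>\<^bsub>M\<^esub>"]) simp_all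
  qed
  moreover have "a \<odot>\<^bsub>M\<^esub> n \<in> N" if "a \<in> {x}" "n \<in> carrier M" for a n
  proof -
    have "x \<odot>\<^bsub>M\<^esub> n \<ominus>\<^bsub>M\<^esub> x \<odot>\<^bsub>M\<^esub> n = \<zero>\<^bsub>M\<^esub>" using that x by algebra
    thus ?thesis unfolding N_def using that x submodule_zero[OF L]
      by (intro CollectI bexI[of _ n]) simp_all
  qed
  ultimately have "adjoin R M L {x} \<subseteq> N" by (rule adjoin_minimal)
  thus "u \<in> adjoin R M L {x} \<Longrightarrow> \<exists>n\<in>carrier M. u \<in> carrier M \<and> u \<ominus>\<^bsub>M\<^esub> x \<odot>\<^bsub>M\<^esub> n \<in> L"
    unfolding N_def by blast
next
  assume "\<exists>n\<in>carrier M. u \<in> carrier M \<and> u \<ominus>\<^bsub>M\<^esub> x \<odot>\<^bsub>M\<^esub> n \<in> L"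
  then obtain n where n: "n \<in> carrier M" "u \<in> carrier M" "u \<ominus>\<^bsub>M\<^esub> x \<odot>\<^bsub>M\<^esub> n \<in> L" by blast
  have "submodule (adjoin R M L {x}) R M"
    using adjoin_submodule[of L "{x}"] submoduleE(1)[OF L] x by blast
  moreover have "u \<ominus>\<^bsub>M\<^esub> x \<odot>\<^bsub>M\<^esub> n \<in> adjoin R M L {x}" using n adjoin_superset by fast
  moreover have "x \<odot>\<^bsub>M\<^esub> n \<in> adjoin R M L {x}" using n adjoin_mem by fast
  ultimately show "u \<in> adjoin R M L {x}"
    using submodule_mem_of_diff[of _ u "x \<odot>\<^bsub>M\<^esub> n"] n x by blast
qed

text \<open>Long exact sequence of multiplication by \<open>x\<close> on \<open>M/L\<close>, which
  is injective by \<open>reg\<close>: the cohomology of \<open>M/(L + x M)\<close> in degree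
  \<open>d\<close> sits between that of \<open>M/L\<close> in degrees \<open>d\<close> and
  \<open>d + 1\<close>.\<close>

lemma koszul_exact_adjoin:
  assumes y: "\<And>j. j < s \<Longrightarrow> y j \<in> carrier R" and L: "submodule L R M" and x: "x \<in> carrier R"
    and reg: "\<And>z. z \<in> carrier M \<Longrightarrow> x \<odot>\<^bsub>M\<^esub> z \<in> L \<Longrightarrow> z \<in> L"
    and ex: "koszul_exact M y s L d" "koszul_exact M y s L (d + 1)"
  shows "koszul_exact M y s (adjoin R M L {x}) d"
  unfolding koszul_exact_def
proof (intro ballI impI)
  let ?d = "koszul M y s"
  have dc: "?d c S \<in> carrier M" if "c \<in> cochains M s e" for c e S
    by (rule koszul_closed[OF y cochains_closed[OF that]])
  have zz: "\<zero>\<^bsub>M\<^esub> \<ominus>\<^bsub>M\<^esub> x \<odot>\<^bsub>M\<^esub> \<zero>\<^bsub>M\<^esub> \<in> L" using x submodule_zero[OF L] by simp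
  fix c assume c: "c \<in> cochains M s d" and "\<forall>S. ?d c S \<in> adjoin R M L {x}"
  hence ce: "\<exists>e\<in>carrier M. ?d c S \<ominus>\<^bsub>M\<^esub> x \<odot>\<^bsub>M\<^esub> e \<in> L" for S using adjoin_singleton[OF L x] by blast
  \<comment> \<open>\<open>e\<close> represents the image of the class of \<open>c\<close> under the
    connecting map: divide \<open>?d c\<close> by \<open>x\<close> modulo \<open>L\<close>.\<close>
  obtain e where e: "e \<in> cochains M s (d + 1)" "\<And>S. ?d c S \<ominus>\<^bsub>M\<^esub> x \<odot>\<^bsub>M\<^esub> e S \<in> L"
    using cochains_choice[where Q = "\<lambda>u v. u \<ominus>\<^bsub>M\<^esub> x \<odot>\<^bsub>M\<^esub> v \<in> L", OF koszul_cochains[OF y c] ce zz] by blast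
  note cl = cochains_closed[OF c] cochains_closed[OF e(1)] dc[OF c] dc[OF e(1)]
  \<comment> \<open>\<open>e\<close> is a cocycle modulo \<open>L\<close>, because \<open>x\<close>
    times its differential lies in \<open>L\<close> and \<open>x\<close> is regular.\<close>
  have "?d e S \<in> L" for S
  proof -
    have "?d (\<lambda>S. ?d c S \<ominus>\<^bsub>M\<^esub> x \<odot>\<^bsub>M\<^esub> e S) S \<in> L" by (rule koszul_submodule[OF y L e(2)])
    also have "?d (\<lambda>S. ?d c S \<ominus>\<^bsub>M\<^esub> x \<odot>\<^bsub>M\<^esub> e S) S = ?d (?d c) S \<ominus>\<^bsub>M\<^esub> ?d (\<lambda>S. x \<odot>\<^bsub>M\<^esub> e S) S"
      by (rule koszul_diff) (use y cl x in auto)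
    also have "?d (?d c) S = \<zero>\<^bsub>M\<^esub>" by (rule koszul_koszul) (use y cl in auto)
    also have "?d (\<lambda>S. x \<odot>\<^bsub>M\<^esub> e S) S = x \<odot>\<^bsub>M\<^esub> ?d e S" by (rule koszul_smult) (use y cl x in auto)
    finally have "\<zero>\<^bsub>M\<^esub> \<ominus>\<^bsub>M\<^esub> (\<zero>\<^bsub>M\<^esub> \<ominus>\<^bsub>M\<^esub> x \<odot>\<^bsub>M\<^esub> ?d e S) \<in> L" using submodule_diff[OF L] submodule_zero[OF L] by blast
    moreover have "\<zero>\<^bsub>M\<^esub> \<ominus>\<^bsub>M\<^esub> (\<zero>\<^bsub>M\<^esub> \<ominus>\<^bsub>M\<^esub> z) = z" if "z \<in> carrier M" for z using that by algebra
    ultimately have "x \<odot>\<^bsub>M\<^esub> ?d e S \<in> L" using x dc[OF e(1)] by simp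
    thus "?d e S \<in> L" using reg dc[OF e(1)] by blast
  qed
  hence "\<exists>f\<in>cochains M s (d + 1 - 1). \<forall>S. e S \<ominus>\<^bsub>M\<^esub> ?d f S \<in> L"
    using ex(2) e(1) unfolding koszul_exact_def by blast
  then obtain f where f: "f \<in> cochains M s d" "\<And>S. e S \<ominus>\<^bsub>M\<^esub> ?d f S \<in> L" by auto
  \<comment> \<open>Subtracting \<open>x\<close> times a primitive \<open>f\<close> of
    \<open>e\<close> lifts \<open>c\<close> from a cocycle of \<open>M/(L + x M)\<close> to a
    cocycle of \<open>M/L\<close>.\<close>
  have cf: "(\<lambda>S. c S \<ominus>\<^bsub>M\<^esub> x \<odot>\<^bsub>M\<^esub> f S) \<in> cochains M s d" using cochains_diff[OF c cochains_smult[OF f(1) x]] .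
  have "?d (\<lambda>S. c S \<ominus>\<^bsub>M\<^esub> x \<odot>\<^bsub>M\<^esub> f S) S \<in> L" for S
  proof -
    have "?d (\<lambda>S. c S \<ominus>\<^bsub>M\<^esub> x \<odot>\<^bsub>M\<^esub> f S) S = ?d c S \<ominus>\<^bsub>M\<^esub> ?d (\<lambda>S. x \<odot>\<^bsub>M\<^esub> f S) S"
      by (rule koszul_diff) (use y cl f x cochains_closed in auto)
    also have "?d (\<lambda>S. x \<odot>\<^bsub>M\<^esub> f S) S = x \<odot>\<^bsub>M\<^esub> ?d f S" by (rule koszul_smult) (use y f cochains_closed x in auto)
    also have "p \<ominus>\<^bsub>M\<^esub> x \<odot>\<^bsub>M\<^esub> q = (p \<ominus>\<^bsub>M\<^esub> x \<odot>\<^bsub>M\<^esub> r) \<oplus>\<^bsub>M\<^esub> x \<odot>\<^bsub>M\<^esub> (r \<ominus>\<^bsub>M\<^esub> q)"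
      if "p \<in> carrier M" "q \<in> carrier M" "r \<in> carrier M" for p q r using that x by algebra
    hence "?d c S \<ominus>\<^bsub>M\<^esub> x \<odot>\<^bsub>M\<^esub> ?d f S = (?d c S \<ominus>\<^bsub>M\<^esub> x \<odot>\<^bsub>M\<^esub> e S) \<oplus>\<^bsub>M\<^esub> x \<odot>\<^bsub>M\<^esub> (e S \<ominus>\<^bsub>M\<^esub> ?d f S)"
      using cl dc[OF f(1)] by blast
    finally show ?thesis using submoduleE(5)[OF L e(2) submoduleE(4)[OF L x f(2)]] by simp
  qed
  then obtain b where b: "b \<in> cochains M s (d - 1)" "\<And>S. (c S \<ominus>\<^bsub>M\<^esub> x \<odot>\<^bsub>M\<^esub> f S) \<ominus>\<^bsub>M\<^esub> ?d b S \<in> L"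
    using ex(1) cf unfolding koszul_exact_def by blast
  have "c S \<ominus>\<^bsub>M\<^esub> ?d b S \<in> adjoin R M L {x}" for S
  proof -
    have "(p \<ominus>\<^bsub>M\<^esub> q) \<ominus>\<^bsub>M\<^esub> x \<odot>\<^bsub>M\<^esub> r = (p \<ominus>\<^bsub>M\<^esub> x \<odot>\<^bsub>M\<^esub> r) \<ominus>\<^bsub>M\<^esub> q"
      if "p \<in> carrier M" "q \<in> carrier M" "r \<in> carrier M" for p q r using that x by algebra
    hence "(c S \<ominus>\<^bsub>M\<^esub> ?d b S) \<ominus>\<^bsub>M\<^esub> x \<odot>\<^bsub>M\<^esub> f S = (c S \<ominus>\<^bsub>M\<^esub> x \<odot>\<^bsub>M\<^esub> f S) \<ominus>\<^bsub>M\<^esub> ?d b S"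
      using cochains_closed c f(1) dc[OF b(1)] by blast
    hence "(c S \<ominus>\<^bsub>M\<^esub> ?d b S) \<ominus>\<^bsub>M\<^esub> x \<odot>\<^bsub>M\<^esub> f S \<in> L" using b(2) by simp
    thus ?thesis
      using adjoin_singleton[OF L x] M.minus_closed[OF cochains_closed[OF c] dc[OF b(1)]] cochains_closed[OF f(1)]
      by blast
  qed
  thus "\<exists>b\<in>cochains M s (d - 1). \<forall>S. c S \<ominus>\<^bsub>M\<^esub> ?d b S \<in> adjoin R M L {x}" using b(1) by blast
qed

text \<open>By \<open>kill\<close>, multiplication by \<open>x\<close> is zero on the cohomology of
  \<open>M/L\<close> in degree \<open>d + 1\<close>, so the connecting map onto it from degree
  \<open>d\<close> of \<open>M/(L + x M)\<close> is surjective.\<close>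

lemma koszul_exact_of_adjoin:
  assumes y: "\<And>j. j < s \<Longrightarrow> y j \<in> carrier R" and L: "submodule L R M" and x: "x \<in> carrier R"
    and reg: "\<And>z. z \<in> carrier M \<Longrightarrow> x \<odot>\<^bsub>M\<^esub> z \<in> L \<Longrightarrow> z \<in> L"
    and kill: "\<And>c. \<lbrakk>c \<in> cochains M s (d + 1); \<And>S. koszul M y s c S \<in> L\<rbrakk>
      \<Longrightarrow> \<exists>b\<in>cochains M s d. \<forall>S. x \<odot>\<^bsub>M\<^esub> c S \<ominus>\<^bsub>M\<^esub> koszul M y s b S \<in> L"
    and ex: "koszul_exact M y s (adjoin R M L {x}) d"
  shows "koszul_exact M y s L (d + 1)"
  unfolding koszul_exact_def
proof (intro ballI impI)
  let ?d = "koszul M y s"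
  have dc: "?d c S \<in> carrier M" if "c \<in> cochains M s e" for c e S
    by (rule koszul_closed[OF y cochains_closed[OF that]])
  fix c assume c: "c \<in> cochains M s (d + 1)" and "\<forall>S. ?d c S \<in> L"
  then obtain b where b: "b \<in> cochains M s d" "\<And>S. x \<odot>\<^bsub>M\<^esub> c S \<ominus>\<^bsub>M\<^esub> ?d b S \<in> L" using kill by blast
  note cl = cochains_closed[OF c] cochains_closed[OF b(1)] dc[OF c] dc[OF b(1)]
  \<comment> \<open>\<open>b\<close> is a cocycle modulo \<open>L + x M\<close>, and the connecting
    map sends its class to that of \<open>c\<close>.\<close>
  have "?d b S \<in> adjoin R M L {x}" for S
  proof -
    have "p \<ominus>\<^bsub>M\<^esub> x \<odot>\<^bsub>M\<^esub> q = \<zero>\<^bsub>M\<^esub> \<ominus>\<^bsub>M\<^esub> (x \<odot>\<^bsub>M\<^esub> q \<ominus>\<^bsub>M\<^esub> p)"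
      if "p \<in> carrier M" "q \<in> carrier M" for p q using that x by algebra
    hence "?d b S \<ominus>\<^bsub>M\<^esub> x \<odot>\<^bsub>M\<^esub> c S \<in> L"
      using submodule_diff[OF L submodule_zero[OF L] b(2)[of S]] cl by simp
    thus ?thesis using adjoin_singleton[OF L x] cl by blast
  qed
  then obtain e where e: "e \<in> cochains M s (d - 1)" "\<And>S. b S \<ominus>\<^bsub>M\<^esub> ?d e S \<in> adjoin R M L {x}"
    using ex b(1) unfolding koszul_exact_def by blast
  have dek: "?d e \<in> cochains M s d" using koszul_cochains[OF y e(1)] by simp
  have be: "(\<lambda>S. b S \<ominus>\<^bsub>M\<^esub> ?d e S) \<in> cochains M s d" by (rule cochains_diff[OF b(1) dek])
  have bf: "\<exists>f\<in>carrier M. (b S \<ominus>\<^bsub>M\<^esub> ?d e S) \<ominus>\<^bsub>M\<^esub> x \<odot>\<^bsub>M\<^esub> f \<in> L" for S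
    using adjoin_singleton[OF L x] e(2)[of S] by blast
  have zz: "\<zero>\<^bsub>M\<^esub> \<ominus>\<^bsub>M\<^esub> x \<odot>\<^bsub>M\<^esub> \<zero>\<^bsub>M\<^esub> \<in> L" using x submodule_zero[OF L] by simp
  obtain f where f: "f \<in> cochains M s d" "\<And>S. (b S \<ominus>\<^bsub>M\<^esub> ?d e S) \<ominus>\<^bsub>M\<^esub> x \<odot>\<^bsub>M\<^esub> f S \<in> L"
    using cochains_choice[where Q = "\<lambda>u v. u \<ominus>\<^bsub>M\<^esub> x \<odot>\<^bsub>M\<^esub> v \<in> L", OF be bf zz] by blast
  \<comment> \<open>\<open>f\<close> arises by dividing \<open>b\<close> minus a coboundary by
    \<open>x\<close>. Hence \<open>x\<close> times the difference of \<open>c\<close> and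
    \<open>?d f\<close> lies in \<open>L\<close>, and regularity removes \<open>x\<close>.\<close>
  have "c S \<ominus>\<^bsub>M\<^esub> ?d f S \<in> L" for S
  proof -
    have "?d (\<lambda>S. (b S \<ominus>\<^bsub>M\<^esub> ?d e S) \<ominus>\<^bsub>M\<^esub> x \<odot>\<^bsub>M\<^esub> f S) S = ?d (\<lambda>S. b S \<ominus>\<^bsub>M\<^esub> ?d e S) S \<ominus>\<^bsub>M\<^esub> ?d (\<lambda>S. x \<odot>\<^bsub>M\<^esub> f S) S"
      by (rule koszul_diff) (use y cochains_closed[OF be] cochains_closed[OF f(1)] x in auto)
    also have "?d (\<lambda>S. b S \<ominus>\<^bsub>M\<^esub> ?d e S) S = ?d b S \<ominus>\<^bsub>M\<^esub> ?d (?d e) S"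
      by (rule koszul_diff) (use y cochains_closed[OF b(1)] dc[OF e(1)] in auto)
    also have "?d (?d e) S = \<zero>\<^bsub>M\<^esub>" by (rule koszul_koszul) (use y cochains_closed[OF e(1)] in auto)
    also have "?d (\<lambda>S. x \<odot>\<^bsub>M\<^esub> f S) S = x \<odot>\<^bsub>M\<^esub> ?d f S" by (rule koszul_smult) (use y cochains_closed[OF f(1)] x in auto)
    finally have df: "?d (\<lambda>S. (b S \<ominus>\<^bsub>M\<^esub> ?d e S) \<ominus>\<^bsub>M\<^esub> x \<odot>\<^bsub>M\<^esub> f S) S = ?d b S \<ominus>\<^bsub>M\<^esub> \<zero>\<^bsub>M\<^esub> \<ominus>\<^bsub>M\<^esub> x \<odot>\<^bsub>M\<^esub> ?d f S" .
    have "?d (\<lambda>S. (b S \<ominus>\<^bsub>M\<^esub> ?d e S) \<ominus>\<^bsub>M\<^esub> x \<odot>\<^bsub>M\<^esub> f S) S \<in> L" by (rule koszul_submodule[OF y L f(2)])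
    hence "?d b S \<ominus>\<^bsub>M\<^esub> x \<odot>\<^bsub>M\<^esub> ?d f S \<in> L" using df dc[OF b(1), of S] by simp
    hence "(x \<odot>\<^bsub>M\<^esub> c S \<ominus>\<^bsub>M\<^esub> ?d b S) \<oplus>\<^bsub>M\<^esub> (?d b S \<ominus>\<^bsub>M\<^esub> x \<odot>\<^bsub>M\<^esub> ?d f S) \<in> L"
      by (rule submoduleE(5)[OF L b(2)])
    moreover have "(x \<odot>\<^bsub>M\<^esub> p \<ominus>\<^bsub>M\<^esub> q) \<oplus>\<^bsub>M\<^esub> (q \<ominus>\<^bsub>M\<^esub> x \<odot>\<^bsub>M\<^esub> r) = x \<odot>\<^bsub>M\<^esub> (p \<ominus>\<^bsub>M\<^esub> r)"
      if "p \<in> carrier M" "q \<in> carrier M" "r \<in> carrier M" for p q r using that x by algebra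
    ultimately have "x \<odot>\<^bsub>M\<^esub> (c S \<ominus>\<^bsub>M\<^esub> ?d f S) \<in> L" using cl dc[OF f(1)] by simp
    thus ?thesis using reg cl dc[OF f(1)] by blast
  qed
  thus "\<exists>b\<in>cochains M s (d + 1 - 1). \<forall>S. c S \<ominus>\<^bsub>M\<^esub> ?d b S \<in> L" using f(1) by auto
qed

text \<open>The scalars that send the class of \<open>c\<close> to zero form an ideal, and each
  \<open>y j\<close> is among them by the null homotopy.\<close>

lemma koszul_annihilated:
  assumes y: "\<And>j. j < s \<Longrightarrow> y j \<in> carrier R" and L: "submodule L R M"
    and x: "x \<in> Idl\<^bsub>R\<^esub> (y ` {..<s})"
    and c: "c \<in> cochains M s d" "\<And>S. koszul M y s c S \<in> L"
  shows "\<exists>b\<in>cochains M s (d - 1). \<forall>S. x \<odot>\<^bsub>M\<^esub> c S \<ominus>\<^bsub>M\<^esub> koszul M y s b S \<in> L"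
proof -
  let ?d = "koszul M y s"
  have dc: "?d c S \<in> carrier M" if "c \<in> cochains M s e" for c e S
    by (rule koszul_closed[OF y cochains_closed[OF that]])
  note cl = cochains_closed[OF c(1)]
  define K where "K = {x \<in> carrier R. \<exists>b\<in>cochains M s (d - 1). \<forall>S. x \<odot>\<^bsub>M\<^esub> c S \<ominus>\<^bsub>M\<^esub> ?d b S \<in> L}"
  have diff: "a \<ominus>\<^bsub>R\<^esub> b \<in> K" if ab: "a \<in> K" "b \<in> K" for a b
  proof -
    obtain p q where pq: "p \<in> cochains M s (d - 1)" "q \<in> cochains M s (d - 1)"
      "\<And>S. a \<odot>\<^bsub>M\<^esub> c S \<ominus>\<^bsub>M\<^esub> ?d p S \<in> L" "\<And>S. b \<odot>\<^bsub>M\<^esub> c S \<ominus>\<^bsub>M\<^esub> ?d q S \<in> L" and ab': "a \<in> carrier R" "b \<in> carrier R"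
      using ab unfolding K_def by blast
    have "(a \<ominus>\<^bsub>R\<^esub> b) \<odot>\<^bsub>M\<^esub> c S \<ominus>\<^bsub>M\<^esub> ?d (\<lambda>S. p S \<ominus>\<^bsub>M\<^esub> q S) S \<in> L" for S
    proof -
      have "?d (\<lambda>S. p S \<ominus>\<^bsub>M\<^esub> q S) S = ?d p S \<ominus>\<^bsub>M\<^esub> ?d q S"
        by (rule koszul_diff) (use y cochains_closed pq in auto)
      moreover have "(a \<ominus>\<^bsub>R\<^esub> b) \<odot>\<^bsub>M\<^esub> c S = a \<odot>\<^bsub>M\<^esub> c S \<ominus>\<^bsub>M\<^esub> b \<odot>\<^bsub>M\<^esub> c S"
        using ab' cl by (simp add: R.minus_eq M.minus_eq smult_l_distr smult_l_minus)
      moreover have "(u \<ominus>\<^bsub>M\<^esub> v) \<ominus>\<^bsub>M\<^esub> (w \<ominus>\<^bsub>M\<^esub> z) = (u \<ominus>\<^bsub>M\<^esub> w) \<ominus>\<^bsub>M\<^esub> (v \<ominus>\<^bsub>M\<^esub> z)"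
        if "u \<in> carrier M" "v \<in> carrier M" "w \<in> carrier M" "z \<in> carrier M" for u v w z
        using that by algebra
      ultimately have "(a \<ominus>\<^bsub>R\<^esub> b) \<odot>\<^bsub>M\<^esub> c S \<ominus>\<^bsub>M\<^esub> ?d (\<lambda>S. p S \<ominus>\<^bsub>M\<^esub> q S) S = (a \<odot>\<^bsub>M\<^esub> c S \<ominus>\<^bsub>M\<^esub> ?d p S) \<ominus>\<^bsub>M\<^esub> (b \<odot>\<^bsub>M\<^esub> c S \<ominus>\<^bsub>M\<^esub> ?d q S)"
        using cl ab' dc[OF pq(1)] dc[OF pq(2)] by simp
      thus ?thesis using submodule_diff[OF L pq(3,4)] by simp
    qed
    thus ?thesis unfolding K_def using cochains_diff[OF pq(1,2)] ab' by blast
  qed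
  have zero: "\<zero>\<^bsub>R\<^esub> \<in> K"
  proof -
    have "?d (\<lambda>S. \<zero>\<^bsub>M\<^esub>) S = \<zero>\<^bsub>M\<^esub>" for S using koszul_zero[OF y] .
    hence "\<zero>\<^bsub>R\<^esub> \<odot>\<^bsub>M\<^esub> c S \<ominus>\<^bsub>M\<^esub> ?d (\<lambda>S. \<zero>\<^bsub>M\<^esub>) S \<in> L" for S using cl[of S] submodule_zero[OF L] by simp
    thus ?thesis unfolding K_def using cochains_zero[of s "d - 1"] by blast
  qed
  have mult: "r \<otimes>\<^bsub>R\<^esub> a \<in> K" if r: "r \<in> carrier R" and a: "a \<in> K" for r a
  proof -
    obtain p where p: "p \<in> cochains M s (d - 1)" "\<And>S. a \<odot>\<^bsub>M\<^esub> c S \<ominus>\<^bsub>M\<^esub> ?d p S \<in> L" and a': "a \<in> carrier R"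
      using a unfolding K_def by blast
    have "(r \<otimes>\<^bsub>R\<^esub> a) \<odot>\<^bsub>M\<^esub> c S \<ominus>\<^bsub>M\<^esub> ?d (\<lambda>S. r \<odot>\<^bsub>M\<^esub> p S) S \<in> L" for S
    proof -
      have "?d (\<lambda>S. r \<odot>\<^bsub>M\<^esub> p S) S = r \<odot>\<^bsub>M\<^esub> ?d p S" by (rule koszul_smult) (use y cochains_closed p r in auto)
      hence "(r \<otimes>\<^bsub>R\<^esub> a) \<odot>\<^bsub>M\<^esub> c S \<ominus>\<^bsub>M\<^esub> ?d (\<lambda>S. r \<odot>\<^bsub>M\<^esub> p S) S = r \<odot>\<^bsub>M\<^esub> (a \<odot>\<^bsub>M\<^esub> c S \<ominus>\<^bsub>M\<^esub> ?d p S)"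
        using cl dc[OF p(1)] r a' by (simp add: smult_assoc1 smult_r_diff)
      thus ?thesis using submoduleE(4)[OF L r p(2)] by simp
    qed
    thus ?thesis unfolding K_def using cochains_smult[OF p(1) r] r a' by blast
  qed
  have "ideal K R" by (rule R.ideal_diffI[OF _ zero diff mult]) (simp_all add: K_def)
  moreover have "y ` {..<s} \<subseteq> K"
  proof
    fix z assume "z \<in> y ` {..<s}"
    then obtain j where j: "j < s" "z = y j" by blast
    have "y j \<odot>\<^bsub>M\<^esub> c S \<ominus>\<^bsub>M\<^esub> ?d (homotopy M j s c) S \<in> L" for S
    proof -
      \<comment> \<open>This is the term of the homotopy formula that vanishes for a cocycle; here
        \<open>c\<close> is a cocycle modulo \<open>L\<close>.\<close>
      have h: "homotopy M j s (?d c) S \<in> L" by (rule homotopy_submodule[OF L c(2)])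
      have eq: "?d (homotopy M j s c) S \<oplus>\<^bsub>M\<^esub> homotopy M j s (?d c) S = y j \<odot>\<^bsub>M\<^esub> c S"
        by (rule koszul_homotopy) (use y cl j in auto)
      have "(p \<oplus>\<^bsub>M\<^esub> q) \<ominus>\<^bsub>M\<^esub> p = q" if "p \<in> carrier M" "q \<in> carrier M" for p q
        using that by algebra
      hence "y j \<odot>\<^bsub>M\<^esub> c S \<ominus>\<^bsub>M\<^esub> ?d (homotopy M j s c) S = homotopy M j s (?d c) S"
        unfolding eq[symmetric] using dc[OF homotopy_cochains[OF j(1) c(1)], of S] submodule_carrier[OF L h] by simp
      thus ?thesis using h by simp
    qed
    thus "z \<in> K" unfolding K_def using j y homotopy_cochains[OF j(1) c(1)] by blast
  qed
  ultimately have "Idl\<^bsub>R\<^esub> (y ` {..<s}) \<subseteq> K" by (rule R.genideal_minimal)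
  thus ?thesis using x unfolding K_def by blast
qed

end

section \<open>Regular sequences and Koszul cohomology\<close>

text \<open>Weak regularity on \<open>M/L\<close>, each step replacing \<open>L\<close> by
  \<open>L + x M\<close>. That the last quotient is nonzero is dealt with in
  \<open>regular_sequence_iff\<close> and \<open>grade_image\<close>.\<close>

primrec regseq :: "('a, 'r) ring_scheme \<Rightarrow> ('a, 'b, 'c) module_scheme \<Rightarrow> 'b set \<Rightarrow> 'a list \<Rightarrow> bool"
  where
    "regseq R M L [] = True"
  | "regseq R M L (x # xs) =
      ((\<forall>z\<in>carrier M. x \<odot>\<^bsub>M\<^esub> z \<in> L \<longrightarrow> z \<in> L) \<and> regseq R M (adjoin R M L {x}) xs)"

text \<open>Parametrised by a predicate, since it serves ideals, submodules over different rings,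
  and subgroups that are stable under a set of operators inside a fixed subgroup.\<close>

definition chain_cond :: "('a set \<Rightarrow> bool) \<Rightarrow> bool" where
  "chain_cond P \<longleftrightarrow>
     (\<forall>f::nat \<Rightarrow> 'a set. (\<forall>n. P (f n) \<and> f n \<subseteq> f (Suc n)) \<longrightarrow> (\<exists>n. \<forall>m\<ge>n. f m = f n))"

lemma chain_condD:
  fixes f :: "nat \<Rightarrow> 'a set"
  assumes "chain_cond P" "\<And>n. P (f n)" "\<And>n. f n \<subseteq> f (Suc n)"
  shows "\<exists>n. \<forall>m\<ge>n. f m = f n"
  using assms unfolding chain_cond_def by blast

lemma chain_cond_maximal:
  assumes P: "chain_cond P" and "X0 \<in> F" and F: "\<And>X. X \<in> F \<Longrightarrow> P X"
  shows "\<exists>X\<in>F. \<forall>Y\<in>F. X \<subseteq> Y \<longrightarrow> Y \<subseteq> X"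
proof (rule ccontr)
  assume "\<not> ?thesis"
  hence "\<forall>X\<in>F. \<exists>Y\<in>F. X \<subset> Y" by blast
  then obtain g where g: "\<And>X. X \<in> F \<Longrightarrow> g X \<in> F \<and> X \<subset> g X" by metis
  define f where "f n = (g ^^ n) X0" for n
  have fF: "f n \<in> F" for n unfolding f_def by (induction n) (use assms(2) g in auto)
  have fS: "f (Suc n) = g (f n)" for n unfolding f_def by simp
  have "\<exists>n. \<forall>m\<ge>n. f m = f n"
    by (rule chain_condD[OF P]) (use F fF g fS in auto)
  thus False using g fF fS by (metis le_SucI order_refl psubset_eq)
qed

context module
begin

lemma koszul_exact_neg:
  assumes y: "\<And>j. j < s \<Longrightarrow> y j \<in> carrier R" and "submodule L R M" "d < 0"
  shows "koszul_exact M y s L d"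
proof -
  have zero: "c S = \<zero>\<^bsub>M\<^esub>" if "c \<in> cochains M s d" for c S using that assms(3) unfolding cochains_def by auto
  have "c S \<ominus>\<^bsub>M\<^esub> koszul M y s (\<lambda>S. \<zero>\<^bsub>M\<^esub>) S \<in> L" if "c \<in> cochains M s d" for c S
    using zero[OF that, of S] koszul_zero[OF y] submodule_zero[OF assms(2)] by simp
  thus ?thesis unfolding koszul_exact_def using cochains_zero[of s "d - 1"] by blast
qed

text \<open>Cohomology in degree zero consists of the elements of \<open>M/L\<close> annihilated by
  all \<open>y j\<close>; such an element is a cochain concentrated at the empty set.\<close>

lemma koszul_exact_0_imp:
  assumes y: "\<And>j. j < s \<Longrightarrow> y j \<in> carrier R" and L: "submodule L R M"
    and ex: "koszul_exact M y s L 0" and z: "z \<in> carrier M" "\<And>j. j < s \<Longrightarrow> y j \<odot>\<^bsub>M\<^esub> z \<in> L"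
  shows "z \<in> L"
proof -
  define c where "c S = (if S = {} then z else \<zero>\<^bsub>M\<^esub>)" for S :: "nat set"
  have "c \<in> cochains M s 0"
  proof -
    have "S = {}" if "S \<subseteq> {..<s}" "int (card S) = 0" for S :: "nat set"
      using that finite_subset[of S "{..<s}"] by simp
    thus ?thesis unfolding cochains_def c_def using z by auto
  qed
  moreover have "koszul M y s c S \<in> L" for S
  \<comment> \<open>Every value of \<open>c\<close> is \<open>z\<close> or zero, hence is multiplied
    into \<open>L\<close> by each \<open>y j\<close>.\<close>
  proof (rule koszul_mem[where P = "\<lambda>_. {u \<in> carrier M. \<forall>j<s. y j \<odot>\<^bsub>M\<^esub> u \<in> L}" and Q = "\<lambda>_. L"])
    show "c T \<in> {u \<in> carrier M. \<forall>j<s. y j \<odot>\<^bsub>M\<^esub> u \<in> L}" for T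
      unfolding c_def using z y submodule_zero[OF L] by simp
  qed (use submodule_zero[OF L] submodule_diff[OF L] in auto)
  ultimately obtain b where b: "b \<in> cochains M s (-1)" "\<And>S. c S \<ominus>\<^bsub>M\<^esub> koszul M y s b S \<in> L"
    using ex unfolding koszul_exact_def by fastforce
  have "b = (\<lambda>S. \<zero>\<^bsub>M\<^esub>)" using b(1) unfolding cochains_def by auto
  hence "z \<ominus>\<^bsub>M\<^esub> \<zero>\<^bsub>M\<^esub> \<in> L" using b(2)[of "{}"] koszul_zero[OF y] unfolding c_def by simp
  moreover have "z \<ominus>\<^bsub>M\<^esub> \<zero>\<^bsub>M\<^esub> = z" using z(1) by algebra
  ultimately show ?thesis by simp
qed

text \<open>Each element of the sequence raises by one the range in which cohomology vanishes: lying
  in the ideal of the \<open>y j\<close>, it annihilates the cohomology of \<open>M/L\<close>, so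
  that \<open>koszul_exact_of_adjoin\<close> applies.\<close>

lemma regseq_imp_koszul_exact:
  assumes y: "\<And>j. j < s \<Longrightarrow> y j \<in> carrier R"
  shows "\<lbrakk>submodule L R M; set xs \<subseteq> Idl\<^bsub>R\<^esub> (y ` {..<s}); regseq R M L xs; d < int (length xs)\<rbrakk>
    \<Longrightarrow> koszul_exact M y s L d"
proof (induction xs arbitrary: L d)
  case Nil
  thus ?case using koszul_exact_neg[OF y] by simp
next
  case (Cons x xs)
  have yR: "y ` {..<s} \<subseteq> carrier R" using y by auto
  have xR: "x \<in> carrier R"
    using Cons.prems(2) ideal.Icarr[OF R.genideal_ideal[OF yR]] by auto
  have sub: "submodule (adjoin R M L {x}) R M"
    by (rule adjoin_submodule) (use submoduleE(1)[OF Cons.prems(1)] xR in auto)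
  have "koszul_exact M y s L (d - 1 + 1)"
  proof (rule koszul_exact_of_adjoin[OF y Cons.prems(1) xR])
    show "koszul_exact M y s (adjoin R M L {x}) (d - 1)"
      by (rule Cons.IH[OF sub]) (use Cons.prems in auto)
    show "\<exists>b\<in>cochains M s (d - 1). \<forall>S. x \<odot>\<^bsub>M\<^esub> c S \<ominus>\<^bsub>M\<^esub> koszul M y s b S \<in> L"
      if "c \<in> cochains M s (d - 1 + 1)" "\<And>S. koszul M y s c S \<in> L" for c
      using koszul_annihilated[OF y Cons.prems(1) _ _ that(2), of x d] that Cons.prems(2) by auto
  qed (use Cons.prems(3) in auto)
  thus ?case by simp
qed

text \<open>
  Since submodules of \<open>R z\<close> correspond to ideals above the annihilator of \<open>z\<close>, the chain condition on
  submodules suffices: no chain condition on the ring is used.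
\<close>
lemma exists_regular:
  assumes L: "submodule L R M" and J: "ideal J R" and acc: "chain_cond (\<lambda>N. submodule N R M)"
    and soc: "\<And>z. \<lbrakk>z \<in> carrier M; \<And>a. a \<in> J \<Longrightarrow> a \<odot>\<^bsub>M\<^esub> z \<in> L\<rbrakk> \<Longrightarrow> z \<in> L"
  shows "\<exists>x\<in>J. \<forall>z\<in>carrier M. x \<odot>\<^bsub>M\<^esub> z \<in> L \<longrightarrow> z \<in> L"
proof -
  have Lc: "L \<subseteq> carrier M" using submoduleE(1)[OF L] .
  define ann where "ann z = {r \<in> carrier R. r \<odot>\<^bsub>M\<^esub> z \<in> L}" for z
  \<comment> \<open>Representatives of the maximal annihilators of nonzero elements of
    \<open>M/L\<close>; these annihilators are shown to be prime below.\<close>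
  define Mx where "Mx = {z \<in> carrier M - L. \<forall>w\<in>carrier M - L. ann z \<subseteq> ann w \<longrightarrow> ann w \<subseteq> ann z}"
  have Mxc: "z \<in> carrier M" "z \<notin> L" if "z \<in> Mx" for z using that unfolding Mx_def by auto
  have maxD: "ann w \<subseteq> ann z" if "z \<in> Mx" "w \<in> carrier M" "w \<notin> L" "ann z \<subseteq> ann w" for w z
    using that unfolding Mx_def by blast
  have ann_diff: "a \<ominus>\<^bsub>R\<^esub> b \<in> ann z" if "z \<in> carrier M" "a \<in> ann z" "b \<in> ann z" for a b z
  proof -
    have "(a \<ominus>\<^bsub>R\<^esub> b) \<odot>\<^bsub>M\<^esub> z = a \<odot>\<^bsub>M\<^esub> z \<ominus>\<^bsub>M\<^esub> b \<odot>\<^bsub>M\<^esub> z"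
      using that unfolding ann_def by (simp add: R.minus_eq M.minus_eq smult_l_distr smult_l_minus)
    thus ?thesis using that submodule_diff[OF L] unfolding ann_def by auto
  qed
  have ann_add: "a \<oplus>\<^bsub>R\<^esub> b \<in> ann z" if "z \<in> carrier M" "a \<in> ann z" "b \<in> ann z" for a b z
    using that submoduleE(5)[OF L] unfolding ann_def by (auto simp: smult_l_distr)
  have ann_mult: "r \<otimes>\<^bsub>R\<^esub> a \<in> ann z" "a \<otimes>\<^bsub>R\<^esub> r \<in> ann z"
    if "z \<in> carrier M" "a \<in> ann z" "r \<in> carrier R" for a r z
  proof -
    show "r \<otimes>\<^bsub>R\<^esub> a \<in> ann z"
      using that submoduleE(4)[OF L] unfolding ann_def by (auto simp: smult_assoc1)
    thus "a \<otimes>\<^bsub>R\<^esub> r \<in> ann z" using that R.m_comm[of a r] unfolding ann_def by auto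
  qed
  have ann_diffD: "a \<in> ann z" if "z \<in> carrier M" "a \<in> carrier R" "b \<in> ann z" "a \<oplus>\<^bsub>R\<^esub> b \<in> ann z" for a b z
  proof -
    have "b \<in> carrier R" using that(3) unfolding ann_def by blast
    hence "a = (a \<oplus>\<^bsub>R\<^esub> b) \<ominus>\<^bsub>R\<^esub> b" using that(2) by algebra
    thus ?thesis using ann_diff[OF that(1,4,3)] by simp
  qed
  have above: "\<exists>z\<in>Mx. ann x \<subseteq> ann z" if x: "x \<in> carrier M" "x \<notin> L" for x
  proof -
    \<comment> \<open>\<open>E w\<close> is \<open>L\<close> plus the multiples of \<open>x\<close>
      by \<open>ann w\<close>. It determines \<open>ann w\<close> whenever that contains
      \<open>ann x\<close>, so a maximal submodule among the \<open>E w\<close> gives a maximal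
      annihilator.\<close>
    define E where "E w = {u. \<exists>r\<in>ann w. u \<in> carrier M \<and> u \<ominus>\<^bsub>M\<^esub> r \<odot>\<^bsub>M\<^esub> x \<in> L}" for w
    define F where "F = {E w | w. w \<in> carrier M \<and> w \<notin> L \<and> ann x \<subseteq> ann w}"
    have "submodule (E w) R M" if w: "w \<in> carrier M" for w
    proof (rule submoduleI_diff)
      have "\<zero>\<^bsub>R\<^esub> \<in> ann w" unfolding ann_def using w submodule_zero[OF L] by simp
      moreover have "\<zero>\<^bsub>M\<^esub> \<ominus>\<^bsub>M\<^esub> \<zero>\<^bsub>R\<^esub> \<odot>\<^bsub>M\<^esub> x \<in> L" using x submodule_zero[OF L] by simp
      ultimately show "\<zero>\<^bsub>M\<^esub> \<in> E w" unfolding E_def by blast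
    next
      fix a b assume "a \<in> E w" "b \<in> E w"
      then obtain m n where m: "m \<in> ann w" "n \<in> ann w" "a \<in> carrier M" "b \<in> carrier M"
        "a \<ominus>\<^bsub>M\<^esub> m \<odot>\<^bsub>M\<^esub> x \<in> L" "b \<ominus>\<^bsub>M\<^esub> n \<odot>\<^bsub>M\<^esub> x \<in> L" unfolding E_def by blast
      have mn: "m \<in> carrier R" "n \<in> carrier R" using m unfolding ann_def by auto
      have "(m \<ominus>\<^bsub>R\<^esub> n) \<odot>\<^bsub>M\<^esub> x = m \<odot>\<^bsub>M\<^esub> x \<ominus>\<^bsub>M\<^esub> n \<odot>\<^bsub>M\<^esub> x"
        using mn x by (simp add: R.minus_eq M.minus_eq smult_l_distr smult_l_minus)
      moreover have "(a \<ominus>\<^bsub>M\<^esub> b) \<ominus>\<^bsub>M\<^esub> (m \<odot>\<^bsub>M\<^esub> x \<ominus>\<^bsub>M\<^esub> n \<odot>\<^bsub>M\<^esub> x) = (a \<ominus>\<^bsub>M\<^esub> m \<odot>\<^bsub>M\<^esub> x) \<ominus>\<^bsub>M\<^esub> (b \<ominus>\<^bsub>M\<^esub> n \<odot>\<^bsub>M\<^esub> x)"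
        using mn m(3,4) x(1) by algebra
      ultimately have "(a \<ominus>\<^bsub>M\<^esub> b) \<ominus>\<^bsub>M\<^esub> (m \<ominus>\<^bsub>R\<^esub> n) \<odot>\<^bsub>M\<^esub> x \<in> L" using submodule_diff[OF L m(5,6)] by simp
      thus "a \<ominus>\<^bsub>M\<^esub> b \<in> E w" unfolding E_def
        using ann_diff[OF w m(1,2)] M.minus_closed[OF m(3,4)] by blast
    next
      fix r a assume r: "r \<in> carrier R" and "a \<in> E w"
      then obtain m where m: "m \<in> ann w" "a \<in> carrier M" "a \<ominus>\<^bsub>M\<^esub> m \<odot>\<^bsub>M\<^esub> x \<in> L" unfolding E_def by blast
      have mc: "m \<in> carrier R" using m unfolding ann_def by auto
      have "r \<odot>\<^bsub>M\<^esub> a \<ominus>\<^bsub>M\<^esub> (r \<otimes>\<^bsub>R\<^esub> m) \<odot>\<^bsub>M\<^esub> x = r \<odot>\<^bsub>M\<^esub> (a \<ominus>\<^bsub>M\<^esub> m \<odot>\<^bsub>M\<^esub> x)"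
        using r mc m x by (simp add: smult_r_diff smult_assoc1)
      hence "r \<odot>\<^bsub>M\<^esub> a \<ominus>\<^bsub>M\<^esub> (r \<otimes>\<^bsub>R\<^esub> m) \<odot>\<^bsub>M\<^esub> x \<in> L" using submoduleE(4)[OF L r m(3)] by simp
      thus "r \<odot>\<^bsub>M\<^esub> a \<in> E w" unfolding E_def using ann_mult(1)[OF w m(1) r] smult_closed[OF r m(2)] by blast
    qed (auto simp: E_def)
    hence sF: "submodule X R M" if "X \<in> F" for X using that unfolding F_def by blast
    have ExF: "E x \<in> F" unfolding F_def using x by blast
    have "\<exists>X\<in>F. \<forall>Y\<in>F. X \<subseteq> Y \<longrightarrow> Y \<subseteq> X" by (rule chain_cond_maximal[OF acc ExF sF])
    then obtain X where X: "X \<in> F" "\<forall>Y\<in>F. X \<subseteq> Y \<longrightarrow> Y \<subseteq> X" by blast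
    obtain z where z: "z \<in> carrier M" "z \<notin> L" "ann x \<subseteq> ann z" and Xz: "X = E z"
      using X(1) unfolding F_def by blast
    have zmax: "Y \<subseteq> E z" if "Y \<in> F" "E z \<subseteq> Y" for Y using X(2) that unfolding Xz by blast
    have "ann w \<subseteq> ann z" if w: "w \<in> carrier M" "w \<notin> L" "ann z \<subseteq> ann w" for w
    proof
      fix r assume r: "r \<in> ann w"
      have "E z \<subseteq> E w" unfolding E_def using w(3) by blast
      moreover have "E w \<in> F" unfolding F_def using w z(3) by blast
      ultimately have Ewz: "E w \<subseteq> E z" by (rule zmax[rotated])
      have rc: "r \<in> carrier R" using r unfolding ann_def by simp
      have "r \<odot>\<^bsub>M\<^esub> x \<ominus>\<^bsub>M\<^esub> r \<odot>\<^bsub>M\<^esub> x = \<zero>\<^bsub>M\<^esub>" using rc x by algebra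
      hence "r \<odot>\<^bsub>M\<^esub> x \<ominus>\<^bsub>M\<^esub> r \<odot>\<^bsub>M\<^esub> x \<in> L" using submodule_zero[OF L] by simp
      hence "r \<odot>\<^bsub>M\<^esub> x \<in> E w" unfolding E_def using r smult_closed[OF rc x(1)] by blast
      then obtain q where q: "q \<in> ann z" "r \<odot>\<^bsub>M\<^esub> x \<ominus>\<^bsub>M\<^esub> q \<odot>\<^bsub>M\<^esub> x \<in> L" using Ewz unfolding E_def by blast
      have qc: "q \<in> carrier R" using q unfolding ann_def by simp
      have "(r \<ominus>\<^bsub>R\<^esub> q) \<odot>\<^bsub>M\<^esub> x = r \<odot>\<^bsub>M\<^esub> x \<ominus>\<^bsub>M\<^esub> q \<odot>\<^bsub>M\<^esub> x"
        using rc qc x by (simp add: R.minus_eq M.minus_eq smult_l_distr smult_l_minus)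
      \<comment> \<open>\<open>r\<close> and \<open>q\<close> act alike on \<open>x\<close> modulo
        \<open>L\<close>, so their difference lies in \<open>ann x\<close>, hence in
        \<open>ann z\<close>.\<close>
      hence "r \<ominus>\<^bsub>R\<^esub> q \<in> ann x" using q rc qc unfolding ann_def by simp
      hence "(r \<ominus>\<^bsub>R\<^esub> q) \<oplus>\<^bsub>R\<^esub> q \<in> ann z" using z q ann_add[of z] by blast
      moreover have "(r \<ominus>\<^bsub>R\<^esub> q) \<oplus>\<^bsub>R\<^esub> q = r" using rc qc by algebra
      ultimately show "r \<in> ann z" by simp
    qed
    hence "z \<in> Mx" unfolding Mx_def using z by blast
    thus ?thesis using z by blast
  qed
  \<comment> \<open>If \<open>t\<close> does not annihilate \<open>z\<close> modulo
    \<open>L\<close>, its multiple of \<open>z\<close> is again outside \<open>L\<close> with an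
    annihilator above \<open>ann z\<close>, which equals \<open>ann z\<close> by maximality.\<close>
  have prime: "r \<in> ann z"
    if z: "z \<in> Mx" and r: "r \<in> carrier R" "t \<in> carrier R" "r \<otimes>\<^bsub>R\<^esub> t \<in> ann z" "t \<notin> ann z" for r t z
  proof -
    have zc: "z \<in> carrier M" using Mxc[OF z] by simp
    have "t \<odot>\<^bsub>M\<^esub> z \<notin> L" using r unfolding ann_def by blast
    moreover have "ann z \<subseteq> ann (t \<odot>\<^bsub>M\<^esub> z)"
    proof
      fix a assume "a \<in> ann z"
      hence "a \<in> carrier R" "t \<odot>\<^bsub>M\<^esub> (a \<odot>\<^bsub>M\<^esub> z) \<in> L"
        using submoduleE(4)[OF L r(2)] unfolding ann_def by auto
      thus "a \<in> ann (t \<odot>\<^bsub>M\<^esub> z)" unfolding ann_def using smult_left_comm[of a t z] r(2) zc by simp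
    qed
    ultimately have "ann (t \<odot>\<^bsub>M\<^esub> z) \<subseteq> ann z" using maxD[OF z] r zc by blast
    moreover have "r \<in> ann (t \<odot>\<^bsub>M\<^esub> z)" using r zc unfolding ann_def by (simp add: smult_assoc1)
    ultimately show ?thesis by blast
  qed
  \<comment> \<open>A product of elements, one from each \<open>ann w\<close> and none from
    \<open>ann z\<close>, stays outside the prime \<open>ann z\<close>.\<close>
  have inter: "\<exists>r\<in>carrier R. r \<notin> ann z \<and> (\<forall>w\<in>W. r \<in> ann w)"
    if "finite W" "W \<subseteq> Mx" and z: "z \<in> Mx" and "\<And>w. w \<in> W \<Longrightarrow> \<not> ann w \<subseteq> ann z" for z W
    using that(1,2,4)
  proof (induction W)
    case empty
    have "\<one>\<^bsub>R\<^esub> \<notin> ann z" using Mxc[OF z] unfolding ann_def by simp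
    thus ?case by blast
  next
    case (insert w W)
    have "\<exists>r\<in>carrier R. r \<notin> ann z \<and> (\<forall>w\<in>W. r \<in> ann w)"
      by (rule insert.IH) (use insert.prems in auto)
    then obtain r where r: "r \<in> carrier R" "r \<notin> ann z" "\<And>w. w \<in> W \<Longrightarrow> r \<in> ann w" by blast
    have "\<not> ann w \<subseteq> ann z" using insert.prems by simp
    then obtain t where t: "t \<in> ann w" "t \<notin> ann z" by blast
    have tc: "t \<in> carrier R" using t unfolding ann_def by simp
    have "t \<otimes>\<^bsub>R\<^esub> r \<notin> ann z" using prime[OF z tc r(1)] r t by blast
    moreover have "t \<otimes>\<^bsub>R\<^esub> r \<in> ann v" if v: "v \<in> insert w W" for v
    proof -
      have vc: "v \<in> carrier M" using v insert.prems(1) Mxc(1) by blast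
      show ?thesis
        using v ann_mult(1)[OF vc _ tc, of r] ann_mult(2)[OF vc _ r(1), of t] r(3) t(1) by blast
    qed
    ultimately show ?case using R.m_closed[OF tc r(1)] by blast
  qed
  \<comment> \<open>Finitely many elements of \<open>Mx\<close> span the rest together with
    \<open>L\<close>: take a maximal submodule among those spanned by \<open>L\<close> and a finite
    subset.\<close>
  obtain Z0 where Z0: "finite Z0" "Z0 \<subseteq> Mx" "Mx \<subseteq> module_span R M (L \<union> Z0)"
  proof -
    define F where "F = {module_span R M (L \<union> Z) | Z. finite Z \<and> Z \<subseteq> Mx}"
    have Mxc': "Mx \<subseteq> carrier M" using Mxc by blast
    have sF: "submodule X R M" if X: "X \<in> F" for X
    proof -
      obtain Z where "X = module_span R M (L \<union> Z)" "Z \<subseteq> Mx" using X unfolding F_def by blast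
      thus ?thesis using module_span_submodule[of "L \<union> Z"] Lc Mxc' by blast
    qed
    have F0: "module_span R M (L \<union> {}) \<in> F" unfolding F_def by blast
    have "\<exists>X\<in>F. \<forall>Y\<in>F. X \<subseteq> Y \<longrightarrow> Y \<subseteq> X" by (rule chain_cond_maximal[OF acc F0 sF])
    then obtain X where X: "X \<in> F" "\<forall>Y\<in>F. X \<subseteq> Y \<longrightarrow> Y \<subseteq> X" by blast
    obtain Z where Z: "finite Z" "Z \<subseteq> Mx" and XZ: "X = module_span R M (L \<union> Z)"
      using X(1) unfolding F_def by blast
    have max: "Y \<subseteq> module_span R M (L \<union> Z)" if "Y \<in> F" "module_span R M (L \<union> Z) \<subseteq> Y" for Y
      using X(2) that unfolding XZ by blast
    have "z \<in> module_span R M (L \<union> Z)" if z: "z \<in> Mx" for z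
    proof -
      have "finite (insert z Z) \<and> insert z Z \<subseteq> Mx" using Z z by simp
      hence "module_span R M (L \<union> insert z Z) \<in> F" unfolding F_def by blast
      moreover have "module_span R M (L \<union> Z) \<subseteq> module_span R M (L \<union> insert z Z)"
        unfolding module_span_def by blast
      ultimately have "module_span R M (L \<union> insert z Z) \<subseteq> module_span R M (L \<union> Z)" by (rule max)
      thus ?thesis using module_span_superset[of "L \<union> insert z Z" R M] by blast
    qed
    thus ?thesis using that Z by blast
  qed
  \<comment> \<open>Otherwise a scalar outside \<open>ann z\<close> would annihilate
    \<open>Z0\<close> modulo \<open>L\<close> and hence \<open>z\<close>, which lies in the span. So
    only finitely many maximal annihilators occur.\<close>
  have below: "\<exists>w\<in>Z0. ann w \<subseteq> ann z" if z: "z \<in> Mx" for z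
  proof (rule ccontr)
    assume "\<not> ?thesis"
    hence "\<exists>r\<in>carrier R. r \<notin> ann z \<and> (\<forall>w\<in>Z0. r \<in> ann w)" by (intro inter[OF Z0(1,2) z]) blast
    then obtain r where r: "r \<in> carrier R" "r \<notin> ann z" "\<forall>w\<in>Z0. r \<in> ann w" by blast
    define N where "N = {u \<in> carrier M. r \<odot>\<^bsub>M\<^esub> u \<in> L}"
    have "submodule N R M"
    proof (rule submoduleI_diff)
      show "\<zero>\<^bsub>M\<^esub> \<in> N" unfolding N_def using r submodule_zero[OF L] by simp
      show "a \<ominus>\<^bsub>M\<^esub> b \<in> N" if "a \<in> N" "b \<in> N" for a b
        using that r submodule_diff[OF L] unfolding N_def by (auto simp: smult_r_diff)
      show "t \<odot>\<^bsub>M\<^esub> a \<in> N" if "t \<in> carrier R" "a \<in> N" for t a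
        using that r submoduleE(4)[OF L] smult_left_comm[of r t a] unfolding N_def by auto
    qed (auto simp: N_def)
    moreover have "L \<subseteq> N" unfolding N_def using Lc submoduleE(4)[OF L r(1)] by blast
    moreover have "Z0 \<subseteq> N" unfolding N_def using r(3) Z0(2) Mxc(1) unfolding ann_def by blast
    ultimately have "module_span R M (L \<union> Z0) \<subseteq> N" by (intro module_span_minimal) auto
    thus False using z Z0(3) r unfolding N_def ann_def by blast
  qed
  \<comment> \<open>Prime avoidance: by \<open>soc\<close> no maximal annihilator contains
    \<open>J\<close>, so finitely many of them do not cover \<open>J\<close>.\<close>
  have avoid: "\<exists>a\<in>J. \<forall>w\<in>Z. a \<notin> ann w" if "finite Z" "Z \<subseteq> Mx" for Z
    using that
  proof (induction Z)
    case empty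
    thus ?case using additive_subgroup.zero_closed[OF ideal.axioms(1)[OF J]] by blast
  next
    case (insert z Z)
    then obtain a where a: "a \<in> J" "\<forall>w\<in>Z. a \<notin> ann w" by auto
    have z: "z \<in> Mx" and Z: "Z \<subseteq> Mx" using insert.prems by auto
    show ?case
    proof (cases "a \<in> ann z")
      case True
      have "\<not> ann w \<subseteq> ann z" if w: "w \<in> Z" for w
      proof
        assume "ann w \<subseteq> ann z"
        moreover have "w \<in> Mx" using w Z by blast
        ultimately have "ann z \<subseteq> ann w" using maxD Mxc[OF z] by blast
        thus False using a(2) w True by blast
      qed
      hence "\<exists>r\<in>carrier R. r \<notin> ann z \<and> (\<forall>w\<in>Z. r \<in> ann w)" by (intro inter[OF insert.hyps(1) Z z]) blast
      then obtain r where r: "r \<in> carrier R" "r \<notin> ann z" "\<forall>w\<in>Z. r \<in> ann w" by blast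
      obtain j where j: "j \<in> J" "j \<odot>\<^bsub>M\<^esub> z \<notin> L" using soc[of z] Mxc[OF z] by blast
      have jc: "j \<in> carrier R" "a \<in> carrier R" using ideal.Icarr[OF J] j a by blast+
      let ?b = "j \<otimes>\<^bsub>R\<^esub> r"
      have bJ: "?b \<in> J" using ideal.I_r_closed[OF J j(1) r(1)] .
      have bc: "?b \<in> carrier R" using jc r by simp
      have "j \<notin> ann z" using j unfolding ann_def by simp
      hence bz: "?b \<notin> ann z" using prime[OF z jc(1) r(1)] r(2) by blast
      \<comment> \<open>The correction \<open>?b\<close> lies in \<open>ann w\<close> for all
        \<open>w\<close> in \<open>Z\<close> but not in \<open>ann z\<close>, while \<open>a\<close>
        does the opposite; so the sum avoids them all.\<close>
      have "a \<oplus>\<^bsub>R\<^esub> ?b \<notin> ann z"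
        using ann_diffD[of z ?b a] bz True bc jc Mxc[OF z] R.a_comm[of a ?b] by auto
      moreover have "a \<oplus>\<^bsub>R\<^esub> ?b \<notin> ann w" if w: "w \<in> Z" for w
      proof -
        have "w \<in> carrier M" using w Z Mxc by blast
        thus ?thesis using ann_diffD[of w a ?b] ann_mult(1)[of w r j] w a r jc by blast
      qed
      moreover have "a \<oplus>\<^bsub>R\<^esub> ?b \<in> J"
        using additive_subgroup.a_closed[OF ideal.axioms(1)[OF J] a(1) bJ] .
      ultimately show ?thesis by blast
    qed (use a in blast)
  qed
  obtain a where a: "a \<in> J" "\<forall>w\<in>Z0. a \<notin> ann w" using avoid[OF Z0(1,2)] by blast
  have ac: "a \<in> carrier R" using ideal.Icarr[OF J a(1)] .
  have "x \<in> L" if x: "x \<in> carrier M" "a \<odot>\<^bsub>M\<^esub> x \<in> L" for x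
  proof (rule ccontr)
    assume "x \<notin> L"
    then obtain z where z: "z \<in> Mx" "ann x \<subseteq> ann z" using above x by blast
    then obtain w where w: "w \<in> Z0" "ann w \<subseteq> ann z" using below by blast
    \<comment> \<open>Two maximal annihilators, one inside the other, coincide. So \<open>a\<close>,
      which avoids \<open>ann w\<close>, also avoids \<open>ann z\<close> and with it
      \<open>ann x\<close>.\<close>
    have "ann z \<subseteq> ann w" by (rule maxD) (use w Z0(2) Mxc[OF z(1)] in auto)
    moreover have "a \<in> ann x" unfolding ann_def using ac x by simp
    ultimately show False using z(2) a(2) w(1) by blast
  qed
  thus ?thesis using a(1) by blast
qed

text \<open>Vanishing in degree zero says that no nonzero element of \<open>M/L\<close> is
  annihilated by the ideal, which by \<open>exists_regular\<close> then contains a regular element.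
  Dividing by it costs one degree, by \<open>koszul_exact_adjoin\<close>.\<close>

lemma koszul_exact_imp_regseq:
  assumes y: "\<And>j. j < s \<Longrightarrow> y j \<in> carrier R" and acc: "chain_cond (\<lambda>N. submodule N R M)"
  shows "\<lbrakk>submodule L R M; \<And>d. d < int n \<Longrightarrow> koszul_exact M y s L d\<rbrakk>
    \<Longrightarrow> \<exists>xs. length xs = n \<and> set xs \<subseteq> Idl\<^bsub>R\<^esub> (y ` {..<s}) \<and> regseq R M L xs"
proof (induction n arbitrary: L)
  case (Suc n)
  let ?J = "Idl\<^bsub>R\<^esub> (y ` {..<s})"
  have yR: "y ` {..<s} \<subseteq> carrier R" using y by auto
  note J = R.genideal_ideal[OF yR]
  have "\<exists>x\<in>?J. \<forall>z\<in>carrier M. x \<odot>\<^bsub>M\<^esub> z \<in> L \<longrightarrow> z \<in> L"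
  proof (rule exists_regular[OF Suc.prems(1) J acc])
    fix z assume z: "z \<in> carrier M" "\<And>a. a \<in> ?J \<Longrightarrow> a \<odot>\<^bsub>M\<^esub> z \<in> L"
    show "z \<in> L"
    proof (rule koszul_exact_0_imp[OF y Suc.prems(1) _ z(1)])
      show "koszul_exact M y s L 0" using Suc.prems(2) by simp
      show "y j \<odot>\<^bsub>M\<^esub> z \<in> L" if "j < s" for j using z(2) R.genideal_self[OF yR] that by blast
    qed
  qed
  then obtain x where x: "x \<in> ?J" "\<forall>z\<in>carrier M. x \<odot>\<^bsub>M\<^esub> z \<in> L \<longrightarrow> z \<in> L" by blast
  have xR: "x \<in> carrier R" using ideal.Icarr[OF J x(1)] .
  have sub: "submodule (adjoin R M L {x}) R M"
    by (rule adjoin_submodule) (use submoduleE(1)[OF Suc.prems(1)] xR in auto)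
  have "koszul_exact M y s (adjoin R M L {x}) d" if "d < int n" for d
  proof (rule koszul_exact_adjoin[OF y Suc.prems(1) xR])
    show "z \<in> L" if "z \<in> carrier M" "x \<odot>\<^bsub>M\<^esub> z \<in> L" for z using x(2) that by blast
    show "koszul_exact M y s L d" "koszul_exact M y s L (d + 1)" using Suc.prems(2) that by auto
  qed
  hence "\<exists>xs. length xs = n \<and> set xs \<subseteq> ?J \<and> regseq R M (adjoin R M L {x}) xs"
    by (rule Suc.IH[OF sub])
  then obtain xs where "length xs = n" "set xs \<subseteq> ?J" "regseq R M (adjoin R M L {x}) xs" by blast
  thus ?case using x by (intro exI[of _ "x # xs"]) simp
qed simp

end

section \<open>Grade under surjections\<close>

text \<open>Unrolls the recursion: by \<open>adjoin_adjoin\<close>, the submodule reached after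
  \<open>i\<close> steps is \<open>L\<close> with the first \<open>i\<close> entries
  adjoined.\<close>

lemma (in module) regseq_iff_nth:
  "\<lbrakk>submodule L R M; set xs \<subseteq> carrier R\<rbrakk> \<Longrightarrow>
    regseq R M L xs \<longleftrightarrow> (\<forall>i<length xs. \<forall>z\<in>carrier M.
      xs ! i \<odot>\<^bsub>M\<^esub> z \<in> adjoin R M L (set (take i xs)) \<longrightarrow> z \<in> adjoin R M L (set (take i xs)))"
proof (induction xs arbitrary: L)
  case (Cons x xs)
  have Lc: "L \<subseteq> carrier M" using submoduleE(1)[OF Cons.prems(1)] .
  have sub: "submodule (adjoin R M L {x}) R M"
    by (rule adjoin_submodule[OF Lc]) (use Cons.prems in auto)
  have ad: "adjoin R M (adjoin R M L {x}) (set (take i xs)) = adjoin R M L (set (take (Suc i) (x # xs)))" for i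
    using adjoin_adjoin[OF Lc, of "{x}" "set (take i xs)"] Cons.prems(2) set_take_subset[of i xs] by auto
  show ?case
    unfolding regseq.simps length_Cons All_less_Suc2 Cons.IH[OF sub set_subset_Cons[THEN subset_trans, OF Cons.prems(2)]]
      ad by (simp add: adjoin_empty[OF Cons.prems(1)])
qed simp

text \<open>\<open>R'\<close> and \<open>N\<close> are bare records: the group structure of
  \<open>N\<close> is inherited through the surjection in \<open>abelian_group_N\<close>, which
  spares a separate verification for the associated graded module.\<close>

locale module_epi = module R M for R (structure) and M (structure) +
  fixes R' :: "('e, 'f) ring_scheme" and N :: "('e, 'g, 'h) module_scheme" and \<phi> \<pi>
  assumes phi_surj: "\<phi> ` carrier R = carrier R'"
    and pi_surj: "\<pi> ` carrier M = carrier N"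
    and pi_add: "\<lbrakk>u \<in> carrier M; v \<in> carrier M\<rbrakk> \<Longrightarrow> \<pi> (u \<oplus>\<^bsub>M\<^esub> v) = \<pi> u \<oplus>\<^bsub>N\<^esub> \<pi> v"
    and pi_smult: "\<lbrakk>r \<in> carrier R; u \<in> carrier M\<rbrakk> \<Longrightarrow> \<pi> (r \<odot>\<^bsub>M\<^esub> u) = \<phi> r \<odot>\<^bsub>N\<^esub> \<pi> u"
    and pi_zero: "\<pi> \<zero>\<^bsub>M\<^esub> = \<zero>\<^bsub>N\<^esub>"
begin

definition ker :: "_ set" where "ker = {u \<in> carrier M. \<pi> u = \<zero>\<^bsub>N\<^esub>}"

lemma pi_closed: "u \<in> carrier M \<Longrightarrow> \<pi> u \<in> carrier N"
  using pi_surj by blast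

lemma carrier_N_E:
  assumes "v \<in> carrier N"
  obtains u where "u \<in> carrier M" "v = \<pi> u"
  using assms pi_surj by blast

lemma abelian_group_N: "abelian_group N"
proof (rule abelian_groupI)
  show "\<zero>\<^bsub>N\<^esub> \<in> carrier N" using pi_closed[OF M.zero_closed] pi_zero by simp
  fix x assume "x \<in> carrier N"
  then obtain u where u: "u \<in> carrier M" "x = \<pi> u" by (rule carrier_N_E)
  show "\<zero>\<^bsub>N\<^esub> \<oplus>\<^bsub>N\<^esub> x = x" using pi_add[OF M.zero_closed u(1)] u pi_zero by simp
  have "\<pi> (\<ominus>\<^bsub>M\<^esub> u) \<oplus>\<^bsub>N\<^esub> x = \<zero>\<^bsub>N\<^esub>"
    using pi_add[of "\<ominus>\<^bsub>M\<^esub> u" u] u pi_zero by (simp add: M.l_neg)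
  thus "\<exists>y\<in>carrier N. y \<oplus>\<^bsub>N\<^esub> x = \<zero>\<^bsub>N\<^esub>" using pi_closed[of "\<ominus>\<^bsub>M\<^esub> u"] u by blast
  fix y assume "y \<in> carrier N"
  then obtain v where v: "v \<in> carrier M" "y = \<pi> v" by (rule carrier_N_E)
  show "x \<oplus>\<^bsub>N\<^esub> y \<in> carrier N" using u v pi_add[of u v] pi_closed[of "u \<oplus>\<^bsub>M\<^esub> v"] by simp
  show "x \<oplus>\<^bsub>N\<^esub> y = y \<oplus>\<^bsub>N\<^esub> x"
    using u v pi_add[of u v] pi_add[of v u] M.a_comm[of u v] by simp
  fix z assume "z \<in> carrier N"
  then obtain w where w: "w \<in> carrier M" "z = \<pi> w" by (rule carrier_N_E)
  show "x \<oplus>\<^bsub>N\<^esub> y \<oplus>\<^bsub>N\<^esub> z = x \<oplus>\<^bsub>N\<^esub> (y \<oplus>\<^bsub>N\<^esub> z)"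
    using u v w pi_add[of u v] pi_add[of v w] pi_add[of "u \<oplus>\<^bsub>M\<^esub> v" w] pi_add[of u "v \<oplus>\<^bsub>M\<^esub> w"]
      M.a_assoc[of u v w] by simp
qed

sublocale N: abelian_group N by (rule abelian_group_N)

lemma pi_minus: "u \<in> carrier M \<Longrightarrow> \<pi> (\<ominus>\<^bsub>M\<^esub> u) = \<ominus>\<^bsub>N\<^esub> \<pi> u"
proof -
  assume u: "u \<in> carrier M"
  have "\<pi> (\<ominus>\<^bsub>M\<^esub> u) \<oplus>\<^bsub>N\<^esub> \<pi> u = \<zero>\<^bsub>N\<^esub>"
    using pi_add[of "\<ominus>\<^bsub>M\<^esub> u" u] u pi_zero by (simp add: M.l_neg)
  thus ?thesis using N.minus_equality pi_closed u by (metis M.a_inv_closed)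
qed

lemma pi_diff: "\<lbrakk>u \<in> carrier M; v \<in> carrier M\<rbrakk> \<Longrightarrow> \<pi> (u \<ominus>\<^bsub>M\<^esub> v) = \<pi> u \<ominus>\<^bsub>N\<^esub> \<pi> v"
  unfolding M.minus_eq N.minus_eq using pi_add[of u "\<ominus>\<^bsub>M\<^esub> v"] pi_minus[of v] by simp

lemma submoduleN_D:
  assumes "submodule K R' N"
  shows "K \<subseteq> carrier N" "\<zero>\<^bsub>N\<^esub> \<in> K" "\<And>x y. \<lbrakk>x \<in> K; y \<in> K\<rbrakk> \<Longrightarrow> x \<oplus>\<^bsub>N\<^esub> y \<in> K"
    "\<And>x. x \<in> K \<Longrightarrow> \<ominus>\<^bsub>N\<^esub> x \<in> K" "\<And>a x. \<lbrakk>a \<in> carrier R'; x \<in> K\<rbrakk> \<Longrightarrow> a \<odot>\<^bsub>N\<^esub> x \<in> K"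
    "subgroup K (add_monoid N)"
proof -
  show K: "subgroup K (add_monoid N)" using assms unfolding submodule_def by blast
  show "K \<subseteq> carrier N" "\<zero>\<^bsub>N\<^esub> \<in> K" "\<And>x y. \<lbrakk>x \<in> K; y \<in> K\<rbrakk> \<Longrightarrow> x \<oplus>\<^bsub>N\<^esub> y \<in> K"
    using subgroup.subset[OF K] subgroup.one_closed[OF K] subgroup.m_closed[OF K] by auto
  show "\<ominus>\<^bsub>N\<^esub> x \<in> K" if "x \<in> K" for x
    using subgroup.m_inv_closed[OF K that] by (simp add: a_inv_def)
  show "\<And>a x. \<lbrakk>a \<in> carrier R'; x \<in> K\<rbrakk> \<Longrightarrow> a \<odot>\<^bsub>N\<^esub> x \<in> K"
    by (rule submodule.smult_closed[OF assms])
qed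

lemma preimage_submodule:
  assumes K: "submodule K R' N"
  shows "submodule {u \<in> carrier M. \<pi> u \<in> K} R M"
proof (rule submoduleI_diff)
  show "\<zero>\<^bsub>M\<^esub> \<in> {u \<in> carrier M. \<pi> u \<in> K}" using submoduleN_D(2)[OF K] pi_zero by simp
  show "a \<ominus>\<^bsub>M\<^esub> b \<in> {u \<in> carrier M. \<pi> u \<in> K}"
    if "a \<in> {u \<in> carrier M. \<pi> u \<in> K}" "b \<in> {u \<in> carrier M. \<pi> u \<in> K}" for a b
    using that pi_diff[of a b] submoduleN_D(3,4)[OF K] unfolding N.minus_eq by simp
  show "r \<odot>\<^bsub>M\<^esub> a \<in> {u \<in> carrier M. \<pi> u \<in> K}"
    if "r \<in> carrier R" "a \<in> {u \<in> carrier M. \<pi> u \<in> K}" for r a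
    using that pi_smult[of r a] submoduleN_D(5)[OF K, of "\<phi> r" "\<pi> a"] phi_surj by auto
qed blast

lemma image_submodule:
  assumes L: "submodule L R M"
  shows "submodule (\<pi> ` L) R' N"
proof -
  have Lc: "L \<subseteq> carrier M" using submoduleE(1)[OF L] .
  have "subgroup (\<pi> ` L) (add_monoid N)"
  proof (rule N.add.subgroupI)
    show "\<pi> ` L \<subseteq> carrier N" using Lc pi_closed by blast
    show "\<pi> ` L \<noteq> {}" using submodule_zero[OF L] by blast
    show "\<ominus>\<^bsub>N\<^esub> x \<in> \<pi> ` L" if x: "x \<in> \<pi> ` L" for x
    proof -
      obtain u where u: "u \<in> L" "x = \<pi> u" using x by blast
      have "\<ominus>\<^bsub>N\<^esub> x = \<pi> (\<ominus>\<^bsub>M\<^esub> u)" using pi_minus[of u] u Lc by auto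
      thus ?thesis using submoduleE(3)[OF L u(1)] by blast
    qed
    show "x \<oplus>\<^bsub>N\<^esub> y \<in> \<pi> ` L" if xy: "x \<in> \<pi> ` L" "y \<in> \<pi> ` L" for x y
    proof -
      obtain u v where u: "u \<in> L" "x = \<pi> u" "v \<in> L" "y = \<pi> v" using xy by blast
      have "x \<oplus>\<^bsub>N\<^esub> y = \<pi> (u \<oplus>\<^bsub>M\<^esub> v)" using pi_add[of u v] u submodule_carrier[OF L] by simp
      thus ?thesis using submoduleE(5)[OF L u(1,3)] by blast
    qed
  qed
  moreover have "a \<odot>\<^bsub>N\<^esub> x \<in> \<pi> ` L" if ax: "a \<in> carrier R'" "x \<in> \<pi> ` L" for a x
  proof -
    obtain u where u: "u \<in> L" "x = \<pi> u" using ax by blast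
    obtain r where r: "r \<in> carrier R" "a = \<phi> r" using ax(1) phi_surj by blast
    have "a \<odot>\<^bsub>N\<^esub> x = \<pi> (r \<odot>\<^bsub>M\<^esub> u)" using pi_smult[of r u] u r Lc by auto
    thus ?thesis using submoduleE(4)[OF L r(1) u(1)] by blast
  qed
  ultimately show ?thesis unfolding submodule_def submodule_axioms_def by blast
qed

lemma ker_submodule: "submodule ker R M"
proof -
  have "ker = {u \<in> carrier M. \<pi> u \<in> \<pi> ` {\<zero>\<^bsub>M\<^esub>}}" unfolding ker_def using pi_zero by auto
  thus ?thesis using preimage_submodule[OF image_submodule[OF submodule_singleton_zero]] by simp
qed

lemma pi_mem_image:
  assumes L: "submodule L R M" "ker \<subseteq> L" and u: "u \<in> carrier M"
  shows "\<pi> u \<in> \<pi> ` L \<longleftrightarrow> u \<in> L"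
proof
  assume "\<pi> u \<in> \<pi> ` L"
  then obtain v where v: "v \<in> L" "\<pi> u = \<pi> v" by blast
  have vc: "v \<in> carrier M" using submodule_carrier[OF L(1) v(1)] .
  have "\<pi> (u \<ominus>\<^bsub>M\<^esub> v) = \<zero>\<^bsub>N\<^esub>" using pi_diff[OF u vc] v pi_closed[OF vc] by (simp add: N.minus_eq N.r_neg)
  hence "u \<ominus>\<^bsub>M\<^esub> v \<in> L" using L(2) u vc unfolding ker_def by auto
  thus "u \<in> L" using submodule_mem_of_diff[OF L(1) u vc _ v(1)] by blast
qed blast

text \<open>Images and preimages of submodules are submodules, so the least submodule containing the
  products in \<open>N\<close> corresponds to the least one in \<open>M\<close> that contains
  \<open>ker\<close> and the products there.\<close>

lemma set_smult_image:
  assumes J: "J \<subseteq> carrier R"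
  shows "set_smult R' (\<phi> ` J) N = \<pi> ` adjoin R M ker J"
proof -
  let ?G = "{a \<odot>\<^bsub>N\<^esub> x |a x. a \<in> \<phi> ` J \<and> x \<in> carrier N}"
  have kc: "ker \<subseteq> carrier M" unfolding ker_def by blast
  have sub: "submodule (adjoin R M ker J) R M" by (rule adjoin_submodule[OF kc J])
  have G: "?G = {\<pi> (a \<odot>\<^bsub>M\<^esub> x) |a x. a \<in> J \<and> x \<in> carrier M}"
  proof (intro equalityI subsetI)
    fix v assume "v \<in> ?G"
    then obtain r x where v: "v = \<phi> r \<odot>\<^bsub>N\<^esub> x" "r \<in> J" "x \<in> carrier N" by blast
    moreover obtain u where "u \<in> carrier M" "x = \<pi> u" by (rule carrier_N_E[OF v(3)])
    ultimately have "v = \<pi> (r \<odot>\<^bsub>M\<^esub> u) \<and> r \<in> J \<and> u \<in> carrier M" using pi_smult[of r u] J by auto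
    thus "v \<in> {\<pi> (a \<odot>\<^bsub>M\<^esub> x) |a x. a \<in> J \<and> x \<in> carrier M}" by blast
  next
    fix v assume "v \<in> {\<pi> (a \<odot>\<^bsub>M\<^esub> x) |a x. a \<in> J \<and> x \<in> carrier M}"
    then obtain a u where v: "v = \<pi> (a \<odot>\<^bsub>M\<^esub> u)" "a \<in> J" "u \<in> carrier M" by blast
    hence "v = \<phi> a \<odot>\<^bsub>N\<^esub> \<pi> u \<and> \<phi> a \<in> \<phi> ` J \<and> \<pi> u \<in> carrier N"
      using pi_smult[of a u] pi_closed[of u] J by auto
    thus "v \<in> ?G" by blast
  qed
  show ?thesis
  proof
    have "?G \<subseteq> \<pi> ` adjoin R M ker J" unfolding G using adjoin_mem by fast
    thus "set_smult R' (\<phi> ` J) N \<subseteq> \<pi> ` adjoin R M ker J"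
      unfolding set_smult_def by (rule module_span_minimal[OF image_submodule[OF sub]])
    show "\<pi> ` adjoin R M ker J \<subseteq> set_smult R' (\<phi> ` J) N"
    proof
      fix v assume "v \<in> \<pi> ` adjoin R M ker J"
      then obtain u where u: "u \<in> adjoin R M ker J" "v = \<pi> u" by blast
      have "\<pi> u \<in> K" if K: "submodule K R' N" "?G \<subseteq> K" for K
      proof -
        have "adjoin R M ker J \<subseteq> {u \<in> carrier M. \<pi> u \<in> K}"
        proof (rule adjoin_minimal[OF preimage_submodule[OF K(1)]])
          show "ker \<subseteq> {u \<in> carrier M. \<pi> u \<in> K}"
            unfolding ker_def using submoduleN_D(2)[OF K(1)] by auto
          show "a \<odot>\<^bsub>M\<^esub> x \<in> {u \<in> carrier M. \<pi> u \<in> K}" if "a \<in> J" "x \<in> carrier M" for a x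
          proof -
            have "\<pi> (a \<odot>\<^bsub>M\<^esub> x) \<in> ?G" unfolding G using that by blast
            moreover have "a \<in> carrier R" using that J by blast
            ultimately show ?thesis using K(2) that smult_closed by blast
          qed
        qed
        thus ?thesis using u by blast
      qed
      thus "v \<in> set_smult R' (\<phi> ` J) N" unfolding set_smult_def module_span_def u(2) by blast
    qed
  qed
qed

lemma image_eq_carrier_iff:
  assumes L: "submodule L R M" "ker \<subseteq> L"
  shows "\<pi> ` L = carrier N \<longleftrightarrow> L = carrier M"
proof
  assume "\<pi> ` L = carrier N"
  hence "u \<in> L" if "u \<in> carrier M" for u using pi_mem_image[OF L that] pi_closed[OF that] by blast
  thus "L = carrier M" using submoduleE(1)[OF L(1)] by blast
qed (use pi_surj in blast)

text \<open>Since \<open>L\<close> contains \<open>ker\<close>, a coset modulo the image of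
  \<open>L\<close> is zero exactly when any representative upstairs lies in
  \<open>L\<close>.\<close>

lemma regular_element_iff:
  assumes L: "submodule L R M" "ker \<subseteq> L" and r: "r \<in> carrier R"
  shows "regular_element (quot_module N (\<pi> ` L)) (\<phi> r) \<longleftrightarrow>
    (\<forall>u\<in>carrier M. r \<odot>\<^bsub>M\<^esub> u \<in> L \<longrightarrow> u \<in> L)"
proof -
  define K where "K = \<pi> ` L"
  have Ksub: "submodule K R' N" unfolding K_def by (rule image_submodule[OF L(1)])
  note K = submoduleN_D[OF Ksub]
  have coset_eq: "K +>\<^bsub>N\<^esub> \<pi> u = K \<longleftrightarrow> u \<in> L" if u: "u \<in> carrier M" for u
    using N.a_coset_join1[OF _ pi_closed[OF u] K(6)] N.a_coset_join2[OF pi_closed[OF u] K(6)]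
      pi_mem_image[OF L u] unfolding K_def by blast
  have smult: "coset_smult N K (\<phi> r) (K +>\<^bsub>N\<^esub> \<pi> u) = K +>\<^bsub>N\<^esub> \<pi> (r \<odot>\<^bsub>M\<^esub> u)" if u: "u \<in> carrier M" for u
  proof -
    have ru: "r \<odot>\<^bsub>M\<^esub> u \<in> carrier M" using r u by simp
    \<comment> \<open>\<open>coset_smult\<close> is a union over all representatives of the coset;
      each of them contributes the same coset.\<close>
    have "K +>\<^bsub>N\<^esub> (\<phi> r \<odot>\<^bsub>N\<^esub> x) = K +>\<^bsub>N\<^esub> \<pi> (r \<odot>\<^bsub>M\<^esub> u)" if x: "x \<in> K +>\<^bsub>N\<^esub> \<pi> u" for x
    proof -
      obtain k where "k \<in> K" "x = k \<oplus>\<^bsub>N\<^esub> \<pi> u" using x unfolding a_r_coset_def' by blast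
      then obtain l where l: "l \<in> L" "x = \<pi> l \<oplus>\<^bsub>N\<^esub> \<pi> u" unfolding K_def by blast
      have lc: "l \<in> carrier M" using submodule_carrier[OF L(1) l(1)] .
      have rl: "r \<odot>\<^bsub>M\<^esub> l \<in> L" using submoduleE(4)[OF L(1) r l(1)] .
      have "\<phi> r \<odot>\<^bsub>N\<^esub> x = \<pi> (r \<odot>\<^bsub>M\<^esub> (l \<oplus>\<^bsub>M\<^esub> u))" using l lc u r pi_add pi_smult by simp
      also have "\<dots> = \<pi> (r \<odot>\<^bsub>M\<^esub> l) \<oplus>\<^bsub>N\<^esub> \<pi> (r \<odot>\<^bsub>M\<^esub> u)"
        using lc u r pi_add by (simp add: smult_r_distr)
      finally have "\<phi> r \<odot>\<^bsub>N\<^esub> x \<in> K +>\<^bsub>N\<^esub> \<pi> (r \<odot>\<^bsub>M\<^esub> u)"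
        using rl unfolding a_r_coset_def' K_def by blast
      thus ?thesis using N.a_repr_independence[OF _ pi_closed[OF ru] K(6)] by simp
    qed
    moreover have "\<pi> u \<in> K +>\<^bsub>N\<^esub> \<pi> u"
      using K(2) pi_closed[OF u] unfolding a_r_coset_def' by force
    ultimately show ?thesis unfolding coset_smult_def by blast
  qed
  have car: "carrier (quot_module N K) = {K +>\<^bsub>N\<^esub> \<pi> u | u. u \<in> carrier M}"
    unfolding quot_module_def A_RCOSETS_def' pi_surj[symmetric] by auto
  have "regular_element (quot_module N K) (\<phi> r) \<longleftrightarrow>
    (\<forall>u\<in>carrier M. coset_smult N K (\<phi> r) (K +>\<^bsub>N\<^esub> \<pi> u) = K \<longrightarrow> K +>\<^bsub>N\<^esub> \<pi> u = K)"
    unfolding regular_element_def car by (auto simp: quot_module_def)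
  also have "\<dots> \<longleftrightarrow> (\<forall>u\<in>carrier M. r \<odot>\<^bsub>M\<^esub> u \<in> L \<longrightarrow> u \<in> L)"
    using smult coset_eq r smult_closed by simp
  finally show ?thesis unfolding K_def .
qed

lemma regular_sequence_iff:
  assumes "set as \<subseteq> carrier R"
  shows "regular_sequence R' N (map \<phi> as) \<longleftrightarrow>
    regseq R M ker as \<and> adjoin R M ker (set as) \<noteq> carrier M"
proof -
  have kc: "ker \<subseteq> carrier M" unfolding ker_def by blast
  have sub: "submodule (adjoin R M ker S) R M" "ker \<subseteq> adjoin R M ker S" if "S \<subseteq> carrier R" for S
    using adjoin_submodule[OF kc that] adjoin_superset[of ker R M S] by simp_all
  have take: "set (take i as) \<subseteq> carrier R" for i using assms set_take_subset[of i as] by simp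
  have 1: "set_smult R' (set (take i (map \<phi> as))) N = \<pi> ` adjoin R M ker (set (take i as))" for i
    using set_smult_image[OF take] by (simp add: take_map)
  have 2: "set_smult R' (set (map \<phi> as)) N = \<pi> ` adjoin R M ker (set as)"
    using set_smult_image[OF assms] by simp
  have 3: "regular_element (quot_module N (\<pi> ` adjoin R M ker (set (take i as)))) (map \<phi> as ! i) \<longleftrightarrow>
      (\<forall>z\<in>carrier M. as ! i \<odot>\<^bsub>M\<^esub> z \<in> adjoin R M ker (set (take i as)) \<longrightarrow>
        z \<in> adjoin R M ker (set (take i as)))" if i: "i < length as" for i
  proof -
    have "as ! i \<in> carrier R" using assms nth_mem[OF i] by blast
    thus ?thesis unfolding nth_map[OF i] by (rule regular_element_iff[OF sub[OF take]])
  qed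
  have 4: "set (map \<phi> as) \<subseteq> carrier R'" using assms phi_surj by auto
  have 5: "(\<forall>i<length (map \<phi> as).
      regular_element (quot_module N (\<pi> ` adjoin R M ker (set (take i as)))) (map \<phi> as ! i))
    \<longleftrightarrow> regseq R M ker as"
    unfolding regseq_iff_nth[OF ker_submodule assms] length_map using 3 by blast
  show ?thesis
    unfolding regular_sequence_def 1 2 image_eq_carrier_iff[OF sub[OF assms]] 5 using 4 by blast
qed

lemma grade_image:
  assumes J: "J \<subseteq> carrier R"
  shows "grade R' (\<phi> ` J) N = (if adjoin R M ker J = carrier M then \<infinity>
    else Sup {enat (length as) | as. set as \<subseteq> J \<and> regseq R M ker as})"
proof -
  have kc: "ker \<subseteq> carrier M" unfolding ker_def by blast
  have sub: "submodule (adjoin R M ker J) R M" "ker \<subseteq> adjoin R M ker J"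
    using adjoin_submodule[OF kc J] adjoin_superset[of ker R M J] by simp_all
  have eq: "set_smult R' (\<phi> ` J) N = carrier N \<longleftrightarrow> adjoin R M ker J = carrier M"
    unfolding set_smult_image[OF J] by (rule image_eq_carrier_iff[OF sub])
  have "{enat (length bs) | bs. set bs \<subseteq> \<phi> ` J \<and> regular_sequence R' N bs} =
      {enat (length as) | as. set as \<subseteq> J \<and> regseq R M ker as}" (is "?A = ?B")
    if ne: "adjoin R M ker J \<noteq> carrier M"
  proof
    show "?A \<subseteq> ?B"
    proof
      fix n assume "n \<in> ?A"
      then obtain bs where bs: "n = enat (length bs)" "set bs \<subseteq> \<phi> ` J" "regular_sequence R' N bs" by blast
      \<comment> \<open>A sequence in the image ideal is lifted entry by entry to one in
        \<open>J\<close>.\<close>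
      have "bs \<in> lists (\<phi> ` J)" using bs(2) by (simp add: lists_eq_set)
      then obtain as where as: "as \<in> lists J" "bs = map \<phi> as" unfolding lists_image by blast
      have aJ: "set as \<subseteq> J" using as(1) by (simp add: lists_eq_set)
      have "set as \<subseteq> carrier R" using aJ J by blast
      hence "regseq R M ker as" using regular_sequence_iff bs(3) as(2) by blast
      thus "n \<in> ?B" using aJ bs(1) as(2) by auto
    qed
    show "?B \<subseteq> ?A"
    proof
      fix n assume "n \<in> ?B"
      then obtain as where as: "n = enat (length as)" "set as \<subseteq> J" "regseq R M ker as" by blast
      have asR: "set as \<subseteq> carrier R" using as(2) J by blast
      have "adjoin R M ker (set as) \<subseteq> adjoin R M ker J" by (rule adjoin_mono[OF kc _ J as(2)]) simp
      \<comment> \<open>Properness for \<open>as\<close> follows from properness for all of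
        \<open>J\<close>, so inside \<open>J\<close> weak regularity suffices.\<close>
      hence "adjoin R M ker (set as) \<noteq> carrier M" using ne submoduleE(1)[OF sub(1)] by blast
      hence "regular_sequence R' N (map \<phi> as)" using regular_sequence_iff[OF asR] as(3) by blast
      moreover have "set (map \<phi> as) \<subseteq> \<phi> ` J" using as(2) by auto
      ultimately show "n \<in> ?A" using as(1) by (intro CollectI exI[of _ "map \<phi> as"]) simp
    qed
  qed
  thus ?thesis unfolding grade_def eq by simp
qed

text \<open>Depth sensitivity of the Koszul complex on generators of \<open>J\<close>. Comparing the
  grade with a natural number avoids deciding whether the supremum is finite or attained.\<close>

lemma le_grade_iff:
  assumes y: "\<And>j. j < s \<Longrightarrow> y j \<in> carrier R" and J: "J = Idl (y ` {..<s})"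
    and acc: "chain_cond (\<lambda>N. submodule N R M)" and ne: "adjoin R M ker J \<noteq> carrier M"
  shows "enat n \<le> grade R' (\<phi> ` J) N \<longleftrightarrow> (\<forall>d<int n. koszul_exact M y s ker d)"
proof -
  have yR: "y ` {..<s} \<subseteq> carrier R" using y by auto
  have Jc: "J \<subseteq> carrier R" unfolding J using ideal.Icarr[OF R.genideal_ideal[OF yR]] by blast
  let ?A = "{enat (length as) | as. set as \<subseteq> J \<and> regseq R M ker as}"
  have g: "grade R' (\<phi> ` J) N = Sup ?A" using grade_image[OF Jc] ne by simp
  show ?thesis
  proof
    assume le: "enat n \<le> grade R' (\<phi> ` J) N"
    show "\<forall>d<int n. koszul_exact M y s ker d"
    proof (intro allI impI)
      fix d assume d: "d < int n"
      show "koszul_exact M y s ker d"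
      proof (cases "n = 0")
        case True
        hence dn: "d < 0" using d by simp
        show ?thesis by (rule koszul_exact_neg[OF y ker_submodule dn])
      next
        case False
        \<comment> \<open>Strictly below the supremum, so some regular sequence in \<open>J\<close>
          is longer than \<open>n - 1\<close>.\<close>
        hence "enat (n - 1) < enat n" by simp
        hence "enat (n - 1) < Sup ?A" using le unfolding g by (rule less_le_trans)
        hence "\<exists>m\<in>?A. enat (n - 1) < m" unfolding less_Sup_iff .
        then obtain as where as: "enat (n - 1) < enat (length as)" "set as \<subseteq> J" "regseq R M ker as"
          by blast
        have da: "d < int (length as)" using as(1) d by simp
        show ?thesis by (rule regseq_imp_koszul_exact[OF y ker_submodule as(2)[unfolded J] as(3) da])
      qed
    qed
  next
    assume ex: "\<forall>d<int n. koszul_exact M y s ker d"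
    have "\<exists>as. length as = n \<and> set as \<subseteq> Idl (y ` {..<s}) \<and> regseq R M ker as"
      by (rule koszul_exact_imp_regseq[OF y acc ker_submodule]) (use ex in blast)+
    then obtain as where "length as = n" "set as \<subseteq> J" "regseq R M ker as" unfolding J by blast
    hence "enat n \<in> ?A" by blast
    thus "enat n \<le> grade R' (\<phi> ` J) N" unfolding g by (rule Sup_upper)
  qed
qed

end

section \<open>Chain conditions\<close>

lemma chain_cond_subset:
  assumes P: "chain_cond P" and QP: "\<And>U. Q U \<Longrightarrow> P U"
  shows "chain_cond Q"
  unfolding chain_cond_def
proof (intro allI impI)
  fix f :: "nat \<Rightarrow> 'a set" assume f: "\<forall>n. Q (f n) \<and> f n \<subseteq> f (Suc n)"
  have Pf: "P (f n)" for n by (rule QP) (simp add: f)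
  have fS: "f n \<subseteq> f (Suc n)" for n using f by simp
  show "\<exists>n. \<forall>m\<ge>n. f m = f n" by (rule chain_condD[where P = P and f = f, OF P Pf fS])
qed

text \<open>A chain of subsets of the image of \<open>C\<close> is determined by its preimages in
  \<open>C\<close>.\<close>

lemma chain_cond_image:
  assumes P: "chain_cond P" and Q: "\<And>U. Q U \<Longrightarrow> P {x \<in> C. \<kappa> x \<in> U}" "\<And>U. Q U \<Longrightarrow> U \<subseteq> \<kappa> ` C"
  shows "chain_cond Q"
  unfolding chain_cond_def
proof (intro allI impI)
  fix f :: "nat \<Rightarrow> 'b set" assume f: "\<forall>n. Q (f n) \<and> f n \<subseteq> f (Suc n)"
  have fS: "f n \<subseteq> f (Suc n)" for n using f by simp
  have "\<exists>n. \<forall>m\<ge>n. {x \<in> C. \<kappa> x \<in> f m} = {x \<in> C. \<kappa> x \<in> f n}"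
  proof (rule chain_condD[where P = P and f = "\<lambda>n. {x \<in> C. \<kappa> x \<in> f n}", OF P])
    show "P {x \<in> C. \<kappa> x \<in> f n}" for n by (rule Q(1)) (simp add: f)
    show "{x \<in> C. \<kappa> x \<in> f n} \<subseteq> {x \<in> C. \<kappa> x \<in> f (Suc n)}" for n using fS[of n] by blast
  qed
  then obtain n where n: "\<forall>m\<ge>n. {x \<in> C. \<kappa> x \<in> f m} = {x \<in> C. \<kappa> x \<in> f n}" by blast
  have img: "f m = \<kappa> ` {x \<in> C. \<kappa> x \<in> f m}" for m
  proof -
    have sub: "f m \<subseteq> \<kappa> ` C" by (rule Q(2)) (simp add: f)
    show ?thesis
    proof (intro equalityI subsetI)
      fix z assume z: "z \<in> f m"
      then obtain x where "x \<in> C" "z = \<kappa> x" using sub by blast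
      thus "z \<in> \<kappa> ` {x \<in> C. \<kappa> x \<in> f m}" using z by blast
    qed blast
  qed
  have "f m = f n" if m: "m \<ge> n" for m
  proof -
    have "f m = \<kappa> ` {x \<in> C. \<kappa> x \<in> f m}" by (rule img)
    also have "\<dots> = \<kappa> ` {x \<in> C. \<kappa> x \<in> f n}" by (rule arg_cong[OF n[rule_format, OF m]])
    also have "\<dots> = f n" by (rule img[symmetric])
    finally show ?thesis .
  qed
  thus "\<exists>n. \<forall>m\<ge>n. f m = f n" by blast
qed

lemma (in noetherian_ring) chain_cond_ideal: "chain_cond (\<lambda>I. ideal I R)"
  unfolding chain_cond_def
proof (intro allI impI)
  fix f :: "nat \<Rightarrow> 'a set" assume f: "\<forall>n. ideal (f n) R \<and> f n \<subseteq> f (Suc n)"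
  have mono: "f i \<subseteq> f j" if "i \<le> j" for i j
    by (rule lift_Suc_mono_le[OF _ that]) (use f in blast)
  have "f i \<subseteq> f j \<or> f j \<subseteq> f i" for i j using mono nat_le_linear[of i j] by blast
  hence "subset.chain {I. ideal I R} (range f)"
    unfolding subset_chain_def using f by blast
  hence "\<Union>(range f) \<in> range f" by (intro ideal_chain_is_trivial) auto
  then obtain n where n: "\<Union>(range f) = f n" by blast
  have "f m = f n" if "m \<ge> n" for m using n mono[OF that] by blast
  thus "\<exists>n. \<forall>m\<ge>n. f m = f n" by blast
qed

text \<open>A submodule over the subring generated by \<open>X\<close>, without forming that
  subring: in \<open>hilbert_basis\<close> the operators are adjoined to \<open>X\<close> one at a
  time.\<close>

definition stable_subgroup :: "('a, 'b, 'c) module_scheme \<Rightarrow> 'a set \<Rightarrow> 'b set \<Rightarrow> bool" where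
  "stable_subgroup M X U \<longleftrightarrow> U \<subseteq> carrier M \<and> \<zero>\<^bsub>M\<^esub> \<in> U \<and> (\<forall>u\<in>U. \<forall>v\<in>U. u \<ominus>\<^bsub>M\<^esub> v \<in> U) \<and> (\<forall>x\<in>X. \<forall>u\<in>U. x \<odot>\<^bsub>M\<^esub> u \<in> U)"

text \<open>
  Hilbert's basis theorem for modules: \<open>polys_below R M y V n\<close> is \<open>V + y V + \<dots> + y\<^sup>n\<^sup>-\<^sup>1 V\<close>, and a
  subgroup \<open>L\<close> stable under \<open>y\<close> is compared with its leading coefficients in \<open>V\<close>.
\<close>

primrec polys_below ::
    "('a, 'r) ring_scheme \<Rightarrow> ('a, 'b, 'c) module_scheme \<Rightarrow> 'a \<Rightarrow> 'b set \<Rightarrow> nat \<Rightarrow> 'b set"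
  where
    "polys_below R M y V 0 = {\<zero>\<^bsub>M\<^esub>}"
  | "polys_below R M y V (Suc n) =
      {(y [^]\<^bsub>R\<^esub> n) \<odot>\<^bsub>M\<^esub> v \<oplus>\<^bsub>M\<^esub> w | v w. v \<in> V \<and> w \<in> polys_below R M y V n}"

text \<open>The sum of \<open>V\<close>, \<open>y V\<close> and so on need not be direct, so an
  element may have several leading coefficients. All are collected, and zero is allowed.\<close>

definition lead_coeffs ::
    "('a, 'r) ring_scheme \<Rightarrow> ('a, 'b, 'c) module_scheme \<Rightarrow> 'a \<Rightarrow> 'b set \<Rightarrow> 'b set \<Rightarrow> nat \<Rightarrow> 'b set"
  where "lead_coeffs R M y V L n =
    {v \<in> V. \<exists>w\<in>polys_below R M y V n. (y [^]\<^bsub>R\<^esub> n) \<odot>\<^bsub>M\<^esub> v \<oplus>\<^bsub>M\<^esub> w \<in> L}"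

section \<open>Hilbert's basis theorem and finitely generated modules\<close>

context module
begin

lemma stable_subgroupD:
  assumes "stable_subgroup M X U"
  shows "U \<subseteq> carrier M" "\<zero>\<^bsub>M\<^esub> \<in> U" "\<And>u v. \<lbrakk>u \<in> U; v \<in> U\<rbrakk> \<Longrightarrow> u \<ominus>\<^bsub>M\<^esub> v \<in> U"
    "\<And>x u. \<lbrakk>x \<in> X; u \<in> U\<rbrakk> \<Longrightarrow> x \<odot>\<^bsub>M\<^esub> u \<in> U"
  using assms unfolding stable_subgroup_def by blast+

lemma stable_subgroup_add:
  assumes U: "stable_subgroup M X U" and uv: "u \<in> U" "v \<in> U"
  shows "u \<oplus>\<^bsub>M\<^esub> v \<in> U"
proof -
  have c: "u \<in> carrier M" "v \<in> carrier M" using stable_subgroupD(1)[OF U] uv by auto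
  have e: "u \<oplus>\<^bsub>M\<^esub> v = u \<ominus>\<^bsub>M\<^esub> (\<zero>\<^bsub>M\<^esub> \<ominus>\<^bsub>M\<^esub> v)" using c by algebra
  show ?thesis unfolding e by (rule stable_subgroupD(3)[OF U uv(1) stable_subgroupD(3)[OF U stable_subgroupD(2)[OF U] uv(2)]])
qed

lemma submodule_imp_stable_subgroup:
  assumes "submodule U R M" "X \<subseteq> carrier R"
  shows "stable_subgroup M X U"
  unfolding stable_subgroup_def
proof (intro conjI ballI)
  show "U \<subseteq> carrier M" by (rule submoduleE(1)[OF assms(1)])
  show "\<zero>\<^bsub>M\<^esub> \<in> U" by (rule submodule_zero[OF assms(1)])
  show "u \<ominus>\<^bsub>M\<^esub> v \<in> U" if "u \<in> U" "v \<in> U" for u v by (rule submodule_diff[OF assms(1) that])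
  show "x \<odot>\<^bsub>M\<^esub> u \<in> U" if "x \<in> X" "u \<in> U" for x u
    using submoduleE(4)[OF assms(1)] that assms(2) by blast
qed

context
  fixes X y V
  assumes X: "X \<subseteq> carrier R" and y: "y \<in> carrier R" and V: "stable_subgroup M X V"
begin

lemma V_carrier: "v \<in> V \<Longrightarrow> v \<in> carrier M"
  using stable_subgroupD(1)[OF V] by blast

lemma y_pow: "y [^]\<^bsub>R\<^esub> (n::nat) \<in> carrier R"
  using y by simp

lemma polys_below_stable_subgroup: "stable_subgroup M X (polys_below R M y V n)"
proof (induction n)
  case 0
  thus ?case unfolding stable_subgroup_def using X by auto
next
  case (Suc n)
  have c: "w \<in> carrier M" if "w \<in> polys_below R M y V n" for w using stable_subgroupD(1)[OF Suc] that by blast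
  show ?case unfolding stable_subgroup_def
  proof (intro conjI ballI)
    show "polys_below R M y V (Suc n) \<subseteq> carrier M" using y_pow[of n] V_carrier c by auto
    have "\<zero>\<^bsub>M\<^esub> = (y [^]\<^bsub>R\<^esub> n) \<odot>\<^bsub>M\<^esub> \<zero>\<^bsub>M\<^esub> \<oplus>\<^bsub>M\<^esub> \<zero>\<^bsub>M\<^esub>" using y_pow[of n] by simp
    thus "\<zero>\<^bsub>M\<^esub> \<in> polys_below R M y V (Suc n)" using stable_subgroupD(2)[OF Suc] stable_subgroupD(2)[OF V] by auto
  next
    fix u u' assume "u \<in> polys_below R M y V (Suc n)" "u' \<in> polys_below R M y V (Suc n)"
    then obtain v w v' w' where u: "u = (y [^]\<^bsub>R\<^esub> n) \<odot>\<^bsub>M\<^esub> v \<oplus>\<^bsub>M\<^esub> w" "u' = (y [^]\<^bsub>R\<^esub> n) \<odot>\<^bsub>M\<^esub> v' \<oplus>\<^bsub>M\<^esub> w'"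
      and m: "v \<in> V" "v' \<in> V" "w \<in> polys_below R M y V n" "w' \<in> polys_below R M y V n" by auto
    have "p \<odot>\<^bsub>M\<^esub> v \<oplus>\<^bsub>M\<^esub> w \<ominus>\<^bsub>M\<^esub> (p \<odot>\<^bsub>M\<^esub> v' \<oplus>\<^bsub>M\<^esub> w') = p \<odot>\<^bsub>M\<^esub> (v \<ominus>\<^bsub>M\<^esub> v') \<oplus>\<^bsub>M\<^esub> (w \<ominus>\<^bsub>M\<^esub> w')" if "p \<in> carrier R" for p
      using V_carrier[OF m(1)] V_carrier[OF m(2)] c[OF m(3)] c[OF m(4)] that by algebra
    hence "u \<ominus>\<^bsub>M\<^esub> u' = (y [^]\<^bsub>R\<^esub> n) \<odot>\<^bsub>M\<^esub> (v \<ominus>\<^bsub>M\<^esub> v') \<oplus>\<^bsub>M\<^esub> (w \<ominus>\<^bsub>M\<^esub> w')" unfolding u using y_pow by blast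
    thus "u \<ominus>\<^bsub>M\<^esub> u' \<in> polys_below R M y V (Suc n)" using stable_subgroupD(3)[OF V m(1,2)] stable_subgroupD(3)[OF Suc m(3,4)] by auto
  next
    fix x u assume x: "x \<in> X" and "u \<in> polys_below R M y V (Suc n)"
    then obtain v w where u: "u = (y [^]\<^bsub>R\<^esub> n) \<odot>\<^bsub>M\<^esub> v \<oplus>\<^bsub>M\<^esub> w" and m: "v \<in> V" "w \<in> polys_below R M y V n" by auto
    have xc: "x \<in> carrier R" using x X by blast
    have "x \<odot>\<^bsub>M\<^esub> u = (y [^]\<^bsub>R\<^esub> n) \<odot>\<^bsub>M\<^esub> (x \<odot>\<^bsub>M\<^esub> v) \<oplus>\<^bsub>M\<^esub> x \<odot>\<^bsub>M\<^esub> w"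
      unfolding u using smult_left_comm[OF xc y_pow[of n] V_carrier[OF m(1)]] xc y_pow[of n] V_carrier[OF m(1)] c[OF m(2)]
      by (simp add: smult_r_distr)
    thus "x \<odot>\<^bsub>M\<^esub> u \<in> polys_below R M y V (Suc n)" using stable_subgroupD(4)[OF V x m(1)] stable_subgroupD(4)[OF Suc x m(2)] by auto
  qed
qed

declare polys_below.simps(2) [simp del]

lemma polys_below_Suc: "polys_below R M y V n \<subseteq> polys_below R M y V (Suc n)"
proof
  fix w assume w: "w \<in> polys_below R M y V n"
  hence "w \<in> carrier M" by (rule subsetD[OF stable_subgroupD(1)[OF polys_below_stable_subgroup]])
  hence e: "(y [^]\<^bsub>R\<^esub> n) \<odot>\<^bsub>M\<^esub> \<zero>\<^bsub>M\<^esub> \<oplus>\<^bsub>M\<^esub> w = w" using y_pow[of n] by simp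
  have "(y [^]\<^bsub>R\<^esub> n) \<odot>\<^bsub>M\<^esub> \<zero>\<^bsub>M\<^esub> \<oplus>\<^bsub>M\<^esub> w \<in> polys_below R M y V (Suc n)"
    unfolding polys_below.simps(2) by (intro CollectI exI conjI) (rule refl, rule stable_subgroupD(2)[OF V], rule w)
  thus "w \<in> polys_below R M y V (Suc n)" unfolding e .
qed

lemma polys_below_mono: "n \<le> m \<Longrightarrow> polys_below R M y V n \<subseteq> polys_below R M y V m"
proof (induction m)
  case (Suc m)
  thus ?case using polys_below_Suc[of m] by (cases "n = Suc m") auto
qed simp

lemma polys_below_mult: "w \<in> polys_below R M y V n \<Longrightarrow> y \<odot>\<^bsub>M\<^esub> w \<in> polys_below R M y V (Suc n)"
proof (induction n arbitrary: w)
  case 0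
  hence "y \<odot>\<^bsub>M\<^esub> w = \<zero>\<^bsub>M\<^esub>" using y by simp
  thus ?case using stable_subgroupD(2)[OF polys_below_stable_subgroup[of "Suc 0"]] by simp
next
  case (Suc n)
  then obtain v u where w: "w = (y [^]\<^bsub>R\<^esub> n) \<odot>\<^bsub>M\<^esub> v \<oplus>\<^bsub>M\<^esub> u" "v \<in> V" "u \<in> polys_below R M y V n"
    unfolding polys_below.simps by blast
  have uc: "u \<in> carrier M" using stable_subgroupD(1)[OF polys_below_stable_subgroup] w(3) by blast
  have "y \<odot>\<^bsub>M\<^esub> w = (y [^]\<^bsub>R\<^esub> Suc n) \<odot>\<^bsub>M\<^esub> v \<oplus>\<^bsub>M\<^esub> y \<odot>\<^bsub>M\<^esub> u"
    unfolding w(1) using y y_pow[of n] V_carrier[OF w(2)] uc R.m_comm[OF y_pow[of n] y]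
    by (simp add: smult_r_distr smult_assoc1[symmetric])
  thus ?case using w(2) Suc.IH[OF w(3)] unfolding polys_below.simps(2)[of R M y V "Suc n"] by blast
qed

lemma polys_below_Union: "stable_subgroup M (insert y X) (\<Union>n. polys_below R M y V n)"
  unfolding stable_subgroup_def
proof (intro conjI ballI)
  show "(\<Union>n. polys_below R M y V n) \<subseteq> carrier M" using stable_subgroupD(1)[OF polys_below_stable_subgroup] by blast
  show "\<zero>\<^bsub>M\<^esub> \<in> (\<Union>n. polys_below R M y V n)" using stable_subgroupD(2)[OF polys_below_stable_subgroup[of 0]] by blast
next
  fix u v assume "u \<in> (\<Union>n. polys_below R M y V n)" "v \<in> (\<Union>n. polys_below R M y V n)"
  then obtain m n where "u \<in> polys_below R M y V m" "v \<in> polys_below R M y V n" by blast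
  hence "u \<in> polys_below R M y V (max m n)" "v \<in> polys_below R M y V (max m n)"
    using polys_below_mono[of m "max m n"] polys_below_mono[of n "max m n"] by auto
  thus "u \<ominus>\<^bsub>M\<^esub> v \<in> (\<Union>n. polys_below R M y V n)" using stable_subgroupD(3)[OF polys_below_stable_subgroup] by blast
next
  fix x u assume x: "x \<in> insert y X" and "u \<in> (\<Union>n. polys_below R M y V n)"
  then obtain n where n: "u \<in> polys_below R M y V n" by blast
  show "x \<odot>\<^bsub>M\<^esub> u \<in> (\<Union>n. polys_below R M y V n)"
  proof (cases "x = y")
    case True
    thus ?thesis using polys_below_mult[OF n] by blast
  next
    case False
    hence "x \<in> X" using x by simp
    thus ?thesis using stable_subgroupD(4)[OF polys_below_stable_subgroup _ n] by blast
  qed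
qed

lemma V_subset: "V \<subseteq> (\<Union>n. polys_below R M y V n)"
proof
  fix v assume v: "v \<in> V"
  hence e: "(y [^]\<^bsub>R\<^esub> (0::nat)) \<odot>\<^bsub>M\<^esub> v \<oplus>\<^bsub>M\<^esub> \<zero>\<^bsub>M\<^esub> = v" using V_carrier by simp
  have "(y [^]\<^bsub>R\<^esub> (0::nat)) \<odot>\<^bsub>M\<^esub> v \<oplus>\<^bsub>M\<^esub> \<zero>\<^bsub>M\<^esub> \<in> polys_below R M y V (Suc 0)" using v unfolding polys_below.simps by blast
  hence "v \<in> polys_below R M y V (Suc 0)" unfolding e .
  thus "v \<in> (\<Union>n. polys_below R M y V n)" by (rule UN_I[OF UNIV_I])
qed

lemma lead_coeffs_stable_subgroup:
  assumes L: "stable_subgroup M (insert y X) L"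
  shows "stable_subgroup M X (lead_coeffs R M y V L n)"
proof -
  have c: "w \<in> carrier M" if "w \<in> polys_below R M y V n" for w using stable_subgroupD(1)[OF polys_below_stable_subgroup] that by blast
  show ?thesis unfolding stable_subgroup_def
  proof (intro conjI ballI)
    show "lead_coeffs R M y V L n \<subseteq> carrier M" unfolding lead_coeffs_def using V_carrier by blast
    have "(y [^]\<^bsub>R\<^esub> n) \<odot>\<^bsub>M\<^esub> \<zero>\<^bsub>M\<^esub> \<oplus>\<^bsub>M\<^esub> \<zero>\<^bsub>M\<^esub> = \<zero>\<^bsub>M\<^esub>" using y_pow[of n] by simp
    hence "(y [^]\<^bsub>R\<^esub> n) \<odot>\<^bsub>M\<^esub> \<zero>\<^bsub>M\<^esub> \<oplus>\<^bsub>M\<^esub> \<zero>\<^bsub>M\<^esub> \<in> L" using stable_subgroupD(2)[OF L] by simp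
    thus "\<zero>\<^bsub>M\<^esub> \<in> lead_coeffs R M y V L n" unfolding lead_coeffs_def using stable_subgroupD(2)[OF V] stable_subgroupD(2)[OF polys_below_stable_subgroup] by blast
  next
    fix v v' assume "v \<in> lead_coeffs R M y V L n" "v' \<in> lead_coeffs R M y V L n"
    then obtain w w' where m: "v \<in> V" "v' \<in> V" "w \<in> polys_below R M y V n" "w' \<in> polys_below R M y V n"
      and l: "(y [^]\<^bsub>R\<^esub> n) \<odot>\<^bsub>M\<^esub> v \<oplus>\<^bsub>M\<^esub> w \<in> L" "(y [^]\<^bsub>R\<^esub> n) \<odot>\<^bsub>M\<^esub> v' \<oplus>\<^bsub>M\<^esub> w' \<in> L"
      unfolding lead_coeffs_def by blast
    have "p \<odot>\<^bsub>M\<^esub> v \<oplus>\<^bsub>M\<^esub> w \<ominus>\<^bsub>M\<^esub> (p \<odot>\<^bsub>M\<^esub> v' \<oplus>\<^bsub>M\<^esub> w') = p \<odot>\<^bsub>M\<^esub> (v \<ominus>\<^bsub>M\<^esub> v') \<oplus>\<^bsub>M\<^esub> (w \<ominus>\<^bsub>M\<^esub> w')" if "p \<in> carrier R" for p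
      using V_carrier[OF m(1)] V_carrier[OF m(2)] c[OF m(3)] c[OF m(4)] that by algebra
    from this[OF y_pow[of n]] have "(y [^]\<^bsub>R\<^esub> n) \<odot>\<^bsub>M\<^esub> (v \<ominus>\<^bsub>M\<^esub> v') \<oplus>\<^bsub>M\<^esub> (w \<ominus>\<^bsub>M\<^esub> w') \<in> L"
      using stable_subgroupD(3)[OF L l] by simp
    thus "v \<ominus>\<^bsub>M\<^esub> v' \<in> lead_coeffs R M y V L n" unfolding lead_coeffs_def
      using stable_subgroupD(3)[OF V m(1,2)] stable_subgroupD(3)[OF polys_below_stable_subgroup m(3,4)] by blast
  next
    fix x v assume x: "x \<in> X" and "v \<in> lead_coeffs R M y V L n"
    then obtain w where m: "v \<in> V" "w \<in> polys_below R M y V n" and l: "(y [^]\<^bsub>R\<^esub> n) \<odot>\<^bsub>M\<^esub> v \<oplus>\<^bsub>M\<^esub> w \<in> L"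
      unfolding lead_coeffs_def by blast
    have xc: "x \<in> carrier R" using x X by blast
    have "x \<odot>\<^bsub>M\<^esub> ((y [^]\<^bsub>R\<^esub> n) \<odot>\<^bsub>M\<^esub> v \<oplus>\<^bsub>M\<^esub> w) = (y [^]\<^bsub>R\<^esub> n) \<odot>\<^bsub>M\<^esub> (x \<odot>\<^bsub>M\<^esub> v) \<oplus>\<^bsub>M\<^esub> x \<odot>\<^bsub>M\<^esub> w"
      using smult_left_comm[OF xc y_pow[of n] V_carrier[OF m(1)]] xc y_pow[of n] V_carrier[OF m(1)] c[OF m(2)]
      by (simp add: smult_r_distr)
    hence "(y [^]\<^bsub>R\<^esub> n) \<odot>\<^bsub>M\<^esub> (x \<odot>\<^bsub>M\<^esub> v) \<oplus>\<^bsub>M\<^esub> x \<odot>\<^bsub>M\<^esub> w \<in> L" using stable_subgroupD(4)[OF L _ l, of x] x by simp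
    thus "x \<odot>\<^bsub>M\<^esub> v \<in> lead_coeffs R M y V L n" unfolding lead_coeffs_def
      using stable_subgroupD(4)[OF V x m(1)] stable_subgroupD(4)[OF polys_below_stable_subgroup x m(2)] by blast
  qed
qed

lemma lead_coeffs_Suc:
  assumes L: "stable_subgroup M (insert y X) L"
  shows "lead_coeffs R M y V L n \<subseteq> lead_coeffs R M y V L (Suc n)"
proof
  fix v assume "v \<in> lead_coeffs R M y V L n"
  then obtain w where m: "v \<in> V" "w \<in> polys_below R M y V n" and l: "(y [^]\<^bsub>R\<^esub> n) \<odot>\<^bsub>M\<^esub> v \<oplus>\<^bsub>M\<^esub> w \<in> L"
    unfolding lead_coeffs_def by blast
  have wc: "w \<in> carrier M" using stable_subgroupD(1)[OF polys_below_stable_subgroup] m(2) by blast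
  have "y \<odot>\<^bsub>M\<^esub> ((y [^]\<^bsub>R\<^esub> n) \<odot>\<^bsub>M\<^esub> v \<oplus>\<^bsub>M\<^esub> w) = (y [^]\<^bsub>R\<^esub> Suc n) \<odot>\<^bsub>M\<^esub> v \<oplus>\<^bsub>M\<^esub> y \<odot>\<^bsub>M\<^esub> w"
    using y y_pow[of n] V_carrier[OF m(1)] wc R.m_comm[OF y_pow[of n] y]
    by (simp add: smult_r_distr smult_assoc1[symmetric])
  hence "(y [^]\<^bsub>R\<^esub> Suc n) \<odot>\<^bsub>M\<^esub> v \<oplus>\<^bsub>M\<^esub> y \<odot>\<^bsub>M\<^esub> w \<in> L" using stable_subgroupD(4)[OF L _ l, of y] by simp
  thus "v \<in> lead_coeffs R M y V L (Suc n)" unfolding lead_coeffs_def using m(1) polys_below_mult[OF m(2)] by blast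
qed

lemma lead_coeffs_mono:
  assumes L': "stable_subgroup M (insert y X) L'" and "L \<subseteq> L'" "n \<le> m"
  shows "lead_coeffs R M y V L n \<subseteq> lead_coeffs R M y V L' m"
proof -
  have "lead_coeffs R M y V L n \<subseteq> lead_coeffs R M y V L' n" unfolding lead_coeffs_def using assms(2) by blast
  also have "\<dots> \<subseteq> lead_coeffs R M y V L' m" by (rule lift_Suc_mono_le[of "lead_coeffs R M y V L'", OF lead_coeffs_Suc[OF L'] assms(3)])
  finally show ?thesis .
qed

text \<open>An element of \<open>L'\<close> is reduced by an element of \<open>L\<close> with the
  same leading coefficient; the difference stays in \<open>L'\<close> and has lower degree, where
  the induction applies.\<close>

lemma subset_if_ld_subset:
  assumes L: "stable_subgroup M (insert y X) L" and L': "stable_subgroup M (insert y X) L'" and LL: "L \<subseteq> L'"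
    and ld: "\<And>n. lead_coeffs R M y V L' n \<subseteq> lead_coeffs R M y V L n"
  shows "L' \<inter> polys_below R M y V n \<subseteq> L"
proof (induction n)
  case 0
  thus ?case using stable_subgroupD(2)[OF L] by auto
next
  case (Suc n)
  show ?case
  proof
    fix u assume u: "u \<in> L' \<inter> polys_below R M y V (Suc n)"
    then obtain v w where e: "u = (y [^]\<^bsub>R\<^esub> n) \<odot>\<^bsub>M\<^esub> v \<oplus>\<^bsub>M\<^esub> w" and m: "v \<in> V" "w \<in> polys_below R M y V n"
      unfolding polys_below.simps by blast
    have "v \<in> lead_coeffs R M y V L' n" unfolding lead_coeffs_def using u e m by blast
    hence "v \<in> lead_coeffs R M y V L n" using ld by blast
    then obtain w' where w': "w' \<in> polys_below R M y V n" "(y [^]\<^bsub>R\<^esub> n) \<odot>\<^bsub>M\<^esub> v \<oplus>\<^bsub>M\<^esub> w' \<in> L" unfolding lead_coeffs_def by blast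
    let ?u = "(y [^]\<^bsub>R\<^esub> n) \<odot>\<^bsub>M\<^esub> v \<oplus>\<^bsub>M\<^esub> w'"
    have c: "w \<in> carrier M" "w' \<in> carrier M" using stable_subgroupD(1)[OF polys_below_stable_subgroup] m(2) w'(1) by blast+
    have "p \<odot>\<^bsub>M\<^esub> v \<oplus>\<^bsub>M\<^esub> w \<ominus>\<^bsub>M\<^esub> (p \<odot>\<^bsub>M\<^esub> v \<oplus>\<^bsub>M\<^esub> w') = w \<ominus>\<^bsub>M\<^esub> w'" if "p \<in> carrier R" for p
      using V_carrier[OF m(1)] c that by algebra
    hence d: "u \<ominus>\<^bsub>M\<^esub> ?u = w \<ominus>\<^bsub>M\<^esub> w'" unfolding e using y_pow by blast
    have "u \<ominus>\<^bsub>M\<^esub> ?u \<in> L'" using stable_subgroupD(3)[OF L'] u LL w'(2) by blast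
    moreover have "u \<ominus>\<^bsub>M\<^esub> ?u \<in> polys_below R M y V n" unfolding d by (rule stable_subgroupD(3)[OF polys_below_stable_subgroup m(2) w'(1)])
    ultimately have "u \<ominus>\<^bsub>M\<^esub> ?u \<in> L" using Suc by blast
    hence "(u \<ominus>\<^bsub>M\<^esub> ?u) \<oplus>\<^bsub>M\<^esub> ?u \<in> L" using stable_subgroup_add[OF L _ w'(2)] by blast
    moreover have uc: "u \<in> carrier M" "?u \<in> carrier M"
      using stable_subgroupD(1)[OF L'] u stable_subgroupD(1)[OF L] w'(2) by blast+
    have "(a \<ominus>\<^bsub>M\<^esub> b) \<oplus>\<^bsub>M\<^esub> b = a" if "a \<in> carrier M" "b \<in> carrier M" for a b using that by algebra
    hence "(u \<ominus>\<^bsub>M\<^esub> ?u) \<oplus>\<^bsub>M\<^esub> ?u = u" using uc by blast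
    ultimately show "u \<in> L" by simp
  qed
qed

lemma hilbert_step:
  assumes cc: "chain_cond (\<lambda>U. stable_subgroup M X U \<and> U \<subseteq> V)"
  shows "chain_cond (\<lambda>U. stable_subgroup M (insert y X) U \<and> U \<subseteq> (\<Union>n. polys_below R M y V n))"
  unfolding chain_cond_def
proof (intro allI impI)
  fix f :: "nat \<Rightarrow> _ set"
  assume f: "\<forall>n. (stable_subgroup M (insert y X) (f n) \<and> f n \<subseteq> (\<Union>n. polys_below R M y V n)) \<and> f n \<subseteq> f (Suc n)"
  have fo: "stable_subgroup M (insert y X) (f n)" for n using f by simp
  have fW: "f n \<subseteq> (\<Union>n. polys_below R M y V n)" for n using f by simp
  have fm: "f i \<subseteq> f j" if "i \<le> j" for i j
    by (rule lift_Suc_mono_le[OF _ that]) (use f in blast)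
  have ldV: "lead_coeffs R M y V L n \<subseteq> V" for L n unfolding lead_coeffs_def by blast
  have ldc: "stable_subgroup M X (lead_coeffs R M y V (f k) n) \<and> lead_coeffs R M y V (f k) n \<subseteq> V" for k n
    using lead_coeffs_stable_subgroup[OF fo] ldV by blast
  \<comment> \<open>The diagonal chain grows in the index of \<open>f\<close> and in the degree at
    once; its limit controls all degrees from \<open>n0\<close> on.\<close>
  have "\<exists>n. \<forall>m\<ge>n. lead_coeffs R M y V (f m) m = lead_coeffs R M y V (f n) n"
    by (rule chain_condD[OF cc ldc], rule lead_coeffs_mono[OF fo fm]) simp_all
  then obtain n0 where n0: "\<And>m. m \<ge> n0 \<Longrightarrow> lead_coeffs R M y V (f m) m = lead_coeffs R M y V (f n0) n0" by blast
  \<comment> \<open>Each fixed degree has its own stationary index; these are used for the degrees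
    below \<open>n0\<close>.\<close>
  have "\<exists>k. \<forall>m\<ge>k. lead_coeffs R M y V (f m) n = lead_coeffs R M y V (f k) n" for n
    by (rule chain_condD[OF cc ldc], rule lead_coeffs_mono[OF fo fm]) simp_all
  then obtain K where K: "\<And>n m. m \<ge> K n \<Longrightarrow> lead_coeffs R M y V (f m) n = lead_coeffs R M y V (f (K n)) n" by metis
  \<comment> \<open>The sum serves as a common upper bound of the \<open>K n\<close> with
    \<open>n\<close> below \<open>n0\<close>.\<close>
  define k0 where "k0 = n0 + (\<Sum>n<n0. K n)"
  have "f k \<subseteq> f k0" if k: "k \<ge> k0" for k
  proof -
    have ldk: "lead_coeffs R M y V (f k) n \<subseteq> lead_coeffs R M y V (f k0) n" for n
    proof (cases "n < n0")
      case True
      hence "K n \<le> (\<Sum>n<n0. K n)" by (intro member_le_sum) auto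
      hence "k0 \<ge> K n" unfolding k0_def by simp
      thus ?thesis using K[of n k] K[of n k0] k by simp
    next
      case False
      \<comment> \<open>Compare with the diagonal at \<open>max k n\<close>, which already has its
        stable value, and return from \<open>n0\<close> to the index \<open>k0\<close> and the
        degree \<open>n\<close>.\<close>
      have "lead_coeffs R M y V (f k) n \<subseteq> lead_coeffs R M y V (f (max k n)) (max k n)" by (rule lead_coeffs_mono[OF fo fm]) auto
      also have "\<dots> = lead_coeffs R M y V (f n0) n0" by (rule n0) (use False in simp)
      also have "\<dots> \<subseteq> lead_coeffs R M y V (f k0) n" by (rule lead_coeffs_mono[OF fo fm]) (use False in \<open>auto simp: k0_def\<close>)
      finally show ?thesis .
    qed
    have "f k \<inter> polys_below R M y V n \<subseteq> f k0" for n by (rule subset_if_ld_subset[OF fo fo fm[OF k] ldk])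
    thus ?thesis using fW[of k] by blast
  qed
  hence "\<forall>m\<ge>k0. f m = f k0" using fm by blast
  thus "\<exists>n. \<forall>m\<ge>n. f m = f n" by blast
qed

end

text \<open>\<open>gen\<close> says that \<open>V\<close> generates \<open>M\<close> under the
  operators in \<open>X\<close> and \<open>Y\<close>. Each operator of \<open>Y\<close> enlarges the
  subgroup inside which the chain condition is known, until it is all of \<open>M\<close>.\<close>

lemma hilbert_basis:
  assumes X: "X \<subseteq> carrier R" and V: "stable_subgroup M X V" and cc: "chain_cond (\<lambda>U. stable_subgroup M X U \<and> U \<subseteq> V)"
    and Y: "finite Y" "Y \<subseteq> carrier R"
    and gen: "\<And>U. \<lbrakk>stable_subgroup M (X \<union> Y) U; V \<subseteq> U\<rbrakk> \<Longrightarrow> carrier M \<subseteq> U"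
  shows "chain_cond (\<lambda>U. submodule U R M)"
proof -
  have "\<exists>W. V \<subseteq> W \<and> stable_subgroup M (X \<union> Y) W \<and> chain_cond (\<lambda>U. stable_subgroup M (X \<union> Y) U \<and> U \<subseteq> W)"
    using Y
  proof (induction Y)
    case empty
    thus ?case using V cc by auto
  next
    case (insert y Y)
    then obtain W where W: "V \<subseteq> W" "stable_subgroup M (X \<union> Y) W" "chain_cond (\<lambda>U. stable_subgroup M (X \<union> Y) U \<and> U \<subseteq> W)"
      by auto
    have XY: "X \<union> Y \<subseteq> carrier R" and y: "y \<in> carrier R" using X insert.prems by auto
    note h = V_subset[OF XY y W(2)] polys_below_Union[OF XY y W(2)] hilbert_step[OF XY y W(2,3)]
    have e: "insert y (X \<union> Y) = X \<union> insert y Y" by simp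
    show ?case using h W(1) unfolding e by blast
  qed
  then obtain W where W: "V \<subseteq> W" "stable_subgroup M (X \<union> Y) W" "chain_cond (\<lambda>U. stable_subgroup M (X \<union> Y) U \<and> U \<subseteq> W)"
    by blast
  have WM: "carrier M \<subseteq> W" by (rule gen[OF W(2,1)])
  show ?thesis
  proof (rule chain_cond_subset[OF W(3)])
    fix U assume U: "submodule U R M"
    have "stable_subgroup M (X \<union> Y) U" by (rule submodule_imp_stable_subgroup[OF U]) (use X Y in blast)
    thus "stable_subgroup M (X \<union> Y) U \<and> U \<subseteq> W" using WM submoduleE(1)[OF U] by blast
  qed
qed

text \<open>The quotient of the larger span by the smaller one is cyclic and so governed by ideals:
  a chain is stationary once its intersections with the smaller span and its ideals of coefficients
  of \<open>g\<close> are.\<close>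

lemma chain_cond_span_insert:
  assumes noeth: "chain_cond (\<lambda>I. ideal I R)" and S: "S \<subseteq> carrier M" and g: "g \<in> carrier M"
    and cc: "chain_cond (\<lambda>U. submodule U R M \<and> U \<subseteq> module_span R M S)"
  shows "chain_cond (\<lambda>U. submodule U R M \<and> U \<subseteq> module_span R M (insert g S))"
  unfolding chain_cond_def
proof (intro allI impI)
  fix f :: "nat \<Rightarrow> _ set"
  assume f: "\<forall>n. (submodule (f n) R M \<and> f n \<subseteq> module_span R M (insert g S)) \<and> f n \<subseteq> f (Suc n)"
  define V where "V = module_span R M S"
  have V: "submodule V R M" unfolding V_def by (rule module_span_submodule[OF S])
  have V_carrier: "v \<in> carrier M" if "v \<in> V" for v using submodule_carrier[OF V that] .
  have fs: "submodule (f n) R M" for n using f by simp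
  have fS: "f n \<subseteq> f (Suc n)" for n using f by simp
  have fsp: "f n \<subseteq> module_span R M (insert g S)" for n using f by simp
  have fc: "u \<in> carrier M" if "u \<in> f n" for u n using submodule_carrier[OF fs that] .
  have fm: "f i \<subseteq> f j" if "i \<le> j" for i j
    by (rule lift_Suc_mono_le[OF _ that]) (use f in blast)
  have dec: "\<exists>a\<in>carrier R. u \<ominus>\<^bsub>M\<^esub> a \<odot>\<^bsub>M\<^esub> g \<in> V" if u: "u \<in> f n" for u n
  proof -
    let ?N = "{u \<in> carrier M. \<exists>a\<in>carrier R. u \<ominus>\<^bsub>M\<^esub> a \<odot>\<^bsub>M\<^esub> g \<in> V}"
    have "submodule ?N R M"
    proof (rule submoduleI_diff)
      have "\<zero>\<^bsub>M\<^esub> \<ominus>\<^bsub>M\<^esub> \<zero>\<^bsub>R\<^esub> \<odot>\<^bsub>M\<^esub> g \<in> V" using g submodule_zero[OF V] by simp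
      thus "\<zero>\<^bsub>M\<^esub> \<in> ?N" by blast
      fix u v assume "u \<in> ?N" "v \<in> ?N"
      then obtain a b where ab: "a \<in> carrier R" "b \<in> carrier R" "u \<in> carrier M" "v \<in> carrier M"
        "u \<ominus>\<^bsub>M\<^esub> a \<odot>\<^bsub>M\<^esub> g \<in> V" "v \<ominus>\<^bsub>M\<^esub> b \<odot>\<^bsub>M\<^esub> g \<in> V" by blast
      have "(a \<ominus>\<^bsub>R\<^esub> b) \<odot>\<^bsub>M\<^esub> g = a \<odot>\<^bsub>M\<^esub> g \<ominus>\<^bsub>M\<^esub> b \<odot>\<^bsub>M\<^esub> g"
        using ab g by (simp add: R.minus_eq M.minus_eq smult_l_distr smult_l_minus)
      moreover have "(u \<ominus>\<^bsub>M\<^esub> v) \<ominus>\<^bsub>M\<^esub> (a \<odot>\<^bsub>M\<^esub> g \<ominus>\<^bsub>M\<^esub> b \<odot>\<^bsub>M\<^esub> g) = (u \<ominus>\<^bsub>M\<^esub> a \<odot>\<^bsub>M\<^esub> g) \<ominus>\<^bsub>M\<^esub> (v \<ominus>\<^bsub>M\<^esub> b \<odot>\<^bsub>M\<^esub> g)"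
        using ab(1-4) g by algebra
      ultimately have "(u \<ominus>\<^bsub>M\<^esub> v) \<ominus>\<^bsub>M\<^esub> (a \<ominus>\<^bsub>R\<^esub> b) \<odot>\<^bsub>M\<^esub> g \<in> V" using submodule_diff[OF V ab(5,6)] by simp
      thus "u \<ominus>\<^bsub>M\<^esub> v \<in> ?N" using R.minus_closed[OF ab(1,2)] M.minus_closed[OF ab(3,4)] by blast
    next
      fix r u assume r: "r \<in> carrier R" and "u \<in> ?N"
      then obtain a where a: "a \<in> carrier R" "u \<in> carrier M" "u \<ominus>\<^bsub>M\<^esub> a \<odot>\<^bsub>M\<^esub> g \<in> V" by blast
      have "r \<odot>\<^bsub>M\<^esub> u \<ominus>\<^bsub>M\<^esub> (r \<otimes>\<^bsub>R\<^esub> a) \<odot>\<^bsub>M\<^esub> g = r \<odot>\<^bsub>M\<^esub> (u \<ominus>\<^bsub>M\<^esub> a \<odot>\<^bsub>M\<^esub> g)"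
        using r a(1,2) g by (simp add: smult_r_diff smult_assoc1)
      hence "r \<odot>\<^bsub>M\<^esub> u \<ominus>\<^bsub>M\<^esub> (r \<otimes>\<^bsub>R\<^esub> a) \<odot>\<^bsub>M\<^esub> g \<in> V" using submoduleE(4)[OF V r a(3)] by simp
      thus "r \<odot>\<^bsub>M\<^esub> u \<in> ?N" using R.m_closed[OF r a(1)] smult_closed[OF r a(2)] by blast
    qed blast
    moreover have "v \<in> ?N" if "v \<in> insert g S" for v
    proof (cases "v = g")
      case True
      have "g \<ominus>\<^bsub>M\<^esub> \<one>\<^bsub>R\<^esub> \<odot>\<^bsub>M\<^esub> g = \<zero>\<^bsub>M\<^esub>" using g by (simp add: M.minus_eq M.r_neg)
      hence "g \<ominus>\<^bsub>M\<^esub> \<one>\<^bsub>R\<^esub> \<odot>\<^bsub>M\<^esub> g \<in> V" using submodule_zero[OF V] by simp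
      thus ?thesis using True g R.one_closed by blast
    next
      case False
      hence "v \<in> V" using that module_span_superset[of S R M] unfolding V_def by blast
      hence "v \<ominus>\<^bsub>M\<^esub> \<zero>\<^bsub>R\<^esub> \<odot>\<^bsub>M\<^esub> g \<in> V" "v \<in> carrier M" using V_carrier g by auto
      thus ?thesis using R.zero_closed by blast
    qed
    ultimately have "module_span R M (insert g S) \<subseteq> ?N" by (intro module_span_minimal) blast+
    thus ?thesis using u fsp[of n] by blast
  qed
  define Id where "Id n = {a \<in> carrier R. \<exists>u\<in>f n. u \<ominus>\<^bsub>M\<^esub> a \<odot>\<^bsub>M\<^esub> g \<in> V}" for n
  have Id_ideal: "ideal (Id n) R" for n
  proof -
    have diff: "a \<ominus>\<^bsub>R\<^esub> b \<in> Id n" if ab: "a \<in> Id n" "b \<in> Id n" for a b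
    proof -
      obtain u v where uv: "a \<in> carrier R" "b \<in> carrier R" "u \<in> f n" "v \<in> f n"
        "u \<ominus>\<^bsub>M\<^esub> a \<odot>\<^bsub>M\<^esub> g \<in> V" "v \<ominus>\<^bsub>M\<^esub> b \<odot>\<^bsub>M\<^esub> g \<in> V" using ab unfolding Id_def by blast
      note c = fc[OF uv(3)] fc[OF uv(4)]
      have "(a \<ominus>\<^bsub>R\<^esub> b) \<odot>\<^bsub>M\<^esub> g = a \<odot>\<^bsub>M\<^esub> g \<ominus>\<^bsub>M\<^esub> b \<odot>\<^bsub>M\<^esub> g"
        using uv g by (simp add: R.minus_eq M.minus_eq smult_l_distr smult_l_minus)
      moreover have "(u \<ominus>\<^bsub>M\<^esub> v) \<ominus>\<^bsub>M\<^esub> (a \<odot>\<^bsub>M\<^esub> g \<ominus>\<^bsub>M\<^esub> b \<odot>\<^bsub>M\<^esub> g) = (u \<ominus>\<^bsub>M\<^esub> a \<odot>\<^bsub>M\<^esub> g) \<ominus>\<^bsub>M\<^esub> (v \<ominus>\<^bsub>M\<^esub> b \<odot>\<^bsub>M\<^esub> g)"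
        using uv(1,2) c g by algebra
      ultimately have "(u \<ominus>\<^bsub>M\<^esub> v) \<ominus>\<^bsub>M\<^esub> (a \<ominus>\<^bsub>R\<^esub> b) \<odot>\<^bsub>M\<^esub> g \<in> V" using submodule_diff[OF V uv(5,6)] by simp
      thus ?thesis unfolding Id_def using R.minus_closed[OF uv(1,2)] submodule_diff[OF fs uv(3,4)] by blast
    qed
    have zero: "\<zero>\<^bsub>R\<^esub> \<in> Id n"
    proof -
      have "\<zero>\<^bsub>M\<^esub> \<ominus>\<^bsub>M\<^esub> \<zero>\<^bsub>R\<^esub> \<odot>\<^bsub>M\<^esub> g \<in> V" using g submodule_zero[OF V] by simp
      thus ?thesis unfolding Id_def using submodule_zero[OF fs] by blast
    qed
    have mult: "r \<otimes>\<^bsub>R\<^esub> a \<in> Id n" if r: "r \<in> carrier R" and a: "a \<in> Id n" for r a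
    proof -
      obtain u where u: "a \<in> carrier R" "u \<in> f n" "u \<ominus>\<^bsub>M\<^esub> a \<odot>\<^bsub>M\<^esub> g \<in> V" using a unfolding Id_def by blast
      have "r \<odot>\<^bsub>M\<^esub> u \<ominus>\<^bsub>M\<^esub> (r \<otimes>\<^bsub>R\<^esub> a) \<odot>\<^bsub>M\<^esub> g = r \<odot>\<^bsub>M\<^esub> (u \<ominus>\<^bsub>M\<^esub> a \<odot>\<^bsub>M\<^esub> g)"
        using r u(1) fc[OF u(2)] g by (simp add: smult_r_diff smult_assoc1)
      hence "r \<odot>\<^bsub>M\<^esub> u \<ominus>\<^bsub>M\<^esub> (r \<otimes>\<^bsub>R\<^esub> a) \<odot>\<^bsub>M\<^esub> g \<in> V" using submoduleE(4)[OF V r u(3)] by simp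
      thus ?thesis unfolding Id_def using R.m_closed[OF r u(1)] submoduleE(4)[OF fs r u(2)] by blast
    qed
    have Ic: "a \<in> carrier R" if "a \<in> Id n" for a using that unfolding Id_def by blast
    show ?thesis by (rule ideal_diffI[OF Ic zero diff mult])
  qed
  have "\<exists>n. \<forall>m\<ge>n. Id m = Id n"
  proof (rule chain_condD[OF noeth Id_ideal])
    show "Id n \<subseteq> Id (Suc n)" for n using fS[of n] unfolding Id_def by blast
  qed
  then obtain n1 where n1: "\<And>m. m \<ge> n1 \<Longrightarrow> Id m = Id n1" by blast
  have "\<exists>n. \<forall>m\<ge>n. f m \<inter> V = f n \<inter> V"
  proof (rule chain_condD[OF cc])
    show "submodule (f n \<inter> V) R M \<and> f n \<inter> V \<subseteq> module_span R M S" for n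
    proof
      show "submodule (f n \<inter> V) R M"
      proof (rule submoduleI_diff)
        show "f n \<inter> V \<subseteq> carrier M" using V_carrier by blast
        show "\<zero>\<^bsub>M\<^esub> \<in> f n \<inter> V" using submodule_zero V fs by blast
        show "a \<ominus>\<^bsub>M\<^esub> b \<in> f n \<inter> V" if "a \<in> f n \<inter> V" "b \<in> f n \<inter> V" for a b
          using that submodule_diff[OF V] submodule_diff[OF fs[of n]] by blast
        show "a \<odot>\<^bsub>M\<^esub> x \<in> f n \<inter> V" if "a \<in> carrier R" "x \<in> f n \<inter> V" for a x
          using that submoduleE(4)[OF V] submoduleE(4)[OF fs[of n]] by blast
      qed
    qed (auto simp: V_def)
    show "f n \<inter> V \<subseteq> f (Suc n) \<inter> V" for n using fS[of n] by blast
  qed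
  then obtain n2 where n2: "\<And>m. m \<ge> n2 \<Longrightarrow> f m \<inter> V = f n2 \<inter> V" by blast
  define n where "n = max n1 n2"
  have "f m \<subseteq> f n" if m: "m \<ge> n" for m
  proof
    fix u assume u: "u \<in> f m"
    obtain a where a: "a \<in> carrier R" "u \<ominus>\<^bsub>M\<^esub> a \<odot>\<^bsub>M\<^esub> g \<in> V" using dec[OF u] by blast
    have "a \<in> Id m" unfolding Id_def using a u by blast
    hence "a \<in> Id n" using n1[of m] n1[of n] m unfolding n_def by simp
    then obtain u' where u': "u' \<in> f n" "u' \<ominus>\<^bsub>M\<^esub> a \<odot>\<^bsub>M\<^esub> g \<in> V" unfolding Id_def by blast
    note c = fc[OF u] fc[OF u'(1)]
    \<comment> \<open>\<open>u\<close> and \<open>u'\<close> have the same coefficient of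
      \<open>g\<close>, so their difference falls into \<open>V\<close>, where the chain is already
      stationary.\<close>
    have "u \<ominus>\<^bsub>M\<^esub> u' = (u \<ominus>\<^bsub>M\<^esub> a \<odot>\<^bsub>M\<^esub> g) \<ominus>\<^bsub>M\<^esub> (u' \<ominus>\<^bsub>M\<^esub> a \<odot>\<^bsub>M\<^esub> g)" using c a(1) g by algebra
    hence "u \<ominus>\<^bsub>M\<^esub> u' \<in> V" using submodule_diff[OF V a(2) u'(2)] by simp
    moreover have "u \<ominus>\<^bsub>M\<^esub> u' \<in> f m" using submodule_diff[OF fs u] u'(1) fm[OF m] by blast
    ultimately have "u \<ominus>\<^bsub>M\<^esub> u' \<in> f n" using n2[of m] n2[of n] m unfolding n_def by auto
    thus "u \<in> f n" by (rule submodule_mem_of_diff[OF fs c _ u'(1)])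
  qed
  hence "\<forall>m\<ge>n. f m = f n" using fm by blast
  thus "\<exists>n. \<forall>m\<ge>n. f m = f n" by blast
qed

lemma fin_gen_chain_cond:
  assumes noeth: "noetherian_ring R" and fg: "fin_gen_module R M"
  shows "chain_cond (\<lambda>U. submodule U R M)"
proof -
  have id: "chain_cond (\<lambda>I. ideal I R)" by (rule noetherian_ring.chain_cond_ideal[OF noeth])
  obtain S where S: "finite S" "S \<subseteq> carrier M" "module_span R M S = carrier M"
    using fg unfolding fin_gen_module_def by blast
  have "chain_cond (\<lambda>U. submodule U R M \<and> U \<subseteq> module_span R M S)"
    using S(1,2)
  proof (induction S)
    case empty
    have span: "module_span R M {} \<subseteq> {\<zero>\<^bsub>M\<^esub>}"
      by (rule module_span_minimal[OF submodule_singleton_zero]) simp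
    show ?case unfolding chain_cond_def
    proof (intro allI impI)
      fix f :: "nat \<Rightarrow> _ set"
      assume f: "\<forall>n. (submodule (f n) R M \<and> f n \<subseteq> module_span R M {}) \<and> f n \<subseteq> f (Suc n)"
      have "f n = {\<zero>\<^bsub>M\<^esub>}" for n
      proof -
        have "submodule (f n) R M" "f n \<subseteq> module_span R M {}" using f by simp_all
        hence "submodule (f n) R M" "f n \<subseteq> {\<zero>\<^bsub>M\<^esub>}" using span by simp_all
        thus ?thesis using submodule_zero[of "f n"] by blast
      qed
      thus "\<exists>n. \<forall>m\<ge>n. f m = f n" by simp
    qed
  next
    case (insert g S)
    thus ?case by (intro chain_cond_span_insert[OF id]) auto
  qed
  thus ?thesis by (rule chain_cond_subset) (use S submoduleE(1) in auto)
qed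

end

section \<open>The Rees ring and the Rees module\<close>

lemma (in module) finsum_submodule:
  assumes L: "submodule L R M" and "finite A" "\<And>i. i \<in> A \<Longrightarrow> f i \<in> L"
  shows "finsum M f A \<in> L"
  using assms(2,3)
proof (induction A)
  case empty
  thus ?case using submodule_zero[OF L] by simp
next
  case (insert i A)
  have "f i \<in> carrier M" "f \<in> A \<rightarrow> carrier M" using insert.prems submodule_carrier[OF L] by auto
  thus ?case using insert submoduleE(5)[OF L] by simp
qed

lemma (in module) finsum_smult_rdistr:
  assumes "finite A" "f \<in> A \<rightarrow> carrier R" "x \<in> carrier M"
  shows "finsum R f A \<odot>\<^bsub>M\<^esub> x = finsum M (\<lambda>i. f i \<odot>\<^bsub>M\<^esub> x) A"
  using assms(1,2)
proof (induction A)
  case (insert i A)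
  have f: "f i \<in> carrier R" "f \<in> A \<rightarrow> carrier R" using insert.prems by auto
  have g: "f i \<odot>\<^bsub>M\<^esub> x \<in> carrier M" "(\<lambda>i. f i \<odot>\<^bsub>M\<^esub> x) \<in> A \<rightarrow> carrier M" using f assms(3) by auto
  show ?case
    using insert.hyps insert.IH[OF f(2)] f g assms(3) by (simp add: smult_l_distr)
qed (simp add: assms(3))

text \<open>Reindexing of a double sum over a triangle. The total degree \<open>n\<close> is kept
  apart from the bound \<open>k\<close> so that \<open>k\<close> can be the induction variable;
  associativity of the module operation is the case \<open>k = n\<close>.\<close>

lemma (in module) finsum_convolution_assoc:
  fixes k n :: nat
  assumes "\<And>i. a i \<in> carrier R" "\<And>i. b i \<in> carrier R" "\<And>i. c i \<in> carrier M"
  shows "k \<le> n \<Longrightarrow> finsum M (\<lambda>j. finsum R (\<lambda>i. a i \<otimes> b (j - i)) {..j} \<odot>\<^bsub>M\<^esub> c (n - j)) {..k} =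
    finsum M (\<lambda>j. a j \<odot>\<^bsub>M\<^esub> finsum M (\<lambda>i. b i \<odot>\<^bsub>M\<^esub> c (n - j - i)) {..k - j}) {..k}"
proof (induction k)
  case 0
  show ?case using assms by (simp add: Pi_def smult_assoc1)
next
  case (Suc k)
  let ?s = "\<lambda>j m. finsum M (\<lambda>i. b i \<odot>\<^bsub>M\<^esub> c (n - j - i)) {..m}"
  have IH: "finsum M (\<lambda>j. finsum R (\<lambda>i. a i \<otimes> b (j - i)) {..j} \<odot>\<^bsub>M\<^esub> c (n - j)) {..k} =
      finsum M (\<lambda>j. a j \<odot>\<^bsub>M\<^esub> ?s j (k - j)) {..k}" using Suc by simp
  have sc: "?s j m \<in> carrier M" for j m using assms by (intro M.finsum_closed) auto
  have "finsum M (\<lambda>j. finsum R (\<lambda>i. a i \<otimes> b (j - i)) {..j} \<odot>\<^bsub>M\<^esub> c (n - j)) {..Suc k} =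
      finsum R (\<lambda>i. a i \<otimes> b (Suc k - i)) {..Suc k} \<odot>\<^bsub>M\<^esub> c (n - Suc k) \<oplus>\<^bsub>M\<^esub> finsum M (\<lambda>j. a j \<odot>\<^bsub>M\<^esub> ?s j (k - j)) {..k}"
    unfolding IH[symmetric] using assms by (intro M.finsum_Suc) auto
  also have "finsum R (\<lambda>i. a i \<otimes> b (Suc k - i)) {..Suc k} \<odot>\<^bsub>M\<^esub> c (n - Suc k) =
      finsum M (\<lambda>i. a i \<odot>\<^bsub>M\<^esub> (b (Suc k - i) \<odot>\<^bsub>M\<^esub> c (n - Suc k))) {..Suc k}"
  proof -
    have "finsum R (\<lambda>i. a i \<otimes> b (Suc k - i)) {..Suc k} \<odot>\<^bsub>M\<^esub> c (n - Suc k) =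
        finsum M (\<lambda>i. (a i \<otimes> b (Suc k - i)) \<odot>\<^bsub>M\<^esub> c (n - Suc k)) {..Suc k}"
      using assms by (intro finsum_smult_rdistr) auto
    thus ?thesis using assms by (simp only: smult_assoc1)
  qed
  also have "\<dots> = a (Suc k) \<odot>\<^bsub>M\<^esub> (b 0 \<odot>\<^bsub>M\<^esub> c (n - Suc k)) \<oplus>\<^bsub>M\<^esub>
      finsum M (\<lambda>i. a i \<odot>\<^bsub>M\<^esub> (b (Suc k - i) \<odot>\<^bsub>M\<^esub> c (n - Suc k))) {..k}"
    using assms by (subst M.finsum_Suc) auto
  also have "a (Suc k) \<odot>\<^bsub>M\<^esub> (b 0 \<odot>\<^bsub>M\<^esub> c (n - Suc k)) \<oplus>\<^bsub>M\<^esub>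
      finsum M (\<lambda>i. a i \<odot>\<^bsub>M\<^esub> (b (Suc k - i) \<odot>\<^bsub>M\<^esub> c (n - Suc k))) {..k} \<oplus>\<^bsub>M\<^esub> finsum M (\<lambda>j. a j \<odot>\<^bsub>M\<^esub> ?s j (k - j)) {..k}
    = a (Suc k) \<odot>\<^bsub>M\<^esub> (b 0 \<odot>\<^bsub>M\<^esub> c (n - Suc k)) \<oplus>\<^bsub>M\<^esub>
      (finsum M (\<lambda>i. a i \<odot>\<^bsub>M\<^esub> (b (Suc k - i) \<odot>\<^bsub>M\<^esub> c (n - Suc k))) {..k} \<oplus>\<^bsub>M\<^esub> finsum M (\<lambda>j. a j \<odot>\<^bsub>M\<^esub> ?s j (k - j)) {..k})"
    using assms sc by (intro M.a_assoc M.finsum_closed smult_closed) auto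
  also have "finsum M (\<lambda>i. a i \<odot>\<^bsub>M\<^esub> (b (Suc k - i) \<odot>\<^bsub>M\<^esub> c (n - Suc k))) {..k} \<oplus>\<^bsub>M\<^esub> finsum M (\<lambda>j. a j \<odot>\<^bsub>M\<^esub> ?s j (k - j)) {..k}
    = finsum M (\<lambda>i. a i \<odot>\<^bsub>M\<^esub> (b (Suc k - i) \<odot>\<^bsub>M\<^esub> c (n - Suc k)) \<oplus>\<^bsub>M\<^esub> a i \<odot>\<^bsub>M\<^esub> ?s i (k - i)) {..k}"
    using assms sc by (intro M.finsum_addf[symmetric]) auto
  \<comment> \<open>Raising \<open>k\<close> by one adds one summand to each inner sum, so the new
    outer summand is distributed over the inner sums.\<close>
  also have "\<dots> = finsum M (\<lambda>i. a i \<odot>\<^bsub>M\<^esub> ?s i (Suc k - i)) {..k}"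
  proof (rule M.finsum_cong')
    fix i assume i: "i \<in> {..k}"
    have e: "Suc k - i = Suc (k - i)" "n - i - Suc (k - i) = n - Suc k" using i by auto
    have "?s i (Suc (k - i)) = b (Suc (k - i)) \<odot>\<^bsub>M\<^esub> c (n - i - Suc (k - i)) \<oplus>\<^bsub>M\<^esub> ?s i (k - i)"
      using assms by (intro M.finsum_Suc) auto
    thus "a i \<odot>\<^bsub>M\<^esub> (b (Suc k - i) \<odot>\<^bsub>M\<^esub> c (n - Suc k)) \<oplus>\<^bsub>M\<^esub> a i \<odot>\<^bsub>M\<^esub> ?s i (k - i) = a i \<odot>\<^bsub>M\<^esub> ?s i (Suc k - i)"
      unfolding e using assms sc by (simp only: smult_r_distr smult_closed)
  qed (use assms sc in auto)
  also have "a (Suc k) \<odot>\<^bsub>M\<^esub> (b 0 \<odot>\<^bsub>M\<^esub> c (n - Suc k)) = a (Suc k) \<odot>\<^bsub>M\<^esub> ?s (Suc k) (Suc k - Suc k)"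
    using assms by simp
  also have "a (Suc k) \<odot>\<^bsub>M\<^esub> ?s (Suc k) (Suc k - Suc k) \<oplus>\<^bsub>M\<^esub> finsum M (\<lambda>i. a i \<odot>\<^bsub>M\<^esub> ?s i (Suc k - i)) {..k} =
      finsum M (\<lambda>j. a j \<odot>\<^bsub>M\<^esub> ?s j (Suc k - j)) {..Suc k}"
    using assms sc by (intro M.finsum_Suc[symmetric]) auto
  finally show ?case .
qed

section \<open>Powers of the ideal, and the axioms of the Rees ring and module\<close>

locale rees_data = module R M for R (structure) and M (structure) +
  fixes I assumes I: "ideal I R"
begin

abbreviation (input) P :: "nat \<Rightarrow> _ set" where "P n \<equiv> ideal_power R I n"
abbreviation (input) MM :: "nat \<Rightarrow> _ set" where "MM n \<equiv> power_smult R I M n"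
abbreviation (input) "S \<equiv> rees_ring R I"
abbreviation (input) "N \<equiv> rees_module R I M"

lemma P_0: "P 0 = carrier R"
  by (simp add: nat_pow_def ideals_set_def)

lemma P_Suc: "P (Suc n) = ideal_prod R (P n) I"
  by (simp add: nat_pow_def ideals_set_def)

lemma P_ideal: "ideal (P n) R"
  by (induction n) (simp_all only: P_0 P_Suc R.oneideal R.ideal_prod_is_ideal I)

lemma P_carrier: "a \<in> P n \<Longrightarrow> a \<in> carrier R"
  by (rule ideal.Icarr[OF P_ideal])

lemma P_add: "\<lbrakk>a \<in> P n; b \<in> P n\<rbrakk> \<Longrightarrow> a \<oplus> b \<in> P n"
  by (rule additive_subgroup.a_closed[OF ideal.axioms(1)[OF P_ideal]])

lemma P_zero: "\<zero>\<^bsub>R\<^esub> \<in> P n"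
  by (rule additive_subgroup.zero_closed[OF ideal.axioms(1)[OF P_ideal]])

lemma P_minus: "a \<in> P n \<Longrightarrow> \<ominus> a \<in> P n"
  by (rule additive_subgroup.a_inv_closed[OF ideal.axioms(1)[OF P_ideal]])

lemma I_mem_P: "a \<in> I \<Longrightarrow> a \<in> P (Suc 0)"
proof -
  assume a: "a \<in> I"
  have "\<one> \<otimes> a \<in> ideal_prod R (P 0) I" by (rule ideal_prod.prod) (use a P_0 in auto)
  thus ?thesis using ideal.Icarr[OF I a] P_Suc[of 0] by simp
qed

lemma P_mult: "\<lbrakk>a \<in> P i; b \<in> P j\<rbrakk> \<Longrightarrow> a \<otimes> b \<in> P (i + j)"
proof (induction j arbitrary: b)
  case 0
  thus ?case using ideal.I_r_closed[OF P_ideal 0(1)] P_0 by simp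
next
  case (Suc j)
  have "b \<in> ideal_prod R (P j) I" using Suc.prems(2) P_Suc by simp
  thus ?case
  proof (induction b rule: ideal_prod.induct)
    case (prod c d)
    have "(a \<otimes> c) \<otimes> d \<in> ideal_prod R (P (i + j)) I"
      by (rule ideal_prod.prod) (use Suc.IH[OF Suc.prems(1) prod(1)] prod(2) in auto)
    moreover have "(a \<otimes> c) \<otimes> d = a \<otimes> (c \<otimes> d)"
      by (rule R.m_assoc) (use P_carrier[OF Suc.prems(1)] P_carrier[OF prod(1)] ideal.Icarr[OF I prod(2)] in auto)
    ultimately show ?case using P_Suc[of "i + j"] by simp
  next
    case (sum b1 b2)
    have "ideal_prod R (P j) I \<subseteq> carrier R" by (rule R.ideal_prod_in_carrier[OF P_ideal I])
    hence "a \<otimes> (b1 \<oplus> b2) = a \<otimes> b1 \<oplus> a \<otimes> b2"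
      using sum.hyps P_carrier[OF Suc.prems(1)] by (intro R.r_distr) auto
    thus ?case using P_add[OF sum.IH] by simp
  qed
qed

lemma P_Suc_subset: "P (Suc n) \<subseteq> P n"
  using R.ideal_prod_inter[OF P_ideal I] P_Suc by auto

lemma MM_submodule: "submodule (MM n) R M"
  unfolding set_smult_def by (rule module_span_submodule) (use P_carrier in auto)

lemma MM_carrier: "x \<in> MM n \<Longrightarrow> x \<in> carrier M"
  by (rule submodule_carrier[OF MM_submodule])

lemma MM_gen: "\<lbrakk>a \<in> P n; x \<in> carrier M\<rbrakk> \<Longrightarrow> a \<odot>\<^bsub>M\<^esub> x \<in> MM n"
  unfolding set_smult_def by (rule subsetD[OF module_span_superset]) blast

lemma MM_minimal:
  assumes "submodule K R M" "\<And>a x. \<lbrakk>a \<in> P n; x \<in> carrier M\<rbrakk> \<Longrightarrow> a \<odot>\<^bsub>M\<^esub> x \<in> K"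
  shows "MM n \<subseteq> K"
  unfolding set_smult_def by (rule module_span_minimal[OF assms(1)]) (use assms(2) in blast)

lemma MM_0: "MM 0 = carrier M"
proof
  show "carrier M \<subseteq> MM 0"
  proof
    fix x assume x: "x \<in> carrier M"
    have "\<one> \<odot>\<^bsub>M\<^esub> x \<in> MM 0" by (rule MM_gen[OF _ x]) (unfold P_0, rule R.one_closed)
    thus "x \<in> MM 0" using x by simp
  qed
qed (use MM_carrier in blast)

lemma MM_Suc_subset: "MM (Suc n) \<subseteq> MM n"
  by (rule MM_minimal[OF MM_submodule]) (use P_Suc_subset MM_gen in blast)

lemma P_MM:
  assumes a: "a \<in> P i" and x: "x \<in> MM j"
  shows "a \<odot>\<^bsub>M\<^esub> x \<in> MM (i + j)"
proof -
  note ac = P_carrier[OF a]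
  have "submodule {x \<in> carrier M. a \<odot>\<^bsub>M\<^esub> x \<in> MM (i + j)} R M" (is "submodule ?K R M")
  proof (rule submoduleI_diff)
    show "\<zero>\<^bsub>M\<^esub> \<in> ?K" using ac submodule_zero[OF MM_submodule] by simp
    show "u \<ominus>\<^bsub>M\<^esub> v \<in> ?K" if "u \<in> ?K" "v \<in> ?K" for u v
      using that ac submodule_diff[OF MM_submodule] by (simp add: smult_r_diff)
    show "r \<odot>\<^bsub>M\<^esub> u \<in> ?K" if "r \<in> carrier R" "u \<in> ?K" for r u
      using that ac submoduleE(4)[OF MM_submodule] smult_left_comm[of a r u] by simp
  qed blast
  moreover have "b \<odot>\<^bsub>M\<^esub> y \<in> ?K" if "b \<in> P j" "y \<in> carrier M" for b y
    using that ac P_carrier[OF that(1)] MM_gen[OF P_mult[OF a that(1)] that(2)] by (simp add: smult_assoc1)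
  ultimately have "MM j \<subseteq> ?K" by (rule MM_minimal)
  thus ?thesis using x by blast
qed

text \<open>As the power with exponent \<open>Suc n\<close> is the product of the
  \<open>n\<close>-th power with \<open>I\<close>, the submodule \<open>MM (Suc n)\<close> is
  generated by \<open>I\<close> times \<open>MM n\<close>. This is the induction principle for the
  grading.\<close>

lemma MM_Suc_minimal:
  assumes K: "submodule K R M" and g: "\<And>a z. \<lbrakk>a \<in> I; z \<in> MM n\<rbrakk> \<Longrightarrow> a \<odot>\<^bsub>M\<^esub> z \<in> K"
  shows "MM (Suc n) \<subseteq> K"
proof (rule MM_minimal[OF K])
  fix b x assume b: "b \<in> P (Suc n)" and x: "x \<in> carrier M"
  have "b \<in> ideal_prod R (P n) I" using b P_Suc by simp
  thus "b \<odot>\<^bsub>M\<^esub> x \<in> K"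
  proof (induction b rule: ideal_prod.induct)
    case (prod c d)
    have "d \<odot>\<^bsub>M\<^esub> (c \<odot>\<^bsub>M\<^esub> x) \<in> K" by (rule g[OF prod(2) MM_gen[OF prod(1) x]])
    moreover have "(c \<otimes> d) \<odot>\<^bsub>M\<^esub> x = d \<odot>\<^bsub>M\<^esub> (c \<odot>\<^bsub>M\<^esub> x)"
      using x P_carrier[OF prod(1)] ideal.Icarr[OF I prod(2)] by (metis smult_assoc1 R.m_comm)
    ultimately show ?case by simp
  next
    case (sum b1 b2)
    have "ideal_prod R (P n) I \<subseteq> carrier R" by (rule R.ideal_prod_in_carrier[OF P_ideal I])
    hence "(b1 \<oplus> b2) \<odot>\<^bsub>M\<^esub> x = b1 \<odot>\<^bsub>M\<^esub> x \<oplus>\<^bsub>M\<^esub> b2 \<odot>\<^bsub>M\<^esub> x" using sum.hyps x by (intro smult_l_distr) auto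
    thus ?case using submoduleE(5)[OF K sum.IH] by simp
  qed
qed

lemma S_carrier: "f \<in> carrier S \<longleftrightarrow> f \<in> up R \<and> (\<forall>n. f n \<in> P n)"
  unfolding rees_ring_def by simp

lemma S_up: "f \<in> carrier S \<Longrightarrow> f \<in> up R"
  by (simp only: S_carrier)

lemma S_P: "f \<in> carrier S \<Longrightarrow> f n \<in> P n"
  by (simp only: S_carrier)

lemma S_R: "f \<in> carrier S \<Longrightarrow> f n \<in> carrier R"
  by (rule P_carrier[OF S_P])

text \<open>Inherited from the polynomial ring: the condition on the coefficients is multiplicative
  by \<open>P_mult\<close>.\<close>

lemma S_cring: "cring S"
proof -
  interpret U: UP_cring R "UP R" by (simp add: UP_cring.intro R.cring_axioms)
  let ?C = "{f \<in> up R. \<forall>n. f n \<in> P n}"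
  have up: "carrier (UP R) = up R" by (simp add: UP_def)
  have "subring ?C (UP R)"
  proof (rule U.P.subringI)
    show "?C \<subseteq> carrier (UP R)" using up by blast
    have one0: "\<one> \<in> P 0" unfolding P_0 by (rule R.one_closed)
    have one: "(if n = 0 then \<one> else \<zero>\<^bsub>R\<^esub>) \<in> P n" for n
    proof (cases "n = 0")
      case True
      show ?thesis unfolding True if_P[OF refl] by (rule one0)
    next
      case False
      show ?thesis unfolding if_not_P[OF False] by (rule P_zero)
    qed
    have e: "\<one>\<^bsub>UP R\<^esub> = (\<lambda>n. if n = 0 then \<one> else \<zero>\<^bsub>R\<^esub>)" by (simp add: UP_def)
    show "\<one>\<^bsub>UP R\<^esub> \<in> ?C" unfolding e using one R.up_one_closed by blast
  next
    fix h assume h: "h \<in> ?C"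
    have neg: "(\<lambda>i. \<ominus> h i) \<in> ?C" using h R.up_a_inv_closed[of h] P_minus by blast
    have "(\<lambda>i. \<ominus> h i) \<oplus>\<^bsub>UP R\<^esub> h = (\<lambda>i. \<ominus> h i \<oplus> h i)" using neg h by (simp add: UP_def)
    also have "\<dots> = \<zero>\<^bsub>UP R\<^esub>" using mem_upD[of h R] h by (simp add: UP_def R.l_neg)
    finally have "\<ominus>\<^bsub>UP R\<^esub> h = (\<lambda>i. \<ominus> h i)"
      by (rule U.P.minus_equality) (use h neg up in auto)
    thus "\<ominus>\<^bsub>UP R\<^esub> h \<in> ?C" using neg by simp
  next
    fix g h assume g: "g \<in> ?C" and h: "h \<in> ?C"
    have "g \<oplus>\<^bsub>UP R\<^esub> h = (\<lambda>i. g i \<oplus> h i)" using g h by (simp add: UP_def)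
    moreover have "(\<lambda>i. g i \<oplus> h i) \<in> ?C" using g h R.up_add_closed[of g h] P_add by simp
    ultimately show "g \<oplus>\<^bsub>UP R\<^esub> h \<in> ?C" by simp
    have "g \<otimes>\<^bsub>UP R\<^esub> h = (\<lambda>n. \<Oplus>i\<in>{..n}. g i \<otimes> h (n - i))" using g h by (simp add: UP_def)
    moreover have "(\<Oplus>i\<in>{..n}. g i \<otimes> h (n - i)) \<in> P n" for n
    proof -
      have tm: "g i \<otimes> h (n - i) \<in> P n" if "i \<in> {..n}" for i
        using P_mult[of "g i" i "h (n - i)" "n - i"] g h that by simp
      have fin: "finsum R f A \<in> P n" if "finite A" "\<And>i. i \<in> A \<Longrightarrow> f i \<in> P n" for f and A :: "nat set"
        using that
      proof (induction A)
        case (insert i A)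
        have "f i \<in> carrier R" "f \<in> A \<rightarrow> carrier R" using insert.prems P_carrier by auto
        thus ?case using insert P_add by simp
      qed (simp add: P_zero)
      show ?thesis by (rule fin[OF _ tm]) simp_all
    qed
    ultimately show "g \<otimes>\<^bsub>UP R\<^esub> h \<in> ?C" using g h R.up_mult_closed[of g h] by simp
  qed
  hence "subcring ?C (UP R)" by (rule U.P.subcringI')
  hence "cring (UP R\<lparr>carrier := ?C\<rparr>)" using U.P.subcring_iff[of ?C] up by blast
  thus ?thesis unfolding rees_ring_def .
qed

sublocale S: cring S by (rule S_cring)

lemma S_mult: "\<lbrakk>f \<in> carrier S; g \<in> carrier S\<rbrakk> \<Longrightarrow> (f \<otimes>\<^bsub>S\<^esub> g) = (\<lambda>n. \<Oplus>i\<in>{..n}. f i \<otimes> g (n - i))"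
  using S_up[of f] S_up[of g] by (simp add: rees_ring_def UP_def)

lemma S_add: "\<lbrakk>f \<in> carrier S; g \<in> carrier S\<rbrakk> \<Longrightarrow> f \<oplus>\<^bsub>S\<^esub> g = (\<lambda>n. f n \<oplus> g n)"
  using S_up[of f] S_up[of g] by (simp add: rees_ring_def UP_def)

lemma S_zero: "\<zero>\<^bsub>S\<^esub> = (\<lambda>n. \<zero>\<^bsub>R\<^esub>)"
  and S_one: "\<one>\<^bsub>S\<^esub> = (\<lambda>n. if n = 0 then \<one> else \<zero>\<^bsub>R\<^esub>)"
  by (simp_all add: rees_ring_def UP_def)

lemma S_minus: "f \<in> carrier S \<Longrightarrow> \<ominus>\<^bsub>S\<^esub> f = (\<lambda>n. \<ominus> f n)"
proof -
  assume f: "f \<in> carrier S"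
  have neg: "(\<lambda>i. \<ominus> f i) \<in> carrier S"
    unfolding S_carrier using R.up_a_inv_closed[OF S_up[OF f]] P_minus[OF S_P[OF f]] by simp
  have "(\<lambda>i. \<ominus> f i) \<oplus>\<^bsub>S\<^esub> f = \<zero>\<^bsub>S\<^esub>"
    unfolding S_add[OF neg f] S_zero using S_R[OF f] by (simp add: R.l_neg)
  thus ?thesis by (rule S.minus_equality[OF _ f neg])
qed

lemma N_carrier: "f \<in> carrier N \<longleftrightarrow> (\<forall>n. f n \<in> MM n) \<and> finite {n. f n \<noteq> \<zero>\<^bsub>M\<^esub>}"
  unfolding rees_module_def by simp

lemma N_MM: "f \<in> carrier N \<Longrightarrow> f n \<in> MM n"
  by (simp only: N_carrier)

lemma N_fin: "f \<in> carrier N \<Longrightarrow> finite {n. f n \<noteq> \<zero>\<^bsub>M\<^esub>}"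
  by (simp only: N_carrier)

lemma N_M: "f \<in> carrier N \<Longrightarrow> f n \<in> carrier M"
  by (rule MM_carrier[OF N_MM])

lemma N_add: "f \<oplus>\<^bsub>N\<^esub> g = (\<lambda>n. f n \<oplus>\<^bsub>M\<^esub> g n)"
  and N_zero: "\<zero>\<^bsub>N\<^esub> = (\<lambda>n. \<zero>\<^bsub>M\<^esub>)"
  and N_smult: "r \<odot>\<^bsub>N\<^esub> f = (\<lambda>n. finsum M (\<lambda>i. r i \<odot>\<^bsub>M\<^esub> f (n - i)) {..n})"
  by (simp_all add: rees_module_def)

lemma N_bound:
  assumes "f \<in> carrier N"
  obtains d where "\<And>n. n > d \<Longrightarrow> f n = \<zero>\<^bsub>M\<^esub>"
proof -
  have "f n = \<zero>\<^bsub>M\<^esub>" if "n > Max (insert 0 {n. f n \<noteq> \<zero>\<^bsub>M\<^esub>})" for n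
  proof (rule ccontr)
    assume "f n \<noteq> \<zero>\<^bsub>M\<^esub>"
    hence "n \<le> Max (insert 0 {n. f n \<noteq> \<zero>\<^bsub>M\<^esub>})" using N_fin[OF assms] by (intro Max_ge) simp_all
    thus False using that by simp
  qed
  thus ?thesis by (rule that)
qed

lemma N_carrierI:
  assumes "\<And>n. f n \<in> MM n" "\<And>n. n > d \<Longrightarrow> f n = \<zero>\<^bsub>M\<^esub>"
  shows "f \<in> carrier N"
proof -
  have "{n. f n \<noteq> \<zero>\<^bsub>M\<^esub>} \<subseteq> {..d}"
  proof
    fix n assume "n \<in> {n. f n \<noteq> \<zero>\<^bsub>M\<^esub>}"
    thus "n \<in> {..d}" using assms(2)[of n] by (cases "n > d") simp_all
  qed
  hence "finite {n. f n \<noteq> \<zero>\<^bsub>M\<^esub>}" by (rule finite_subset) simp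
  thus ?thesis unfolding N_carrier using assms(1) by simp
qed

lemma S_bound:
  assumes "f \<in> carrier S"
  obtains d where "\<And>n. n > d \<Longrightarrow> f n = \<zero>\<^bsub>R\<^esub>"
proof -
  obtain d where "bound \<zero>\<^bsub>R\<^esub> d f" using R.bound_upD[OF S_up[OF assms]] by blast
  thus ?thesis by (intro that[of d]) (rule bound.bound)
qed

lemma N_closed:
  shows "\<lbrakk>f \<in> carrier N; g \<in> carrier N\<rbrakk> \<Longrightarrow> (\<lambda>n. f n \<oplus>\<^bsub>M\<^esub> g n) \<in> carrier N"
    and "f \<in> carrier N \<Longrightarrow> (\<lambda>n. \<ominus>\<^bsub>M\<^esub> f n) \<in> carrier N"
    and "(\<lambda>n. \<zero>\<^bsub>M\<^esub>) \<in> carrier N"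
    and "\<lbrakk>r \<in> carrier S; f \<in> carrier N\<rbrakk> \<Longrightarrow> (\<lambda>n. finsum M (\<lambda>i. r i \<odot>\<^bsub>M\<^esub> f (n - i)) {..n}) \<in> carrier N"
proof -
  show "(\<lambda>n. \<zero>\<^bsub>M\<^esub>) \<in> carrier N"
    using submodule_zero[OF MM_submodule] by (intro N_carrierI) auto
  assume f: "f \<in> carrier N"
  obtain d where d: "\<And>n. n > d \<Longrightarrow> f n = \<zero>\<^bsub>M\<^esub>" using N_bound[OF f] by blast
  show "(\<lambda>n. \<ominus>\<^bsub>M\<^esub> f n) \<in> carrier N"
    by (rule N_carrierI[where d = d]) (use N_MM[OF f] d submoduleE(3)[OF MM_submodule] in auto)
  show "(\<lambda>n. f n \<oplus>\<^bsub>M\<^esub> g n) \<in> carrier N" if g: "g \<in> carrier N"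
  proof -
    obtain e where e: "\<And>n. n > e \<Longrightarrow> g n = \<zero>\<^bsub>M\<^esub>" using N_bound[OF g] by blast
    show ?thesis
    proof (rule N_carrierI[where d = "max d e"])
      show "f n \<oplus>\<^bsub>M\<^esub> g n \<in> MM n" for n by (rule submoduleE(5)[OF MM_submodule N_MM[OF f] N_MM[OF g]])
      show "f n \<oplus>\<^bsub>M\<^esub> g n = \<zero>\<^bsub>M\<^esub>" if "n > max d e" for n using that d e by simp
    qed
  qed
  show "(\<lambda>n. finsum M (\<lambda>i. r i \<odot>\<^bsub>M\<^esub> f (n - i)) {..n}) \<in> carrier N" if r: "r \<in> carrier S"
  proof -
    obtain e where e: "\<And>n. n > e \<Longrightarrow> r n = \<zero>\<^bsub>R\<^esub>" using S_bound[OF r] by blast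
    show ?thesis
    proof (rule N_carrierI[where d = "d + e"])
      have "r i \<odot>\<^bsub>M\<^esub> f (n - i) \<in> MM n" if "i \<in> {..n}" for i n
        using P_MM[OF S_P[OF r, of i] N_MM[OF f, of "n - i"]] that by simp
      thus "finsum M (\<lambda>i. r i \<odot>\<^bsub>M\<^esub> f (n - i)) {..n} \<in> MM n" for n
        by (intro finsum_submodule[OF MM_submodule]) auto
      have "r i \<odot>\<^bsub>M\<^esub> f (n - i) = \<zero>\<^bsub>M\<^esub>" if "n > d + e" for i n
      proof (cases "i > e")
        case True
        thus ?thesis using e N_M[OF f] by simp
      next
        case False
        hence "n - i > d" using that by simp
        thus ?thesis using d S_R[OF r] by simp
      qed
      thus "finsum M (\<lambda>i. r i \<odot>\<^bsub>M\<^esub> f (n - i)) {..n} = \<zero>\<^bsub>M\<^esub>" if "n > d + e" for n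
        using that by simp
    qed
  qed
qed

lemma N_abelian_group: "abelian_group N"
proof (rule abelian_groupI)
  show "\<zero>\<^bsub>N\<^esub> \<in> carrier N" using N_closed(3) N_zero by simp
  fix f assume f: "f \<in> carrier N"
  show "\<zero>\<^bsub>N\<^esub> \<oplus>\<^bsub>N\<^esub> f = f" unfolding N_add N_zero using N_M[OF f] by simp
  have "(\<lambda>n. \<ominus>\<^bsub>M\<^esub> f n) \<oplus>\<^bsub>N\<^esub> f = \<zero>\<^bsub>N\<^esub>" unfolding N_add N_zero using N_M[OF f] by (simp add: M.l_neg)
  thus "\<exists>g\<in>carrier N. g \<oplus>\<^bsub>N\<^esub> f = \<zero>\<^bsub>N\<^esub>" using N_closed(2)[OF f] by blast
  fix g assume g: "g \<in> carrier N"
  show "f \<oplus>\<^bsub>N\<^esub> g \<in> carrier N" unfolding N_add by (rule N_closed(1)[OF f g])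
  show "f \<oplus>\<^bsub>N\<^esub> g = g \<oplus>\<^bsub>N\<^esub> f" unfolding N_add using N_M[OF f] N_M[OF g] M.a_comm by simp
  fix h assume h: "h \<in> carrier N"
  show "f \<oplus>\<^bsub>N\<^esub> g \<oplus>\<^bsub>N\<^esub> h = f \<oplus>\<^bsub>N\<^esub> (g \<oplus>\<^bsub>N\<^esub> h)"
    unfolding N_add using N_M[OF f] N_M[OF g] N_M[OF h] M.a_assoc by simp
qed

lemma finsum_only:
  fixes k n :: nat
  assumes "x \<in> carrier M" "k \<le> n" "\<And>i. i \<le> n \<Longrightarrow> g i = (if i = k then x else \<zero>\<^bsub>M\<^esub>)"
  shows "finsum M g {..n} = x"
proof -
  have "finsum M g {..n} = finsum M (\<lambda>i. if k = i then x else \<zero>\<^bsub>M\<^esub>) {..n}"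
    by (rule M.finsum_cong') (use assms in auto)
  also have "\<dots> = x" using M.finsum_singleton[of k "{..n}" "\<lambda>_. x"] assms by simp
  finally show ?thesis .
qed

lemma N_module: "module S N"
proof (rule moduleI[OF S_cring N_abelian_group])
  fix r f assume r: "r \<in> carrier S" and f: "f \<in> carrier N"
  note rR = S_R[OF r] and fM = N_M[OF f]
  show "r \<odot>\<^bsub>N\<^esub> f \<in> carrier N" unfolding N_smult by (rule N_closed(4)[OF r f])
  fix t assume t: "t \<in> carrier S"
  note tR = S_R[OF t]
  show "(r \<oplus>\<^bsub>S\<^esub> t) \<odot>\<^bsub>N\<^esub> f = (r \<odot>\<^bsub>N\<^esub> f) \<oplus>\<^bsub>N\<^esub> (t \<odot>\<^bsub>N\<^esub> f)"
    unfolding N_smult N_add S_add[OF r t]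
  proof
    fix n
    have "finsum M (\<lambda>i. (r i \<oplus> t i) \<odot>\<^bsub>M\<^esub> f (n - i)) {..n} = finsum M (\<lambda>i. r i \<odot>\<^bsub>M\<^esub> f (n - i) \<oplus>\<^bsub>M\<^esub> t i \<odot>\<^bsub>M\<^esub> f (n - i)) {..n}"
      by (rule M.finsum_cong') (use rR tR fM smult_l_distr in auto)
    also have "\<dots> = finsum M (\<lambda>i. r i \<odot>\<^bsub>M\<^esub> f (n - i)) {..n} \<oplus>\<^bsub>M\<^esub> finsum M (\<lambda>i. t i \<odot>\<^bsub>M\<^esub> f (n - i)) {..n}"
      by (rule M.finsum_addf) (use rR tR fM in auto)
    finally show "finsum M (\<lambda>i. (r i \<oplus> t i) \<odot>\<^bsub>M\<^esub> f (n - i)) {..n} =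
      finsum M (\<lambda>i. r i \<odot>\<^bsub>M\<^esub> f (n - i)) {..n} \<oplus>\<^bsub>M\<^esub> finsum M (\<lambda>i. t i \<odot>\<^bsub>M\<^esub> f (n - i)) {..n}" .
  qed
  show "(r \<otimes>\<^bsub>S\<^esub> t) \<odot>\<^bsub>N\<^esub> f = r \<odot>\<^bsub>N\<^esub> (t \<odot>\<^bsub>N\<^esub> f)"
    unfolding N_smult S_mult[OF r t]
    by (rule ext) (rule finsum_convolution_assoc[OF rR tR fM order_refl])
next
  fix r f g assume r: "r \<in> carrier S" and f: "f \<in> carrier N" and g: "g \<in> carrier N"
  note rR = S_R[OF r] and fM = N_M[OF f] and gM = N_M[OF g]
  show "r \<odot>\<^bsub>N\<^esub> (f \<oplus>\<^bsub>N\<^esub> g) = (r \<odot>\<^bsub>N\<^esub> f) \<oplus>\<^bsub>N\<^esub> (r \<odot>\<^bsub>N\<^esub> g)"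
    unfolding N_smult N_add
  proof
    fix n
    have "finsum M (\<lambda>i. r i \<odot>\<^bsub>M\<^esub> (f (n - i) \<oplus>\<^bsub>M\<^esub> g (n - i))) {..n} = finsum M (\<lambda>i. r i \<odot>\<^bsub>M\<^esub> f (n - i) \<oplus>\<^bsub>M\<^esub> r i \<odot>\<^bsub>M\<^esub> g (n - i)) {..n}"
      by (rule M.finsum_cong') (use rR gM fM smult_r_distr in auto)
    also have "\<dots> = finsum M (\<lambda>i. r i \<odot>\<^bsub>M\<^esub> f (n - i)) {..n} \<oplus>\<^bsub>M\<^esub> finsum M (\<lambda>i. r i \<odot>\<^bsub>M\<^esub> g (n - i)) {..n}"
      by (rule M.finsum_addf) (use rR gM fM in auto)
    finally show "finsum M (\<lambda>i. r i \<odot>\<^bsub>M\<^esub> (f (n - i) \<oplus>\<^bsub>M\<^esub> g (n - i))) {..n} =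
      finsum M (\<lambda>i. r i \<odot>\<^bsub>M\<^esub> f (n - i)) {..n} \<oplus>\<^bsub>M\<^esub> finsum M (\<lambda>i. r i \<odot>\<^bsub>M\<^esub> g (n - i)) {..n}" .
  qed
next
  fix f assume f: "f \<in> carrier N"
  show "\<one>\<^bsub>S\<^esub> \<odot>\<^bsub>N\<^esub> f = f"
    unfolding N_smult S_one
    by (rule ext, rule finsum_only[where k = 0]) (use N_M[OF f] in auto)
qed

sublocale N: module S N by (rule N_module)

lemma N_minus: "f \<in> carrier N \<Longrightarrow> \<ominus>\<^bsub>N\<^esub> f = (\<lambda>n. \<ominus>\<^bsub>M\<^esub> f n)"
proof -
  assume f: "f \<in> carrier N"
  have "(\<lambda>i. \<ominus>\<^bsub>M\<^esub> f i) \<oplus>\<^bsub>N\<^esub> f = \<zero>\<^bsub>N\<^esub>"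
    unfolding N_add N_zero using N_M[OF f] by (simp add: M.l_neg)
  thus ?thesis by (rule N.M.minus_equality[OF _ f N_closed(2)[OF f]])
qed

lemma N_diff: "g \<in> carrier N \<Longrightarrow> f \<ominus>\<^bsub>N\<^esub> g = (\<lambda>n. f n \<ominus>\<^bsub>M\<^esub> g n)"
  unfolding N.M.minus_eq N_minus N_add M.minus_eq by simp

text \<open>The homogeneous element \<open>a t^k\<close> of the Rees ring.\<close>

definition rmono :: "_ \<Rightarrow> nat \<Rightarrow> nat \<Rightarrow> _" where "rmono a k = (\<lambda>n. if n = k then a else \<zero>\<^bsub>R\<^esub>)"

definition nmono :: "_ \<Rightarrow> nat \<Rightarrow> nat \<Rightarrow> _" where "nmono x k = (\<lambda>n. if n = k then x else \<zero>\<^bsub>M\<^esub>)"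

lemma rmono_closed: "a \<in> P k \<Longrightarrow> rmono a k \<in> carrier S"
proof -
  assume a: "a \<in> P k"
  have "bound \<zero>\<^bsub>R\<^esub> k (rmono a k)" unfolding rmono_def by auto
  hence "rmono a k \<in> up R" using P_carrier[OF a] by (intro mem_upI) (auto simp: rmono_def)
  thus ?thesis unfolding S_carrier using a P_zero by (simp add: rmono_def)
qed

lemma nmono_closed: "x \<in> MM k \<Longrightarrow> nmono x k \<in> carrier N"
  by (rule N_carrierI[where d = k]) (auto simp: nmono_def submodule_zero[OF MM_submodule])

lemma rmono_smult:
  assumes a: "a \<in> P k" and f: "f \<in> carrier N"
  shows "rmono a k \<odot>\<^bsub>N\<^esub> f = (\<lambda>n. if k \<le> n then a \<odot>\<^bsub>M\<^esub> f (n - k) else \<zero>\<^bsub>M\<^esub>)"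
proof
  fix n
  have tm: "rmono a k i \<odot>\<^bsub>M\<^esub> f (n - i) = (if i = k then a \<odot>\<^bsub>M\<^esub> f (n - k) else \<zero>\<^bsub>M\<^esub>)" for i
    using N_M[OF f] by (simp add: rmono_def)
  show "(rmono a k \<odot>\<^bsub>N\<^esub> f) n = (if k \<le> n then a \<odot>\<^bsub>M\<^esub> f (n - k) else \<zero>\<^bsub>M\<^esub>)"
  proof (cases "k \<le> n")
    case True
    have "finsum M (\<lambda>i. rmono a k i \<odot>\<^bsub>M\<^esub> f (n - i)) {..n} = a \<odot>\<^bsub>M\<^esub> f (n - k)"
      by (rule finsum_only[where k = k]) (use True tm P_carrier[OF a] N_M[OF f] in auto)
    thus ?thesis unfolding N_smult using True by simp
  next
    case False
    have "finsum M (\<lambda>i. rmono a k i \<odot>\<^bsub>M\<^esub> f (n - i)) {..n} = finsum M (\<lambda>i. \<zero>\<^bsub>M\<^esub>) {..n}"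
      by (rule M.finsum_cong') (use False tm in auto)
    thus ?thesis unfolding N_smult using False by simp
  qed
qed

lemma rmono_nmono:
  assumes a: "a \<in> P i" and x: "x \<in> MM j"
  shows "rmono a i \<odot>\<^bsub>N\<^esub> nmono x j = nmono (a \<odot>\<^bsub>M\<^esub> x) (i + j)"
  unfolding rmono_smult[OF a nmono_closed[OF x]]
proof
  fix n
  have "n - i = j \<longleftrightarrow> n = i + j" if "i \<le> n" using that by auto
  thus "(if i \<le> n then a \<odot>\<^bsub>M\<^esub> nmono x j (n - i) else \<zero>\<^bsub>M\<^esub>) = nmono (a \<odot>\<^bsub>M\<^esub> x) (i + j) n"
    using P_carrier[OF a] by (simp add: nmono_def)
qed

end

section \<open>Generators and the chain condition for the Rees module\<close>

context rees_data
begin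

text \<open>Truncations of \<open>f\<close> are built up one homogeneous component at a time, and
  finite support makes \<open>f\<close> itself a truncation.\<close>

lemma N_graded_induct:
  assumes f: "f \<in> carrier N" and zero: "\<zero>\<^bsub>N\<^esub> \<in> U"
    and add: "\<And>u v. \<lbrakk>u \<in> U; v \<in> U\<rbrakk> \<Longrightarrow> u \<oplus>\<^bsub>N\<^esub> v \<in> U" and mono: "\<And>n. nmono (f n) n \<in> U"
  shows "f \<in> U"
proof -
  have "(\<lambda>n. if n < k then f n else \<zero>\<^bsub>M\<^esub>) \<in> U" for k
  proof (induction k)
    case 0
    thus ?case using zero N_zero by simp
  next
    case (Suc k)
    have "(\<lambda>n. if n < Suc k then f n else \<zero>\<^bsub>M\<^esub>) = (\<lambda>n. if n < k then f n else \<zero>\<^bsub>M\<^esub>) \<oplus>\<^bsub>N\<^esub> nmono (f k) k"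
      unfolding N_add
    proof
      fix n
      show "(if n < Suc k then f n else \<zero>\<^bsub>M\<^esub>) = (if n < k then f n else \<zero>\<^bsub>M\<^esub>) \<oplus>\<^bsub>M\<^esub> nmono (f k) k n"
        using N_M[OF f, of n] by (cases "n < k"; cases "n = k") (simp_all add: nmono_def)
    qed
    thus ?case using add[OF Suc mono] by simp
  qed
  moreover obtain d where d: "\<And>n. n > d \<Longrightarrow> f n = \<zero>\<^bsub>M\<^esub>" using N_bound[OF f] by blast
  have "(\<lambda>n. if n < Suc d then f n else \<zero>\<^bsub>M\<^esub>) = f"
  proof
    show "(if n < Suc d then f n else \<zero>\<^bsub>M\<^esub>) = f n" for n using d[of n] by simp
  qed
  ultimately show ?thesis by metis
qed

text \<open>\<open>U\<close> is kept inside the carrier because the componentwise formula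
  \<open>S_add\<close> is available there.\<close>

lemma S_graded_induct:
  assumes f: "f \<in> carrier S" and zero: "\<zero>\<^bsub>S\<^esub> \<in> U"
    and add: "\<And>u v. \<lbrakk>u \<in> U; v \<in> U\<rbrakk> \<Longrightarrow> u \<oplus>\<^bsub>S\<^esub> v \<in> U" and Uc: "U \<subseteq> carrier S"
    and mono: "\<And>n. rmono (f n) n \<in> U"
  shows "f \<in> U"
proof -
  have "(\<lambda>n. if n < k then f n else \<zero>\<^bsub>R\<^esub>) \<in> U" for k
  proof (induction k)
    case 0
    thus ?case using zero S_zero by simp
  next
    case (Suc k)
    have c: "(\<lambda>n. if n < k then f n else \<zero>\<^bsub>R\<^esub>) \<in> carrier S" "rmono (f k) k \<in> carrier S"
      using Suc mono[of k] Uc by blast+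
    have "(\<lambda>n. if n < Suc k then f n else \<zero>\<^bsub>R\<^esub>) = (\<lambda>n. if n < k then f n else \<zero>\<^bsub>R\<^esub>) \<oplus>\<^bsub>S\<^esub> rmono (f k) k"
      unfolding S_add[OF c]
    proof
      fix n
      show "(if n < Suc k then f n else \<zero>\<^bsub>R\<^esub>) = (if n < k then f n else \<zero>\<^bsub>R\<^esub>) \<oplus> rmono (f k) k n"
        using S_R[OF f, of n] by (cases "n < k"; cases "n = k") (simp_all add: rmono_def)
    qed
    thus ?case using add[OF Suc mono] by simp
  qed
  moreover obtain d where d: "\<And>n. n > d \<Longrightarrow> f n = \<zero>\<^bsub>R\<^esub>" using S_bound[OF f] by blast
  have "(\<lambda>n. if n < Suc d then f n else \<zero>\<^bsub>R\<^esub>) = f"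
  proof
    show "(if n < Suc d then f n else \<zero>\<^bsub>R\<^esub>) = f n" for n using d[of n] by simp
  qed
  ultimately show ?thesis by metis
qed

lemma rmono_mult:
  assumes a: "a \<in> P i" and b: "b \<in> P j"
  shows "rmono a i \<otimes>\<^bsub>S\<^esub> rmono b j = rmono (a \<otimes> b) (i + j)"
  unfolding S_mult[OF rmono_closed[OF a] rmono_closed[OF b]]
proof
  fix n
  note ab = P_carrier[OF a] P_carrier[OF b]
  have tm: "rmono a i k \<otimes> rmono b j (n - k) = (if i = k then a \<otimes> rmono b j (n - i) else \<zero>\<^bsub>R\<^esub>)" for k
    using ab by (auto simp: rmono_def)
  have bc: "rmono b j m \<in> carrier R" for m using ab by (simp add: rmono_def)
  have "(\<Oplus>k\<in>{..n}. rmono a i k \<otimes> rmono b j (n - k)) =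
      (\<Oplus>k\<in>{..n}. if i = k then a \<otimes> rmono b j (n - i) else \<zero>\<^bsub>R\<^esub>)"
    by (rule R.finsum_cong') (use tm ab bc in auto)
  also have "\<dots> = (if i \<le> n then a \<otimes> rmono b j (n - i) else \<zero>\<^bsub>R\<^esub>)"
  proof (cases "i \<le> n")
    case True
    thus ?thesis using R.finsum_singleton[of i "{..n}" "\<lambda>_. a \<otimes> rmono b j (n - i)"] ab bc by simp
  next
    case False
    have "(\<Oplus>k\<in>{..n}. if i = k then a \<otimes> rmono b j (n - i) else \<zero>\<^bsub>R\<^esub>) = (\<Oplus>k\<in>{..n}. \<zero>\<^bsub>R\<^esub>)"
      by (rule R.finsum_cong') (use False in auto)
    thus ?thesis using False by simp
  qed
  also have "\<dots> = rmono (a \<otimes> b) (i + j) n"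
  proof -
    have "n - i = j \<longleftrightarrow> n = i + j" if "i \<le> n" using that by auto
    thus ?thesis using ab by (simp add: rmono_def)
  qed
  finally show "(\<Oplus>k\<in>{..n}. rmono a i k \<otimes> rmono b j (n - k)) = rmono (a \<otimes> b) (i + j) n" .
qed

lemma rmono_add:
  assumes a: "a \<in> P i" and b: "b \<in> P i"
  shows "rmono a i \<oplus>\<^bsub>S\<^esub> rmono b i = rmono (a \<oplus> b) i"
  unfolding S_add[OF rmono_closed[OF a] rmono_closed[OF b]] by (auto simp: rmono_def)

lemma rmono_diff:
  assumes a: "a \<in> P i" and b: "b \<in> P i"
  shows "rmono a i \<ominus>\<^bsub>S\<^esub> rmono b i = rmono (a \<ominus> b) i"
proof -
  have "\<ominus>\<^bsub>S\<^esub> rmono b i = rmono (\<ominus> b) i"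
    unfolding S_minus[OF rmono_closed[OF b]] by (auto simp: rmono_def)
  thus ?thesis unfolding S.minus_eq R.minus_eq using rmono_add[OF a P_minus[OF b]] by simp
qed

lemma rmono_zero: "rmono \<zero>\<^bsub>R\<^esub> i = \<zero>\<^bsub>S\<^esub>"
  unfolding S_zero rmono_def by simp

lemma nmono_zero: "nmono \<zero>\<^bsub>M\<^esub> i = \<zero>\<^bsub>N\<^esub>"
  unfolding N_zero nmono_def by simp

lemma nmono_diff: "y \<in> MM i \<Longrightarrow> nmono x i \<ominus>\<^bsub>N\<^esub> nmono y i = nmono (x \<ominus>\<^bsub>M\<^esub> y) i"
  unfolding N_diff[OF nmono_closed] by (auto simp: nmono_def)

lemma R_P0: "a \<in> carrier R \<Longrightarrow> a \<in> P 0"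
  by (simp only: P_0)

lemma M_MM0: "x \<in> carrier M \<Longrightarrow> x \<in> MM 0"
  by (simp only: MM_0)

end

locale rees_gens = rees_data R M I for R (structure) and M (structure) and I +
  fixes \<mm> ms as
  assumes ms: "set ms \<subseteq> carrier R" "\<mm> = Idl (set ms)"
    and as: "set as \<subseteq> carrier R" "I = Idl (set as)"
    and noeth: "noetherian_ring R" and fg: "fin_gen_module R M"
begin

definition s :: nat where "s = length ms + length as"

text \<open>Homogeneous generators of the graded maximal ideal; the index \<open>length ms\<close>
  separates those of degree zero from those of degree one.\<close>

definition y where
  "y j = (if j < length ms then rmono (ms ! j) 0 else rmono (as ! (j - length ms)) (Suc 0))"

lemma m_ideal: "ideal \<mm> R"
  unfolding ms(2) by (rule R.genideal_ideal[OF ms(1)])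

lemma ms_in: "set ms \<subseteq> \<mm>"
  unfolding ms(2) by (rule R.genideal_self[OF ms(1)])

lemma as_in: "set as \<subseteq> I"
  unfolding as(2) by (rule R.genideal_self[OF as(1)])

lemma y_image: "y ` {..<s} = (\<lambda>a. rmono a 0) ` set ms \<union> (\<lambda>a. rmono a (Suc 0)) ` set as"
proof (intro equalityI subsetI)
  fix z assume "z \<in> y ` {..<s}"
  then obtain j where j: "j < s" "z = y j" by blast
  show "z \<in> (\<lambda>a. rmono a 0) ` set ms \<union> (\<lambda>a. rmono a (Suc 0)) ` set as"
  proof (cases "j < length ms")
    case True
    thus ?thesis using j by (simp add: y_def)
  next
    case False
    hence "j - length ms < length as" using j by (simp add: s_def)
    thus ?thesis using j False by (simp add: y_def)
  qed
next
  fix z assume "z \<in> (\<lambda>a. rmono a 0) ` set ms \<union> (\<lambda>a. rmono a (Suc 0)) ` set as"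
  then consider j where "j < length ms" "z = rmono (ms ! j) 0"
    | j where "j < length as" "z = rmono (as ! j) (Suc 0)"
    by (auto simp: in_set_conv_nth)
  thus "z \<in> y ` {..<s}"
  proof cases
    case 1
    hence "z = y j" "j < s" by (simp_all add: y_def s_def)
    thus ?thesis by blast
  next
    case (2 j)
    hence "z = y (length ms + j)" "length ms + j < s" by (simp_all add: y_def s_def)
    thus ?thesis by blast
  qed
qed

lemma y_closed: "j < s \<Longrightarrow> y j \<in> carrier S"
proof -
  assume "j < s"
  hence "y j \<in> (\<lambda>a. rmono a 0) ` set ms \<union> (\<lambda>a. rmono a (Suc 0)) ` set as"
    using y_image by blast
  thus ?thesis
  proof (elim UnE imageE)
    show "y j \<in> carrier S" if "y j = rmono a 0" "a \<in> set ms" for a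
      unfolding that(1) by (rule rmono_closed[OF R_P0]) (use that(2) ms(1) in blast)
    show "y j \<in> carrier S" if "y j = rmono a (Suc 0)" "a \<in> set as" for a
      unfolding that(1) by (rule rmono_closed[OF I_mem_P]) (use that(2) as_in in blast)
  qed
qed

abbreviation (input) "J \<equiv> rees_max_ideal R \<mm> I"

lemma J_mem: "f \<in> J \<longleftrightarrow> f \<in> carrier S \<and> f 0 \<in> \<mm>"
  unfolding rees_max_ideal_def by simp

lemma J_ideal: "ideal J S"
proof (rule S.ideal_diffI)
  show "a \<in> carrier S" if "a \<in> J" for a using that J_mem by simp
  show "\<zero>\<^bsub>S\<^esub> \<in> J" unfolding J_mem S_zero[symmetric]
    using S.zero_closed additive_subgroup.zero_closed[OF ideal.axioms(1)[OF m_ideal]] by (simp add: S_zero)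
  fix a b assume a: "a \<in> J" and b: "b \<in> J"
  have c: "a \<in> carrier S" "b \<in> carrier S" "\<ominus>\<^bsub>S\<^esub> b \<in> carrier S" using a b J_mem by simp_all
  have "(a \<ominus>\<^bsub>S\<^esub> b) 0 = a 0 \<oplus> \<ominus> b 0"
    using S_add[OF c(1,3)] S_minus[OF c(2)] by (simp add: S.minus_eq)
  moreover have "a 0 \<oplus> \<ominus> b 0 \<in> \<mm>"
    using a b J_mem additive_subgroup.a_closed[OF ideal.axioms(1)[OF m_ideal]]
      additive_subgroup.a_inv_closed[OF ideal.axioms(1)[OF m_ideal]] by simp
  ultimately show "a \<ominus>\<^bsub>S\<^esub> b \<in> J" unfolding J_mem using S.minus_closed[OF c(1,2)] by simp
next
  fix r a assume r: "r \<in> carrier S" and a: "a \<in> J"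
  have ac: "a \<in> carrier S" "a 0 \<in> \<mm>" using a J_mem by simp_all
  have "(r \<otimes>\<^bsub>S\<^esub> a) 0 = r 0 \<otimes> a 0" unfolding S_mult[OF r ac(1)] using S_R[OF r] S_R[OF ac(1)] by simp
  moreover have "r 0 \<otimes> a 0 \<in> \<mm>" by (rule ideal.I_l_closed[OF m_ideal ac(2) S_R[OF r]])
  ultimately show "r \<otimes>\<^bsub>S\<^esub> a \<in> J" unfolding J_mem using S.m_closed[OF r ac(1)] by simp
qed

text \<open>In degree zero \<open>J\<close> is the ideal \<open>\<mm>\<close>, and its part of
  degree \<open>n + 1\<close> is generated by products of degree \<open>n\<close> with degree one.
  So generators of \<open>\<mm>\<close> in degree zero and of \<open>I\<close> in degree one
  suffice.\<close>

lemma J_gen: "J = genideal S (y ` {..<s})"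
proof
  let ?K = "genideal S (y ` {..<s})"
  have yc: "y ` {..<s} \<subseteq> carrier S" using y_closed by blast
  have K: "ideal ?K S" by (rule S.genideal_ideal[OF yc])
  note yK = S.genideal_self[OF yc]
  have Ksub: "additive_subgroup ?K S" by (rule ideal.axioms(1)[OF K])
  have Kdiff: "a \<ominus>\<^bsub>S\<^esub> b \<in> ?K" if "a \<in> ?K" "b \<in> ?K" for a b
    unfolding S.minus_eq
    using that additive_subgroup.a_closed[OF Ksub] additive_subgroup.a_inv_closed[OF Ksub] by blast
  have "y ` {..<s} \<subseteq> J"
  proof
    fix z assume z: "z \<in> y ` {..<s}"
    hence "z 0 \<in> \<mm>" using ms_in additive_subgroup.zero_closed[OF ideal.axioms(1)[OF m_ideal]]
      unfolding y_image by (auto simp: rmono_def)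
    thus "z \<in> J" using z yc unfolding J_mem by blast
  qed
  thus "?K \<subseteq> J" by (rule S.genideal_minimal[OF J_ideal])
  have deg0: "rmono b 0 \<in> ?K" if b: "b \<in> \<mm>" for b
  proof -
    \<comment> \<open>The coefficients whose monomial lies in \<open>?K\<close> form an ideal, so it
      is enough to know the generators.\<close>
    let ?B = "{b \<in> carrier R. rmono b 0 \<in> ?K}"
    have "ideal ?B R"
    proof (rule R.ideal_diffI)
      show "\<zero>\<^bsub>R\<^esub> \<in> ?B" using additive_subgroup.zero_closed[OF Ksub] by (simp add: rmono_zero)
      show "a \<ominus> b \<in> ?B" if "a \<in> ?B" "b \<in> ?B" for a b
        using that Kdiff[of "rmono a 0" "rmono b 0"] rmono_diff[OF R_P0 R_P0, of a b] by simp
      show "r \<otimes> a \<in> ?B" if "r \<in> carrier R" "a \<in> ?B" for r a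
        using that ideal.I_l_closed[OF K, of "rmono a 0" "rmono r 0"] rmono_mult[OF R_P0 R_P0, of r a]
          rmono_closed[OF R_P0, of r] by simp
    qed blast
    moreover have "set ms \<subseteq> ?B" using ms(1) yK unfolding y_image by blast
    ultimately have "\<mm> \<subseteq> ?B" unfolding ms(2) by (rule R.genideal_minimal)
    thus ?thesis using b by blast
  qed
  have deg1: "rmono a (Suc 0) \<in> ?K" if a: "a \<in> I" for a
  proof -
    let ?B = "{a \<in> I. rmono a (Suc 0) \<in> ?K}"
    have Isub: "additive_subgroup I R" by (rule ideal.axioms(1)[OF I])
    have "ideal ?B R"
    proof (rule R.ideal_diffI)
      show "a \<in> carrier R" if "a \<in> ?B" for a using that ideal.Icarr[OF I] by blast
      show "\<zero>\<^bsub>R\<^esub> \<in> ?B" using additive_subgroup.zero_closed[OF Ksub] additive_subgroup.zero_closed[OF Isub]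
        by (simp add: rmono_zero)
      show "a \<ominus> b \<in> ?B" if "a \<in> ?B" "b \<in> ?B" for a b
      proof -
        have "a \<ominus> b \<in> I" unfolding R.minus_eq
          using that additive_subgroup.a_closed[OF Isub] additive_subgroup.a_inv_closed[OF Isub] by blast
        thus ?thesis
          using that Kdiff[of "rmono a (Suc 0)" "rmono b (Suc 0)"] rmono_diff[OF I_mem_P I_mem_P, of a b] by simp
      qed
      show "r \<otimes> a \<in> ?B" if "r \<in> carrier R" "a \<in> ?B" for r a
        using that ideal.I_l_closed[OF K, of "rmono a (Suc 0)" "rmono r 0"]
          rmono_mult[OF R_P0 I_mem_P, of r a] rmono_closed[OF R_P0, of r]
          ideal.I_l_closed[OF I, of a r] by simp
    qed
    moreover have "set as \<subseteq> ?B" using as_in yK unfolding y_image by blast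
    ultimately have "Idl (set as) \<subseteq> ?B" by (rule R.genideal_minimal)
    thus ?thesis using a as(2) by blast
  qed
  have degSuc: "rmono b (Suc n) \<in> ?K" if b: "b \<in> P (Suc n)" for b n
  proof -
    have "b \<in> ideal_prod R (P n) I" using b P_Suc by simp
    thus ?thesis
    proof (induction b rule: ideal_prod.induct)
      case (prod c a)
      have "rmono c n \<otimes>\<^bsub>S\<^esub> rmono a (Suc 0) \<in> ?K"
        by (rule ideal.I_l_closed[OF K deg1[OF prod(2)] rmono_closed[OF prod(1)]])
      thus ?case using rmono_mult[OF prod(1) I_mem_P[OF prod(2)]] by simp
    next
      case (sum b1 b2)
      have "b1 \<in> P (Suc n)" "b2 \<in> P (Suc n)" using sum.hyps P_Suc by simp_all
      hence "rmono b1 (Suc n) \<oplus>\<^bsub>S\<^esub> rmono b2 (Suc n) = rmono (b1 \<oplus> b2) (Suc n)" by (rule rmono_add)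
      thus ?case using additive_subgroup.a_closed[OF Ksub sum.IH] by simp
    qed
  qed
  show "J \<subseteq> ?K"
  proof
    fix f assume "f \<in> J"
    hence f: "f \<in> carrier S" "f 0 \<in> \<mm>" using J_mem by simp_all
    show "f \<in> ?K"
    proof (rule S_graded_induct[OF f(1)])
      show "\<zero>\<^bsub>S\<^esub> \<in> ?K" by (rule additive_subgroup.zero_closed[OF Ksub])
      show "u \<oplus>\<^bsub>S\<^esub> v \<in> ?K" if "u \<in> ?K" "v \<in> ?K" for u v
        by (rule additive_subgroup.a_closed[OF Ksub that])
      show "?K \<subseteq> carrier S" by (rule additive_subgroup.a_subset[OF Ksub])
      show "rmono (f n) n \<in> ?K" for n
        using deg0[OF f(2)] degSuc[OF S_P[OF f(1)]] by (cases n) auto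
    qed
  qed
qed

text \<open>Hilbert's basis theorem starting from the part of degree zero, a copy of
  \<open>M\<close> with scalars from \<open>R\<close> in degree zero. The operators to be adjoined
  are the finitely many \<open>a t\<close> with \<open>a\<close> a chosen generator of
  \<open>I\<close>.\<close>

lemma N_chain_cond: "chain_cond (\<lambda>U. submodule U S N)"
proof (rule N.hilbert_basis)
  let ?X = "{rmono r 0 | r. r \<in> carrier R}"
  let ?V = "{nmono x 0 | x. x \<in> carrier M}"
  let ?Y = "(\<lambda>a. rmono a (Suc 0)) ` set as"
  show X: "?X \<subseteq> carrier S" using rmono_closed[OF R_P0] by blast
  show "finite ?Y" by simp
  show Y: "?Y \<subseteq> carrier S" using rmono_closed[OF I_mem_P] as_in by blast
  show V: "stable_subgroup N ?X ?V"
    unfolding stable_subgroup_def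
  proof (intro conjI ballI)
    show "?V \<subseteq> carrier N" using nmono_closed[OF M_MM0] by blast
    show "\<zero>\<^bsub>N\<^esub> \<in> ?V" unfolding nmono_zero[of 0, symmetric] by blast
  next
    fix u v assume "u \<in> ?V" "v \<in> ?V"
    then obtain x z where x: "u = nmono x 0" "x \<in> carrier M" "v = nmono z 0" "z \<in> carrier M" by blast
    have "u \<ominus>\<^bsub>N\<^esub> v = nmono (x \<ominus>\<^bsub>M\<^esub> z) 0" unfolding x(1,3) by (rule nmono_diff[OF M_MM0[OF x(4)]])
    thus "u \<ominus>\<^bsub>N\<^esub> v \<in> ?V" using M.minus_closed[OF x(2,4)] by blast
  next
    fix r u assume "r \<in> ?X" "u \<in> ?V"
    then obtain a x where x: "r = rmono a 0" "a \<in> carrier R" "u = nmono x 0" "x \<in> carrier M" by blast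
    have "r \<odot>\<^bsub>N\<^esub> u = nmono (a \<odot>\<^bsub>M\<^esub> x) 0"
      unfolding x(1,3) using rmono_nmono[OF R_P0[OF x(2)] M_MM0[OF x(4)]] by simp
    thus "r \<odot>\<^bsub>N\<^esub> u \<in> ?V" using smult_closed[OF x(2,4)] by blast
  qed
  show "chain_cond (\<lambda>U. stable_subgroup N ?X U \<and> U \<subseteq> ?V)"
  \<comment> \<open>Pulling back along \<open>nmono\<close> in degree zero turns stable subgroups of
    the base into submodules of the finitely generated module \<open>M\<close>.\<close>
  proof (rule chain_cond_image[OF fin_gen_chain_cond[OF noeth fg], where \<kappa> = "\<lambda>x. nmono x 0" and C = "carrier M"])
    fix U assume "stable_subgroup N ?X U \<and> U \<subseteq> ?V"
    hence U: "stable_subgroup N ?X U" and UV: "U \<subseteq> ?V" by simp_all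
    show "U \<subseteq> (\<lambda>x. nmono x 0) ` carrier M" using UV by blast
    show "submodule {x \<in> carrier M. nmono x 0 \<in> U} R M"
    proof (rule submoduleI_diff)
      show "\<zero>\<^bsub>M\<^esub> \<in> {x \<in> carrier M. nmono x 0 \<in> U}" using N.stable_subgroupD(2)[OF U] by (simp add: nmono_zero)
      show "x \<ominus>\<^bsub>M\<^esub> z \<in> {x \<in> carrier M. nmono x 0 \<in> U}"
        if "x \<in> {x \<in> carrier M. nmono x 0 \<in> U}" "z \<in> {x \<in> carrier M. nmono x 0 \<in> U}" for x z
        using that N.stable_subgroupD(3)[OF U, of "nmono x 0" "nmono z 0"] nmono_diff[OF M_MM0, of z x] by simp
      show "r \<odot>\<^bsub>M\<^esub> x \<in> {x \<in> carrier M. nmono x 0 \<in> U}"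
        if "r \<in> carrier R" "x \<in> {x \<in> carrier M. nmono x 0 \<in> U}" for r x
      proof -
        have x: "x \<in> carrier M" "nmono x 0 \<in> U" using that(2) by simp_all
        have "rmono r 0 \<odot>\<^bsub>N\<^esub> nmono x 0 \<in> U" by (rule N.stable_subgroupD(4)[OF U _ x(2)]) (use that(1) in blast)
        thus ?thesis using rmono_nmono[OF R_P0[OF that(1)] M_MM0[OF x(1)]] that(1) x(1) by simp
      qed
    qed blast
  qed
  fix U assume U: "stable_subgroup N (?X \<union> ?Y) U" and VU: "?V \<subseteq> U"
  have rU: "rmono r 0 \<odot>\<^bsub>N\<^esub> u \<in> U" if "r \<in> carrier R" "u \<in> U" for r u
    by (rule N.stable_subgroupD(4)[OF U _ that(2)]) (use that(1) in blast)
  \<comment> \<open>Degree by degree: \<open>MM (Suc n)\<close> is generated by \<open>I\<close>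
    times \<open>MM n\<close>, and \<open>U\<close> is closed under the chosen generators of
    \<open>I\<close> in degree one.\<close>
  have mono: "\<forall>x\<in>MM n. nmono x n \<in> U" for n
  proof (induction n)
    case 0
    thus ?case unfolding MM_0 using VU by blast
  next
    case (Suc n)
    have diffU: "nmono (x \<ominus>\<^bsub>M\<^esub> z) k \<in> U" if "x \<in> MM k" "z \<in> MM k" "nmono x k \<in> U" "nmono z k \<in> U" for x z k
      using N.stable_subgroupD(3)[OF U that(3,4)] nmono_diff[OF that(2), of x] by simp
    have smU: "nmono (r \<odot>\<^bsub>M\<^esub> x) k \<in> U" if "r \<in> carrier R" "x \<in> MM k" "nmono x k \<in> U" for r x k
      using rU[OF that(1,3)] rmono_nmono[OF R_P0[OF that(1)] that(2)] by simp
    have az: "a \<odot>\<^bsub>M\<^esub> z \<in> MM (Suc n)" if "a \<in> I" "z \<in> MM n" for a z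
      using P_MM[OF I_mem_P[OF that(1)] that(2)] by simp
    have gen: "nmono (a \<odot>\<^bsub>M\<^esub> z) (Suc n) \<in> U" if a: "a \<in> I" and z: "z \<in> MM n" for a z
    proof -
      \<comment> \<open>For fixed \<open>z\<close> the admissible \<open>a\<close> form an ideal, so
        it suffices to treat the generators of \<open>I\<close>.\<close>
      let ?B = "{a \<in> I. nmono (a \<odot>\<^bsub>M\<^esub> z) (Suc n) \<in> U}"
      have Isub: "additive_subgroup I R" by (rule ideal.axioms(1)[OF I])
      note zc = MM_carrier[OF z]
      have "ideal ?B R"
      proof (rule R.ideal_diffI)
        show "a \<in> carrier R" if "a \<in> ?B" for a using that ideal.Icarr[OF I] by blast
        show "\<zero>\<^bsub>R\<^esub> \<in> ?B" using N.stable_subgroupD(2)[OF U] additive_subgroup.zero_closed[OF Isub] zc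
          by (simp add: nmono_zero)
        show "a \<ominus> b \<in> ?B" if ab: "a \<in> ?B" "b \<in> ?B" for a b
        proof -
          have c: "a \<in> carrier R" "b \<in> carrier R" using ab ideal.Icarr[OF I] by blast+
          have "a \<ominus> b \<in> I" unfolding R.minus_eq
            using ab additive_subgroup.a_closed[OF Isub] additive_subgroup.a_inv_closed[OF Isub] by blast
          moreover have "(a \<ominus> b) \<odot>\<^bsub>M\<^esub> z = a \<odot>\<^bsub>M\<^esub> z \<ominus>\<^bsub>M\<^esub> b \<odot>\<^bsub>M\<^esub> z"
            using c zc by (simp add: R.minus_eq M.minus_eq smult_l_distr smult_l_minus)
          ultimately show ?thesis using diffU[OF az az, of a z b z] ab z by simp
        qed
        show "r \<otimes> a \<in> ?B" if r: "r \<in> carrier R" and a: "a \<in> ?B" for r a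
        proof -
          have c: "a \<in> carrier R" "a \<in> I" "nmono (a \<odot>\<^bsub>M\<^esub> z) (Suc n) \<in> U" using a ideal.Icarr[OF I] by blast+
          have "nmono (r \<odot>\<^bsub>M\<^esub> (a \<odot>\<^bsub>M\<^esub> z)) (Suc n) \<in> U" by (rule smU[OF r az[OF c(2) z] c(3)])
          thus ?thesis using smult_assoc1[OF r c(1) zc] ideal.I_l_closed[OF I c(2) r] by simp
        qed
      qed
      moreover have "set as \<subseteq> ?B"
      proof
        fix a assume a: "a \<in> set as"
        hence aI: "a \<in> I" using as_in by blast
        have "rmono a (Suc 0) \<odot>\<^bsub>N\<^esub> nmono z n \<in> U"
          by (rule N.stable_subgroupD(4)[OF U]) (use a Suc z in blast)+
        thus "a \<in> ?B" using rmono_nmono[OF I_mem_P[OF aI] z] aI by simp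
      qed
      ultimately have "Idl (set as) \<subseteq> ?B" by (rule R.genideal_minimal)
      thus ?thesis using a as(2) by blast
    qed
    let ?K = "{x \<in> MM (Suc n). nmono x (Suc n) \<in> U}"
    have "submodule ?K R M"
    proof (rule submoduleI_diff)
      show "?K \<subseteq> carrier M" using MM_carrier by blast
      show "\<zero>\<^bsub>M\<^esub> \<in> ?K"
        unfolding mem_Collect_eq nmono_zero using N.stable_subgroupD(2)[OF U] submodule_zero[OF MM_submodule] by blast
      show "a \<ominus>\<^bsub>M\<^esub> b \<in> ?K" if "a \<in> ?K" "b \<in> ?K" for a b
        using that diffU[of a "Suc n" b] submodule_diff[OF MM_submodule] by blast
      show "r \<odot>\<^bsub>M\<^esub> a \<in> ?K" if "r \<in> carrier R" "a \<in> ?K" for r a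
        using that smU[of r a "Suc n"] submoduleE(4)[OF MM_submodule] by blast
    qed
    hence "MM (Suc n) \<subseteq> ?K" by (rule MM_Suc_minimal) (use gen az in blast)
    thus ?case by blast
  qed
  show "carrier N \<subseteq> U"
  proof
    fix f assume f: "f \<in> carrier N"
    show "f \<in> U"
    proof (rule N_graded_induct[OF f])
      show "\<zero>\<^bsub>N\<^esub> \<in> U" by (rule N.stable_subgroupD(2)[OF U])
      show "u \<oplus>\<^bsub>N\<^esub> v \<in> U" if "u \<in> U" "v \<in> U" for u v by (rule N.stable_subgroup_add[OF U that])
      show "nmono (f n) n \<in> U" for n using mono N_MM[OF f] by blast
    qed
  qed
qed

end

section \<open>The shift argument\<close>

context module
begin

lemma cochains_add:
  assumes "b \<in> cochains M s d" "c \<in> cochains M s d"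
  shows "(\<lambda>S. b S \<oplus>\<^bsub>M\<^esub> c S) \<in> cochains M s d"
proof -
  have "b S \<oplus>\<^bsub>M\<^esub> c S = \<zero>\<^bsub>M\<^esub>" if "\<not> (S \<subseteq> {..<s} \<and> int (card S) = d)" for S
  proof -
    have "b S = \<zero>\<^bsub>M\<^esub>" "c S = \<zero>\<^bsub>M\<^esub>" using assms that unfolding cochains_def by blast+
    thus ?thesis by simp
  qed
  moreover have "b S \<oplus>\<^bsub>M\<^esub> c S \<in> carrier M" for S
    using cochains_closed[OF assms(1)] cochains_closed[OF assms(2)] by simp
  ultimately show ?thesis unfolding cochains_def by blast
qed

lemma koszul_add:
  assumes y: "\<And>j. j < s \<Longrightarrow> y j \<in> carrier R" and c: "\<And>T. c T \<in> carrier M" and d: "\<And>T. d T \<in> carrier M"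
  shows "koszul M y s (\<lambda>T. c T \<oplus>\<^bsub>M\<^esub> d T) S = koszul M y s c S \<oplus>\<^bsub>M\<^esub> koszul M y s d S"
proof -
  have e: "c T \<oplus>\<^bsub>M\<^esub> d T = c T \<ominus>\<^bsub>M\<^esub> (\<zero>\<^bsub>M\<^esub> \<ominus>\<^bsub>M\<^esub> d T)" for T
  proof -
    have "u \<oplus>\<^bsub>M\<^esub> v = u \<ominus>\<^bsub>M\<^esub> (\<zero>\<^bsub>M\<^esub> \<ominus>\<^bsub>M\<^esub> v)" if "u \<in> carrier M" "v \<in> carrier M" for u v using that by algebra
    thus ?thesis using c d by blast
  qed
  have k: "koszul M y s c S \<in> carrier M" "koszul M y s d S \<in> carrier M" using koszul_closed[of s y c S, OF y c] koszul_closed[of s y d S, OF y d] by simp_all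
  have "koszul M y s (\<lambda>T. c T \<oplus>\<^bsub>M\<^esub> d T) S = koszul M y s c S \<ominus>\<^bsub>M\<^esub> koszul M y s (\<lambda>T. \<zero>\<^bsub>M\<^esub> \<ominus>\<^bsub>M\<^esub> d T) S"
    unfolding e by (rule koszul_diff[OF y c]) (use d in simp_all)
  also have "koszul M y s (\<lambda>T. \<zero>\<^bsub>M\<^esub> \<ominus>\<^bsub>M\<^esub> d T) S = koszul M y s (\<lambda>T. \<zero>\<^bsub>M\<^esub>) S \<ominus>\<^bsub>M\<^esub> koszul M y s d S"
    by (rule koszul_diff[OF y _ d]) simp_all
  also have "koszul M y s (\<lambda>T. \<zero>\<^bsub>M\<^esub>) S = \<zero>\<^bsub>M\<^esub>" by (rule koszul_zero[OF y])
  also have "u \<ominus>\<^bsub>M\<^esub> (\<zero>\<^bsub>M\<^esub> \<ominus>\<^bsub>M\<^esub> v) = u \<oplus>\<^bsub>M\<^esub> v" if "u \<in> carrier M" "v \<in> carrier M" for u v using that by algebra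
  hence "koszul M y s c S \<ominus>\<^bsub>M\<^esub> (\<zero>\<^bsub>M\<^esub> \<ominus>\<^bsub>M\<^esub> koszul M y s d S) = koszul M y s c S \<oplus>\<^bsub>M\<^esub> koszul M y s d S" using k by blast
  finally show ?thesis .
qed

lemma cochains_map:
  assumes c: "c \<in> cochains M s d" and h: "h \<zero>\<^bsub>M\<^esub> = \<zero>\<^bsub>M\<^esub>" "\<And>S. h (c S) \<in> carrier M"
  shows "(\<lambda>S. h (c S)) \<in> cochains M s d"
proof -
  have "h (c S) = \<zero>\<^bsub>M\<^esub>" if "\<not> (S \<subseteq> {..<s} \<and> int (card S) = d)" for S
  proof -
    have "c S = \<zero>\<^bsub>M\<^esub>" using c that unfolding cochains_def by blast
    thus ?thesis using h(1) by simp
  qed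
  thus ?thesis unfolding cochains_def using h(2) by blast
qed

lemma koszul_exact_zeroD:
  assumes y: "\<And>j. j < s \<Longrightarrow> y j \<in> carrier R"
    and ex: "koszul_exact M y s {\<zero>\<^bsub>M\<^esub>} d" and c: "c \<in> cochains M s d" "\<And>S. koszul M y s c S = \<zero>\<^bsub>M\<^esub>"
  shows "\<exists>b\<in>cochains M s (d - 1). \<forall>S. c S = koszul M y s b S"
proof -
  have "\<forall>S. koszul M y s c S \<in> {\<zero>\<^bsub>M\<^esub>}" using c(2) by simp
  then obtain b where b: "b \<in> cochains M s (d - 1)" "\<forall>S. c S \<ominus>\<^bsub>M\<^esub> koszul M y s b S \<in> {\<zero>\<^bsub>M\<^esub>}"
    using ex c(1) unfolding koszul_exact_def by blast
  have "c S = koszul M y s b S" for S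
    by (rule diff_zero_imp_eq[OF cochains_closed[OF c(1)] koszul_closed[OF y cochains_closed[OF b(1)]]])
      (use b(2) in auto)
  thus ?thesis using b(1) by blast
qed

lemma koszul_exact_zeroI:
  assumes "\<And>c. \<lbrakk>c \<in> cochains M s d; \<And>S. koszul M y s c S = \<zero>\<^bsub>M\<^esub>\<rbrakk> \<Longrightarrow> \<exists>b\<in>cochains M s (d - 1). \<forall>S. c S = koszul M y s b S"
  shows "koszul_exact M y s {\<zero>\<^bsub>M\<^esub>} d"
  unfolding koszul_exact_def
proof (intro ballI impI)
  fix c assume c: "c \<in> cochains M s d" and "\<forall>S. koszul M y s c S \<in> {\<zero>\<^bsub>M\<^esub>}"
  hence "koszul M y s c S = \<zero>\<^bsub>M\<^esub>" for S by simp
  then obtain b where b: "b \<in> cochains M s (d - 1)" "\<And>S. c S = koszul M y s b S" using assms[OF c] by blast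
  have "c S \<ominus>\<^bsub>M\<^esub> koszul M y s b S \<in> {\<zero>\<^bsub>M\<^esub>}" for S
    using cochains_closed[OF c, of S] unfolding b(2)[symmetric] by (simp add: M.minus_eq M.r_neg)
  thus "\<exists>b\<in>cochains M s (d - 1). \<forall>S. c S \<ominus>\<^bsub>M\<^esub> koszul M y s b S \<in> {\<zero>\<^bsub>M\<^esub>}" using b(1) by blast
qed

lemma cochains_koszul:
  assumes "\<And>j. j < s \<Longrightarrow> y j \<in> carrier R" "c \<in> cochains M s (d - 1)"
  shows "koszul M y s c \<in> cochains M s d"
  using koszul_cochains[where s = s and y = y, OF assms] by simp

end

section \<open>The degree shift on the Rees module and the induction on degrees\<close>

context rees_gens
begin

text \<open>The kernels of the surjections of the Rees module onto \<open>M\<close> and onto the associated graded module.\<close>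

definition N_pos where "N_pos = {f \<in> carrier N. f 0 = \<zero>\<^bsub>M\<^esub>}"

definition N_gr where "N_gr = {f \<in> carrier N. \<forall>n. f n \<in> MM (Suc n)}"

lemma N_diff_at: "\<lbrakk>f \<in> carrier N; g \<in> carrier N\<rbrakk> \<Longrightarrow> (f \<ominus>\<^bsub>N\<^esub> g) n = f n \<ominus>\<^bsub>M\<^esub> g n"
  by (simp add: N_diff)

lemma y_low: "\<lbrakk>j < length ms; f \<in> carrier N\<rbrakk> \<Longrightarrow> y j \<odot>\<^bsub>N\<^esub> f = (\<lambda>n. ms ! j \<odot>\<^bsub>M\<^esub> f n)"
proof -
  assume j: "j < length ms" and f: "f \<in> carrier N"
  have "ms ! j \<in> carrier R" using j ms(1) nth_mem[OF j] by blast
  thus ?thesis using rmono_smult[OF R_P0 f, of "ms ! j"] j by (simp add: y_def)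
qed

lemma y_high:
  assumes j: "j < s" "\<not> j < length ms" and f: "f \<in> carrier N"
  obtains a where "a \<in> I" "y j \<odot>\<^bsub>N\<^esub> f = (\<lambda>n. if Suc 0 \<le> n then a \<odot>\<^bsub>M\<^esub> f (n - Suc 0) else \<zero>\<^bsub>M\<^esub>)"
proof -
  have jl: "j - length ms < length as" using j by (simp add: s_def)
  have aI: "as ! (j - length ms) \<in> I" using nth_mem[OF jl] as_in by blast
  have "y j \<odot>\<^bsub>N\<^esub> f = (\<lambda>n. if Suc 0 \<le> n then as ! (j - length ms) \<odot>\<^bsub>M\<^esub> f (n - Suc 0) else \<zero>\<^bsub>M\<^esub>)"
    using rmono_smult[OF I_mem_P[OF aI] f] j by (simp add: y_def)
  thus ?thesis using that aI by blast
qed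

lemma N_pos_mult: "\<lbrakk>j < s; f \<in> N_pos\<rbrakk> \<Longrightarrow> y j \<odot>\<^bsub>N\<^esub> f \<in> N_pos"
proof -
  assume j: "j < s" and f: "f \<in> N_pos"
  have fN: "f \<in> carrier N" "f 0 = \<zero>\<^bsub>M\<^esub>" using f unfolding N_pos_def by simp_all
  have yN: "y j \<odot>\<^bsub>N\<^esub> f \<in> carrier N" by (rule N.smult_closed[OF y_closed[OF j] fN(1)])
  have "(y j \<odot>\<^bsub>N\<^esub> f) 0 = \<zero>\<^bsub>M\<^esub>"
  proof (cases "j < length ms")
    case True
    have "ms ! j \<in> carrier R" using True ms(1) nth_mem[OF True] by blast
    thus ?thesis using y_low[OF True fN(1)] fN(2) by simp
  next
    case False
    obtain a where "y j \<odot>\<^bsub>N\<^esub> f = (\<lambda>n. if Suc 0 \<le> n then a \<odot>\<^bsub>M\<^esub> f (n - Suc 0) else \<zero>\<^bsub>M\<^esub>)"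
      by (rule y_high[OF j False fN(1)])
    thus ?thesis by simp
  qed
  thus ?thesis unfolding N_pos_def using yN by simp
qed

text \<open>Restricted to \<open>N_pos\<close> this is the isomorphism onto \<open>N_gr\<close> that
  links the kernels of the two surjections; \<open>shift_up\<close> is its inverse.\<close>

definition shift_down where "shift_down f = (\<lambda>n::nat. f (Suc n))"

definition shift_up where "shift_up f = (\<lambda>n::nat. case n of 0 \<Rightarrow> \<zero>\<^bsub>M\<^esub> | Suc k \<Rightarrow> f k)"

lemma shift_down_closed: "f \<in> carrier N \<Longrightarrow> shift_down f \<in> N_gr"
proof -
  assume f: "f \<in> carrier N"
  obtain d where d: "\<And>n. n > d \<Longrightarrow> f n = \<zero>\<^bsub>M\<^esub>" using N_bound[OF f] by blast
  have m: "shift_down f n \<in> MM (Suc n)" for n unfolding shift_down_def by (rule N_MM[OF f])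
  have "shift_down f \<in> carrier N"
  proof (rule N_carrierI[where d = d])
    show "shift_down f n \<in> MM n" for n using m[of n] MM_Suc_subset[of n] by blast
    show "shift_down f n = \<zero>\<^bsub>M\<^esub>" if "n > d" for n using d[of "Suc n"] that unfolding shift_down_def by simp
  qed
  thus ?thesis unfolding N_gr_def using m by blast
qed

lemma shift_up_closed: "f \<in> N_gr \<Longrightarrow> shift_up f \<in> N_pos"
proof -
  assume "f \<in> N_gr"
  hence f: "f \<in> carrier N" and m: "\<And>n. f n \<in> MM (Suc n)" unfolding N_gr_def by blast+
  obtain d where d: "\<And>n. n > d \<Longrightarrow> f n = \<zero>\<^bsub>M\<^esub>" using N_bound[OF f] by blast
  have "shift_up f \<in> carrier N"
  proof (rule N_carrierI[where d = "Suc d"])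
    show "shift_up f n \<in> MM n" for n
    proof (cases n)
      case 0
      show ?thesis unfolding 0 shift_up_def nat.case by (rule submodule_zero[OF MM_submodule])
    next
      case (Suc k)
      show ?thesis unfolding Suc shift_up_def nat.case by (rule m)
    qed
    show "shift_up f n = \<zero>\<^bsub>M\<^esub>" if "n > Suc d" for n using d that unfolding shift_up_def by (cases n) simp_all
  qed
  thus ?thesis unfolding N_pos_def by (simp add: shift_up_def)
qed

lemma shift_down_shift_up: "shift_down (shift_up f) = f"
  unfolding shift_down_def shift_up_def by simp

lemma shift_up_shift_down: "f \<in> N_pos \<Longrightarrow> shift_up (shift_down f) = f"
proof
  fix n assume "f \<in> N_pos"
  thus "shift_up (shift_down f) n = f n" unfolding shift_down_def shift_up_def N_pos_def by (cases n) simp_all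
qed

lemma shift_down_zero: "shift_down \<zero>\<^bsub>N\<^esub> = \<zero>\<^bsub>N\<^esub>"
  unfolding shift_down_def N_zero ..

lemma shift_up_zero: "shift_up \<zero>\<^bsub>N\<^esub> = \<zero>\<^bsub>N\<^esub>"
  unfolding shift_up_def N_zero by (rule ext) (simp split: nat.split)

lemma N_pos_carrier: "f \<in> N_pos \<Longrightarrow> f \<in> carrier N"
  unfolding N_pos_def by blast

lemma N_gr_carrier: "f \<in> N_gr \<Longrightarrow> f \<in> carrier N"
  unfolding N_gr_def by blast

lemma N_pos_zero: "\<zero>\<^bsub>N\<^esub> \<in> N_pos"
  unfolding N_pos_def using N.M.zero_closed N_zero by simp

lemma N_pos_diff: "\<lbrakk>f \<in> N_pos; g \<in> N_pos\<rbrakk> \<Longrightarrow> f \<ominus>\<^bsub>N\<^esub> g \<in> N_pos"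
  unfolding N_pos_def using N.M.minus_closed N_diff_at[of f g 0] by simp

text \<open>A generator of degree one applied after the shift leaves no constant term. Applied
  before the shift it leaves a multiple of \<open>f 0\<close> there, which vanishes on
  \<open>N_pos\<close>.\<close>

lemma shift_down_smult:
  assumes j: "j < s" and f: "f \<in> N_pos"
  shows "shift_down (y j \<odot>\<^bsub>N\<^esub> f) = y j \<odot>\<^bsub>N\<^esub> shift_down f"
proof -
  note fN = N_pos_carrier[OF f] and dN = N_gr_carrier[OF shift_down_closed[OF N_pos_carrier[OF f]]]
  show ?thesis
  proof (cases "j < length ms")
    case True
    show ?thesis unfolding y_low[OF True fN] y_low[OF True dN] by (simp add: shift_down_def)
  next
    case False
    have jl: "j - length ms < length as" using j False by (simp add: s_def)
    have aI: "as ! (j - length ms) \<in> I" using nth_mem[OF jl] as_in by blast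
    have yj: "y j = rmono (as ! (j - length ms)) (Suc 0)" using False by (simp add: y_def)
    have f0: "f 0 = \<zero>\<^bsub>M\<^esub>" using f unfolding N_pos_def by simp
    show ?thesis unfolding yj rmono_smult[OF I_mem_P[OF aI] fN] rmono_smult[OF I_mem_P[OF aI] dN]
    proof
      fix n
      show "shift_down (\<lambda>n. if Suc 0 \<le> n then as ! (j - length ms) \<odot>\<^bsub>M\<^esub> f (n - Suc 0) else \<zero>\<^bsub>M\<^esub>) n =
        (if Suc 0 \<le> n then as ! (j - length ms) \<odot>\<^bsub>M\<^esub> shift_down f (n - Suc 0) else \<zero>\<^bsub>M\<^esub>)"
        using f0 ideal.Icarr[OF I aI] by (cases n) (simp_all add: shift_down_def)
    qed
  qed
qed

lemma koszul_N_pos: "(\<And>T. c T \<in> N_pos) \<Longrightarrow> koszul N y s c T \<in> N_pos"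
proof -
  assume c: "\<And>T. c T \<in> N_pos"
  show ?thesis
  proof (rule N.koszul_mem[where P = "\<lambda>_. N_pos" and Q = "\<lambda>_. N_pos"])
    show "y j \<odot>\<^bsub>N\<^esub> u \<in> N_pos" if "j < s" "j \<in> T" "u \<in> N_pos" for j T u by (rule N_pos_mult[OF that(1,3)])
  qed (fact c N_pos_zero N_pos_diff)+
qed

lemma koszul_shift_down: "(\<And>T. c T \<in> N_pos) \<Longrightarrow> shift_down (koszul N y s c T) = koszul N y s (\<lambda>T. shift_down (c T)) T"
proof -
  assume c: "\<And>T. c T \<in> N_pos"
  show ?thesis
  proof (rule N.koszul_hom[where P = N_pos and h = shift_down])
    show "y j \<in> carrier S" if "j < s" for j by (rule y_closed[OF that])
    show "N_pos \<subseteq> carrier N" using N_pos_carrier by blast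
    show "\<zero>\<^bsub>N\<^esub> \<in> N_pos" by (rule N_pos_zero)
    show "u \<ominus>\<^bsub>N\<^esub> v \<in> N_pos" if "u \<in> N_pos" "v \<in> N_pos" for u v by (rule N_pos_diff[OF that])
    show "y j \<odot>\<^bsub>N\<^esub> u \<in> N_pos" if "j < s" "u \<in> N_pos" for j u by (rule N_pos_mult[OF that])
    show "shift_down \<zero>\<^bsub>N\<^esub> = \<zero>\<^bsub>N\<^esub>" by (rule shift_down_zero)
    show "shift_down (u \<ominus>\<^bsub>N\<^esub> v) = shift_down u \<ominus>\<^bsub>N\<^esub> shift_down v" if "u \<in> N_pos" "v \<in> N_pos" for u v
      unfolding N_diff[OF N_pos_carrier[OF that(2)]] N_diff[OF N_gr_carrier[OF shift_down_closed[OF N_pos_carrier[OF that(2)]]]]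
      by (simp add: shift_down_def)
    show "shift_down (y j \<odot>\<^bsub>N\<^esub> u) = y j \<odot>\<^bsub>N\<^esub> shift_down u" if "j < s" "u \<in> N_pos" for j u by (rule shift_down_smult[OF that])
    show "c T \<in> N_pos" for T by (rule c)
  qed
qed

lemma koszul_shift_up: 
  assumes c: "\<And>T. c T \<in> N_gr"
  shows "shift_up (koszul N y s c T) = koszul N y s (\<lambda>T. shift_up (c T)) T"
proof -
  have "shift_down (koszul N y s (\<lambda>T. shift_up (c T)) T) = koszul N y s c T"
    using koszul_shift_down[of "\<lambda>T. shift_up (c T)" T] shift_up_closed[OF c] by (simp add: shift_down_shift_up)
  moreover have "koszul N y s (\<lambda>T. shift_up (c T)) T \<in> N_pos" by (rule koszul_N_pos) (rule shift_up_closed[OF c])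
  ultimately show ?thesis using shift_up_shift_down[of "koszul N y s (\<lambda>T. shift_up (c T)) T"] by simp
qed

text \<open>The degree of the product of the generators with index in \<open>T\<close>.\<close>

definition wt :: "nat set \<Rightarrow> nat" where "wt T = card {j \<in> T. length ms \<le> j \<and> j < s}"

lemma wt_le: "wt T \<le> s"
proof -
  have "{j \<in> T. length ms \<le> j \<and> j < s} \<subseteq> {..<s}" by auto
  from card_mono[OF _ this] show ?thesis unfolding wt_def by simp
qed

lemma wt_low: "j < length ms \<Longrightarrow> wt (T - {j}) = wt T"
proof -
  assume "j < length ms"
  hence "{i \<in> T - {j}. length ms \<le> i \<and> i < s} = {i \<in> T. length ms \<le> i \<and> i < s}" by auto
  thus ?thesis unfolding wt_def by simp
qed

lemma wt_high: "\<lbrakk>j < s; \<not> j < length ms; j \<in> T\<rbrakk> \<Longrightarrow> wt T = Suc (wt (T - {j}))"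
proof -
  assume j: "j < s" "\<not> j < length ms" "j \<in> T"
  have e: "{i \<in> T - {j}. length ms \<le> i \<and> i < s} = {i \<in> T. length ms \<le> i \<and> i < s} - {j}" by auto
  have "finite {i \<in> T. length ms \<le> i \<and> i < s}" "j \<in> {i \<in> T. length ms \<le> i \<and> i < s}"
    using j by simp_all
  thus ?thesis unfolding wt_def e by (rule card_Suc_Diff1[symmetric])
qed

text \<open>The inequality means that \<open>n - wt T\<close> is at least \<open>D - s\<close>,
  written without subtraction. The differential respects this degree: a generator of degree one
  raises both \<open>n\<close> and \<open>wt T\<close> by one, a generator of degree zero raises
  neither.\<close>

lemma koszul_degree_bound:
  assumes c: "\<And>T. c T \<in> carrier N" and b: "\<And>T n. D + wt T \<le> n + s \<Longrightarrow> c T n = \<zero>\<^bsub>M\<^esub>"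
    and n: "D + wt T \<le> n + s"
  shows "koszul N y s c T n = \<zero>\<^bsub>M\<^esub>"
proof -
  define B where "B T = {f \<in> carrier N. \<forall>n. D + wt T \<le> n + s \<longrightarrow> f n = \<zero>\<^bsub>M\<^esub>}" for T
  have "koszul N y s c T \<in> B T"
  proof (rule N.koszul_mem[where P = B and Q = B])
    show "c T \<in> B T" for T unfolding B_def using c b by blast
    show "\<zero>\<^bsub>N\<^esub> \<in> B T" for T unfolding B_def using N.M.zero_closed by (simp add: N_zero)
    show "u \<ominus>\<^bsub>N\<^esub> v \<in> B T" if "u \<in> B T" "v \<in> B T" for T u v
      using that unfolding B_def by (simp add: N_diff_at)
    show "y j \<odot>\<^bsub>N\<^esub> u \<in> B T" if j: "j < s" "j \<in> T" and u: "u \<in> B (T - {j})" for j T u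
    proof -
      have uN: "u \<in> carrier N" and u0: "\<And>n. D + wt (T - {j}) \<le> n + s \<Longrightarrow> u n = \<zero>\<^bsub>M\<^esub>"
        using u unfolding B_def by blast+
      have "(y j \<odot>\<^bsub>N\<^esub> u) n = \<zero>\<^bsub>M\<^esub>" if n: "D + wt T \<le> n + s" for n
      proof (cases "j < length ms")
        case True
        have "ms ! j \<in> carrier R" using True ms(1) nth_mem[OF True] by blast
        thus ?thesis using y_low[OF True uN] u0[of n] n wt_low[OF True, of T] by simp
      next
        case False
        obtain a where a: "a \<in> I" "y j \<odot>\<^bsub>N\<^esub> u = (\<lambda>n. if Suc 0 \<le> n then a \<odot>\<^bsub>M\<^esub> u (n - Suc 0) else \<zero>\<^bsub>M\<^esub>)"
          by (rule y_high[OF j(1) False uN])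
        show ?thesis
        proof (cases n)
          case 0
          thus ?thesis using a(2) by simp
        next
          case (Suc k)
          have "u k = \<zero>\<^bsub>M\<^esub>" by (rule u0) (use n Suc wt_high[OF j(1) False j(2)] in simp)
          thus ?thesis using a(2) Suc ideal.Icarr[OF I a(1)] by simp
        qed
      qed
      thus ?thesis unfolding B_def using N.smult_closed[OF y_closed[OF j(1)] uN] by blast
    qed
  qed
  thus ?thesis unfolding B_def using n by blast
qed

text \<open>Generators of degree one contribute nothing in internal degree zero, and those of degree
  zero do not change \<open>wt\<close>. So only values at sets of the same weight as
  \<open>T\<close> enter.\<close>

lemma koszul_weight_component:
  assumes c: "\<And>T. c T \<in> carrier N" and b: "\<And>U. wt U = wt T \<Longrightarrow> c U 0 = \<zero>\<^bsub>M\<^esub>"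
  shows "koszul N y s c T 0 = \<zero>\<^bsub>M\<^esub>"
proof -
  define B where "B U = {f \<in> carrier N. wt U = wt T \<longrightarrow> f 0 = \<zero>\<^bsub>M\<^esub>}" for U
  have "koszul N y s c T \<in> B T"
  proof (rule N.koszul_mem[where P = B and Q = B])
    show "c U \<in> B U" for U unfolding B_def using c b by blast
    show "\<zero>\<^bsub>N\<^esub> \<in> B U" for U unfolding B_def using N.M.zero_closed by (simp add: N_zero)
    show "u \<ominus>\<^bsub>N\<^esub> v \<in> B U" if "u \<in> B U" "v \<in> B U" for U u v
      using that unfolding B_def by (simp add: N_diff_at)
    show "y j \<odot>\<^bsub>N\<^esub> u \<in> B U" if j: "j < s" "j \<in> U" and u: "u \<in> B (U - {j})" for j U u
    proof -
      have uN: "u \<in> carrier N" and u0: "wt (U - {j}) = wt T \<Longrightarrow> u 0 = \<zero>\<^bsub>M\<^esub>"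
        using u unfolding B_def by blast+
      have "(y j \<odot>\<^bsub>N\<^esub> u) 0 = \<zero>\<^bsub>M\<^esub>" if n: "wt U = wt T"
      proof (cases "j < length ms")
        case True
        have "ms ! j \<in> carrier R" using True ms(1) nth_mem[OF True] by blast
        thus ?thesis using y_low[OF True uN] u0 n wt_low[OF True, of U] by simp
      next
        case False
        obtain a where a: "a \<in> I" "y j \<odot>\<^bsub>N\<^esub> u = (\<lambda>n. if Suc 0 \<le> n then a \<odot>\<^bsub>M\<^esub> u (n - Suc 0) else \<zero>\<^bsub>M\<^esub>)"
          by (rule y_high[OF j(1) False uN])
        thus ?thesis by simp
      qed
      thus ?thesis unfolding B_def using N.smult_closed[OF y_closed[OF j(1)] uN] by blast
    qed
  qed
  thus ?thesis unfolding B_def by blast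
qed

text \<open>
  Induction on the bound \<open>D - s\<close> of the internal degree: modulo a coboundary \<open>c\<close> lies in \<open>N_pos\<close>,
  hence may be shifted down, and \<open>exG\<close> allows to lift a preimage of the shifted cocycle back to \<open>N_pos\<close>.
\<close>
lemma cocycle_bounded_is_coboundary:
  assumes exM: "koszul_exact N y s N_pos d" and exG: "koszul_exact N y s N_gr (d - 1)"
  shows "\<lbrakk>c \<in> cochains N s d; \<And>T. koszul N y s c T = \<zero>\<^bsub>N\<^esub>; \<And>T n. D + wt T \<le> n + s \<Longrightarrow> c T n = \<zero>\<^bsub>M\<^esub>\<rbrakk>
    \<Longrightarrow> \<exists>b\<in>cochains N s (d - 1). \<forall>T. c T = koszul N y s b T"
proof (induction D arbitrary: c)
  case 0
  \<comment> \<open>For \<open>D = 0\<close> the bound covers every \<open>n\<close>, as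
    \<open>wt T\<close> never exceeds \<open>s\<close>.\<close>
  have "c T = \<zero>\<^bsub>N\<^esub>" for T
    unfolding N_zero by (rule ext, rule 0(3)) (use wt_le[of T] in simp)
  hence "\<forall>T. c T = koszul N y s (\<lambda>T. \<zero>\<^bsub>N\<^esub>) T" using N.koszul_zero[OF y_closed] by simp
  thus ?case using N.cochains_zero[of s "d - 1"] by blast
next
  case (Suc D)
  let ?d = "koszul N y s"
  note cN = N.cochains_closed[OF Suc.prems(1)]
  have dc: "?d b T \<in> carrier N" if "b \<in> cochains N s e" for b e T
    by (rule N.koszul_closed[OF y_closed N.cochains_closed[OF that]])
  have "?d c T \<in> N_pos" for T using Suc.prems(2) N_pos_zero by simp
  then obtain b where b: "b \<in> cochains N s (d - 1)" "\<And>T. c T \<ominus>\<^bsub>N\<^esub> ?d b T \<in> N_pos"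
    using exM Suc.prems(1) unfolding koszul_exact_def by blast
  note bN = N.cochains_closed[OF b(1)]
  \<comment> \<open>The constant terms of \<open>b\<close> determine those of \<open>?d b\<close>.
    They are dropped where the bound makes \<open>c\<close> vanish in degree zero anyway, so that
    subtracting \<open>?d b'\<close> does not break the bound.\<close>
  define b' where "b' T = (if Suc D + wt T \<le> s then \<zero>\<^bsub>N\<^esub> else nmono (b T 0) 0)" for T
  have b'N: "b' T \<in> carrier N" for T
    unfolding b'_def using nmono_closed[OF M_MM0[OF N_M[OF bN]]] N.M.zero_closed by simp
  have b': "b' \<in> cochains N s (d - 1)"
  proof -
    have "b' T = \<zero>\<^bsub>N\<^esub>" if "\<not> (T \<subseteq> {..<s} \<and> int (card T) = d - 1)" for T
    proof -
      have "b T = \<zero>\<^bsub>N\<^esub>" using b(1) that unfolding cochains_def by blast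
      hence "b T 0 = \<zero>\<^bsub>M\<^esub>" by (simp add: N_zero)
      thus ?thesis unfolding b'_def by (simp add: nmono_zero)
    qed
    thus ?thesis unfolding cochains_def using b'N by blast
  qed
  have b'_bound: "?d b' T n = \<zero>\<^bsub>M\<^esub>" if "Suc D + wt T \<le> n + s" for T n
  proof (rule koszul_degree_bound[OF b'N _ that])
    fix T n assume n: "Suc D + wt T \<le> n + s"
    show "b' T n = \<zero>\<^bsub>M\<^esub>"
    proof (cases "Suc D + wt T \<le> s")
      case True
      thus ?thesis by (simp add: b'_def N_zero)
    next
      case False
      hence "n \<noteq> 0" using n by auto
      thus ?thesis using False by (simp add: b'_def nmono_def)
    qed
  qed
  define c' where "c' T = c T \<ominus>\<^bsub>N\<^esub> ?d b' T" for T
  have c'k: "c' \<in> cochains N s d"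
    unfolding c'_def[abs_def] by (rule N.cochains_diff[OF Suc.prems(1) N.cochains_koszul[OF y_closed b']])
  have c'N_pos: "c' T \<in> N_pos" for T
  proof -
    have "c T 0 \<ominus>\<^bsub>M\<^esub> ?d b' T 0 = \<zero>\<^bsub>M\<^esub>"
    \<comment> \<open>Either both terms vanish by the bound, or \<open>b\<close> and
      \<open>b'\<close> have equal constant terms at all sets of the weight of
      \<open>T\<close>.\<close>
    proof (cases "Suc D + wt T \<le> s")
      case True
      thus ?thesis using Suc.prems(3)[of T 0] b'_bound[of T 0] by simp
    next
      case False
      have "?d (\<lambda>U. b U \<ominus>\<^bsub>N\<^esub> b' U) T 0 = \<zero>\<^bsub>M\<^esub>"
      proof (rule koszul_weight_component)
        show "b U \<ominus>\<^bsub>N\<^esub> b' U \<in> carrier N" for U by (rule N.M.minus_closed[OF bN b'N])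
        fix U assume "wt U = wt T"
        hence "b' U 0 = b U 0" using False by (simp add: b'_def nmono_def)
        thus "(b U \<ominus>\<^bsub>N\<^esub> b' U) 0 = \<zero>\<^bsub>M\<^esub>"
          using N_diff_at[OF bN b'N] N_M[OF bN] by (simp add: M.minus_eq M.r_neg)
      qed
      moreover have "?d (\<lambda>U. b U \<ominus>\<^bsub>N\<^esub> b' U) T = ?d b T \<ominus>\<^bsub>N\<^esub> ?d b' T"
        by (rule N.koszul_diff[OF y_closed bN b'N])
      ultimately have "?d b T 0 \<ominus>\<^bsub>M\<^esub> ?d b' T 0 = \<zero>\<^bsub>M\<^esub>" using N_diff_at[OF dc[OF b(1)] dc[OF b']] by simp
      hence e1: "?d b T 0 = ?d b' T 0" by (rule diff_zero_imp_eq[OF N_M[OF dc[OF b(1)]] N_M[OF dc[OF b']]])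
      have "c T 0 \<ominus>\<^bsub>M\<^esub> ?d b T 0 = \<zero>\<^bsub>M\<^esub>" using b(2)[of T] N_diff_at[OF cN dc[OF b(1)]] unfolding N_pos_def by simp
      thus ?thesis using e1 by simp
    qed
    thus ?thesis unfolding N_pos_def
      using N.cochains_closed[OF c'k, of T] N_diff_at[OF cN[of T] dc[OF b', of T], of 0] by (simp add: c'_def)
  qed
  define c'' where "c'' T = shift_down (c' T)" for T
  have c''N_gr: "c'' T \<in> N_gr" for T unfolding c''_def by (rule shift_down_closed[OF N_pos_carrier[OF c'N_pos]])
  have c''k: "c'' \<in> cochains N s d"
    unfolding c''_def[abs_def]
    by (rule N.cochains_map[where h = shift_down, OF c'k shift_down_zero]) (rule N_gr_carrier[OF shift_down_closed[OF N_pos_carrier[OF c'N_pos]]])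
  have "?d c'' T = \<zero>\<^bsub>N\<^esub>" for T
  proof -
    have "?d c' T = ?d c T \<ominus>\<^bsub>N\<^esub> ?d (?d b') T"
      unfolding c'_def[abs_def] by (rule N.koszul_diff[OF y_closed cN dc[OF b']])
    also have "\<dots> = \<zero>\<^bsub>N\<^esub>" using Suc.prems(2) N.koszul_koszul[of s y b' T, OF y_closed b'N] by simp
    finally show ?thesis using koszul_shift_down[of c' T, OF c'N_pos] shift_down_zero unfolding c''_def[abs_def] by simp
  qed
  \<comment> \<open>The shift replaces \<open>n\<close> by \<open>Suc n\<close>, which turns the
    bound for \<open>Suc D\<close> into the one for \<open>D\<close>.\<close>
  moreover have "c'' T n = \<zero>\<^bsub>M\<^esub>" if n: "D + wt T \<le> n + s" for T n
    using n Suc.prems(3)[of T "Suc n"] b'_bound[of T "Suc n"] N_diff_at[OF cN[of T] dc[OF b', of T], of "Suc n"]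
    by (simp add: c''_def c'_def shift_down_def)
  ultimately have "\<exists>e\<in>cochains N s (d - 1). \<forall>T. c'' T = ?d e T" by (rule Suc.IH[OF c''k])
  then obtain e where e: "e \<in> cochains N s (d - 1)" "\<And>T. c'' T = ?d e T" by blast
  \<comment> \<open>\<open>e\<close> need not have values in \<open>N_gr\<close>, so it cannot be
    shifted up yet. It is a cocycle modulo \<open>N_gr\<close> in degree \<open>d - 1\<close>, and
    \<open>exG\<close> corrects it by a coboundary.\<close>
  have "\<forall>T. ?d e T \<in> N_gr" using c''N_gr e(2) by simp
  then obtain g where g: "g \<in> cochains N s (d - 1 - 1)" "\<And>T. e T \<ominus>\<^bsub>N\<^esub> ?d g T \<in> N_gr"
    using exG e(1) unfolding koszul_exact_def by blast
  define e1 where "e1 T = e T \<ominus>\<^bsub>N\<^esub> ?d g T" for T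
  have e1LG: "e1 T \<in> N_gr" for T unfolding e1_def by (rule g(2))
  have e1k: "e1 \<in> cochains N s (d - 1)"
    unfolding e1_def[abs_def] by (rule N.cochains_diff[OF e(1) N.cochains_koszul[OF y_closed g(1)]])
  have de1: "?d e1 T = c'' T" for T
  proof -
    have "?d e1 T = ?d e T \<ominus>\<^bsub>N\<^esub> ?d (?d g) T"
      unfolding e1_def[abs_def] by (rule N.koszul_diff[OF y_closed N.cochains_closed[OF e(1)] dc[OF g(1)]])
    also have "\<dots> = c'' T" using N.koszul_koszul[of s y g T, OF y_closed N.cochains_closed[OF g(1)]] e(2) dc[OF e(1)] by simp
    finally show ?thesis .
  qed
  have sk: "(\<lambda>T. shift_up (e1 T)) \<in> cochains N s (d - 1)"
    by (rule N.cochains_map[where h = shift_up, OF e1k shift_up_zero]) (rule N_pos_carrier[OF shift_up_closed[OF e1LG]])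
  have ds: "?d (\<lambda>T. shift_up (e1 T)) T = c' T" for T
    using koszul_shift_up[of e1 T, OF e1LG] de1[of T] shift_up_shift_down[OF c'N_pos] by (simp add: c''_def)
  have "c T = ?d (\<lambda>T. shift_up (e1 T) \<oplus>\<^bsub>N\<^esub> b' T) T" for T
  proof -
    have "?d (\<lambda>T. shift_up (e1 T) \<oplus>\<^bsub>N\<^esub> b' T) T = c' T \<oplus>\<^bsub>N\<^esub> ?d b' T"
      unfolding ds[symmetric] by (rule N.koszul_add[OF y_closed N.cochains_closed[OF sk] b'N])
    moreover have "(u \<ominus>\<^bsub>N\<^esub> v) \<oplus>\<^bsub>N\<^esub> v = u" if "u \<in> carrier N" "v \<in> carrier N" for u v
      using that by (simp add: N.M.minus_eq N.M.a_assoc N.M.l_neg)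
    ultimately show ?thesis using cN dc[OF b'] by (simp add: c'_def)
  qed
  thus ?case using N.cochains_add[OF sk b'] by blast
qed

theorem koszul_exact_rees:
  assumes exM: "koszul_exact N y s N_pos d" and exG: "koszul_exact N y s N_gr (d - 1)"
  shows "koszul_exact N y s {\<zero>\<^bsub>N\<^esub>} d"
proof (rule N.koszul_exact_zeroI)
  fix c assume c: "c \<in> cochains N s d" and dz: "\<And>T. koszul N y s c T = \<zero>\<^bsub>N\<^esub>"
  have "\<exists>D. \<forall>n. n > D \<longrightarrow> c T n = \<zero>\<^bsub>M\<^esub>" for T
    using N_bound[OF N.cochains_closed[OF c, of T]] by metis
  then obtain e where e: "\<And>T n. n > e T \<Longrightarrow> c T n = \<zero>\<^bsub>M\<^esub>" by metis
  \<comment> \<open>The sum over all index sets dominates each bound \<open>e T\<close>; the summand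
    \<open>s\<close> cancels the \<open>s\<close> in the degree bound, and \<open>Suc\<close> makes
    the inequality strict.\<close>
  define D where "D = Suc (s + (\<Sum>T\<in>Pow {..<s}. e T))"
  have "c T n = \<zero>\<^bsub>M\<^esub>" if n: "D + wt T \<le> n + s" for T n
  proof (cases "T \<subseteq> {..<s}")
    case True
    hence "e T \<le> (\<Sum>T\<in>Pow {..<s}. e T)" by (intro member_le_sum) auto
    thus ?thesis using e[of T n] n unfolding D_def by simp
  next
    case False
    hence "c T = \<zero>\<^bsub>N\<^esub>" using c unfolding cochains_def by blast
    thus ?thesis by (simp add: N_zero)
  qed
  thus "\<exists>b\<in>cochains N s (d - 1). \<forall>T. c T = koszul N y s b T"
    by (rule cocycle_bounded_is_coboundary[OF exM exG c dz])
qed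

text \<open>For a cocycle \<open>c\<close> modulo \<open>N_gr\<close> the connecting class is
  represented by \<open>shift_up\<close> of the differential of \<open>c\<close>. It bounds in
  \<open>N\<close> by \<open>ex0(2)\<close>, hence in \<open>N_pos\<close> by \<open>exM\<close>; so
  \<open>c\<close> lifts to a cocycle of \<open>N\<close>, which bounds by
  \<open>ex0(1)\<close>.\<close>

theorem koszul_exact_assoc_graded:
  assumes exM: "koszul_exact N y s N_pos d" and ex0: "koszul_exact N y s {\<zero>\<^bsub>N\<^esub>} d" "koszul_exact N y s {\<zero>\<^bsub>N\<^esub>} (d + 1)"
  shows "koszul_exact N y s N_gr d"
  unfolding koszul_exact_def
proof (intro ballI impI)
  let ?d = "koszul N y s"
  have dc: "?d b T \<in> carrier N" if "b \<in> cochains N s e" for b e T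
    by (rule N.koszul_closed[OF y_closed N.cochains_closed[OF that]])
  fix c assume c: "c \<in> cochains N s d" and "\<forall>T. ?d c T \<in> N_gr"
  hence dcLG: "?d c T \<in> N_gr" for T by simp
  note cN = N.cochains_closed[OF c]
  have kk: "?d c \<in> cochains N s (d + 1)" by (rule N.koszul_cochains[OF y_closed c])
  have c2: "(\<lambda>T. shift_up (?d c T)) \<in> cochains N s (d + 1)"
    by (rule N.cochains_map[where h = shift_up, OF kk shift_up_zero]) (rule N_pos_carrier[OF shift_up_closed[OF dcLG]])
  have "?d (\<lambda>T. shift_up (?d c T)) T = \<zero>\<^bsub>N\<^esub>" for T
    using koszul_shift_up[of "?d c" T, OF dcLG] N.koszul_koszul[of s y c T, OF y_closed cN] shift_up_zero by simp
  then obtain b where b: "b \<in> cochains N s (d + 1 - 1)" "\<And>T. shift_up (?d c T) = ?d b T"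
    using N.koszul_exact_zeroD[OF y_closed ex0(2) c2] by blast
  have bk: "b \<in> cochains N s d" using b(1) by simp
  have "\<forall>T. ?d b T \<in> N_pos" using shift_up_closed[OF dcLG] b(2) by simp
  then obtain e where e: "e \<in> cochains N s (d - 1)" "\<And>T. b T \<ominus>\<^bsub>N\<^esub> ?d e T \<in> N_pos"
    using exM bk unfolding koszul_exact_def by blast
  \<comment> \<open>The shift commutes with the differential on \<open>N_pos\<close>, so the
    primitive is moved there first; subtracting a coboundary does not change its
    differential.\<close>
  define b1 where "b1 T = b T \<ominus>\<^bsub>N\<^esub> ?d e T" for T
  have b1LM: "b1 T \<in> N_pos" for T unfolding b1_def by (rule e(2))
  have b1k: "b1 \<in> cochains N s d"
    unfolding b1_def[abs_def] by (rule N.cochains_diff[OF bk N.cochains_koszul[OF y_closed e(1)]])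
  have db1: "?d b1 T = shift_up (?d c T)" for T
  proof -
    have "?d b1 T = ?d b T \<ominus>\<^bsub>N\<^esub> ?d (?d e) T"
      unfolding b1_def[abs_def] by (rule N.koszul_diff[OF y_closed N.cochains_closed[OF bk] dc[OF e(1)]])
    also have "\<dots> = shift_up (?d c T)" using N.koszul_koszul[of s y e T, OF y_closed N.cochains_closed[OF e(1)]] b(2) dc[OF bk] by simp
    finally show ?thesis .
  qed
  have dnN: "shift_down (b1 T) \<in> N_gr" for T by (rule shift_down_closed[OF N_pos_carrier[OF b1LM]])
  have dnk: "(\<lambda>T. shift_down (b1 T)) \<in> cochains N s d"
    by (rule N.cochains_map[where h = shift_down, OF b1k shift_down_zero]) (rule N_gr_carrier[OF dnN])
  have ddn: "?d (\<lambda>T. shift_down (b1 T)) T = ?d c T" for T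
    using koszul_shift_down[of b1 T, OF b1LM] db1[of T] shift_down_shift_up by simp
  have rz: "u \<ominus>\<^bsub>N\<^esub> u = \<zero>\<^bsub>N\<^esub>" if "u \<in> carrier N" for u
    using that by (simp add: N.M.minus_eq N.M.r_neg)
  \<comment> \<open>\<open>shift_down (b1 T)\<close> lies in \<open>N_gr\<close> and has the same
    differential as \<open>c\<close>. Subtracting it turns \<open>c\<close> into a cocycle of
    \<open>N\<close> without changing it modulo \<open>N_gr\<close>.\<close>
  have "?d (\<lambda>T. c T \<ominus>\<^bsub>N\<^esub> shift_down (b1 T)) T = \<zero>\<^bsub>N\<^esub>" for T
  proof -
    have "?d (\<lambda>T. c T \<ominus>\<^bsub>N\<^esub> shift_down (b1 T)) T = ?d c T \<ominus>\<^bsub>N\<^esub> ?d (\<lambda>T. shift_down (b1 T)) T"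
      by (rule N.koszul_diff[OF y_closed cN N_gr_carrier[OF dnN]])
    thus ?thesis unfolding ddn using rz[OF dc[OF c]] by simp
  qed
  then obtain f where f: "f \<in> cochains N s (d - 1)" "\<And>T. c T \<ominus>\<^bsub>N\<^esub> shift_down (b1 T) = ?d f T"
    using N.koszul_exact_zeroD[OF y_closed ex0(1) N.cochains_diff[OF c dnk]] by blast
  have "c T \<ominus>\<^bsub>N\<^esub> ?d f T \<in> N_gr" for T
  proof -
    have "u \<ominus>\<^bsub>N\<^esub> (u \<ominus>\<^bsub>N\<^esub> v) = v" if "u \<in> carrier N" "v \<in> carrier N" for u v
      using that by (simp add: N.M.minus_eq N.M.minus_add N.M.r_neg1 N.M.r_neg2 N.M.minus_minus)
    thus ?thesis unfolding f(2)[symmetric] using cN N_gr_carrier[OF dnN] dnN by simp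
  qed
  thus "\<exists>b\<in>cochains N s (d - 1). \<forall>T. c T \<ominus>\<^bsub>N\<^esub> ?d b T \<in> N_gr" using f(1) by blast
qed

end

section \<open>The module and its associated graded module as quotients of the Rees module\<close>

context module
begin

lemma submodule_abelian_subgroup: "submodule K R M \<Longrightarrow> abelian_subgroup K M"
  by (intro abelian_subgroupI3 additive_subgroupI M.abelian_group_axioms) (simp add: submodule_def)

lemma submodule_subgroup: "submodule K R M \<Longrightarrow> subgroup K (add_monoid M)"
  by (simp add: submodule_def)

lemma rcos_add:
  assumes "submodule K R M" "u \<in> carrier M" "v \<in> carrier M"
  shows "(K +>\<^bsub>M\<^esub> u) <+>\<^bsub>M\<^esub> (K +>\<^bsub>M\<^esub> v) = K +>\<^bsub>M\<^esub> (u \<oplus>\<^bsub>M\<^esub> v)"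
  by (rule abelian_subgroup.a_rcos_sum[OF submodule_abelian_subgroup[OF assms(1)] assms(2,3)])

lemma rcos_zero: "submodule K R M \<Longrightarrow> K +>\<^bsub>M\<^esub> \<zero>\<^bsub>M\<^esub> = K"
  using submoduleE(1) by simp

lemma rcos_eq_iff:
  assumes "submodule K R M" "u \<in> carrier M"
  shows "K +>\<^bsub>M\<^esub> u = K \<longleftrightarrow> u \<in> K"
  using M.a_coset_join1[OF _ assms(2) submodule_subgroup[OF assms(1)]]
    M.a_coset_join2[OF assms(2) submodule_subgroup[OF assms(1)]] by blast

lemma rcos_eqI:
  assumes K: "submodule K R M" and "k \<in> K" "u \<in> carrier M"
  shows "K +>\<^bsub>M\<^esub> (k \<oplus>\<^bsub>M\<^esub> u) = K +>\<^bsub>M\<^esub> u"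
proof -
  have "k \<oplus>\<^bsub>M\<^esub> u \<in> K +>\<^bsub>M\<^esub> u" using assms(2) unfolding a_r_coset_def' by blast
  from M.a_repr_independence[OF this assms(3) submodule_subgroup[OF K]] show ?thesis by simp
qed

text \<open>The scalar multiplication of the associated graded module is a \<open>finsum\<close>
  taken in this quotient, and the rules for \<open>finsum\<close> live in an abelian monoid.\<close>

lemma quot_abelian_monoid:
  assumes K: "submodule K R M"
  shows "abelian_monoid (quot_module M K)"
proof -
  have car: "carrier (quot_module M K) = {K +>\<^bsub>M\<^esub> u | u. u \<in> carrier M}"
    unfolding quot_module_def A_RCOSETS_def' by auto
  have ops: "add (quot_module M K) = set_add M" "zero (quot_module M K) = K"
    by (simp_all add: quot_module_def)
  show ?thesis
  proof (rule abelian_monoidI)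
    show "\<zero>\<^bsub>quot_module M K\<^esub> \<in> carrier (quot_module M K)"
      unfolding ops car using rcos_zero[OF K] M.zero_closed by blast
    fix x assume "x \<in> carrier (quot_module M K)"
    then obtain u where u: "x = K +>\<^bsub>M\<^esub> u" "u \<in> carrier M" unfolding car by blast
    show "\<zero>\<^bsub>quot_module M K\<^esub> \<oplus>\<^bsub>quot_module M K\<^esub> x = x"
      unfolding ops u(1) using rcos_add[OF K M.zero_closed u(2)] rcos_zero[OF K] u(2) by simp
    fix y assume "y \<in> carrier (quot_module M K)"
    then obtain v where v: "y = K +>\<^bsub>M\<^esub> v" "v \<in> carrier M" unfolding car by blast
    show "x \<oplus>\<^bsub>quot_module M K\<^esub> y \<in> carrier (quot_module M K)"
      unfolding ops u(1) v(1) rcos_add[OF K u(2) v(2)] car using M.a_closed[OF u(2) v(2)] by blast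
    show "x \<oplus>\<^bsub>quot_module M K\<^esub> y = y \<oplus>\<^bsub>quot_module M K\<^esub> x"
      unfolding ops u(1) v(1) rcos_add[OF K u(2) v(2)] rcos_add[OF K v(2) u(2)]
      using M.a_comm[OF u(2) v(2)] by simp
    fix z assume "z \<in> carrier (quot_module M K)"
    then obtain w where w: "z = K +>\<^bsub>M\<^esub> w" "w \<in> carrier M" unfolding car by blast
    show "x \<oplus>\<^bsub>quot_module M K\<^esub> y \<oplus>\<^bsub>quot_module M K\<^esub> z = x \<oplus>\<^bsub>quot_module M K\<^esub> (y \<oplus>\<^bsub>quot_module M K\<^esub> z)"
      unfolding ops u(1) v(1) w(1) rcos_add[OF K u(2) v(2)] rcos_add[OF K v(2) w(2)]
        rcos_add[OF K M.a_closed[OF u(2) v(2)] w(2)] rcos_add[OF K u(2) M.a_closed[OF v(2) w(2)]]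
      using M.a_assoc[OF u(2) v(2) w(2)] by simp
  qed
qed

lemma finsum_quot:
  assumes K: "submodule K R M" and "finite A" "\<And>i. i \<in> A \<Longrightarrow> g i \<in> carrier M"
  shows "finsum (quot_module M K) (\<lambda>i. K +>\<^bsub>M\<^esub> g i) A = K +>\<^bsub>M\<^esub> finsum M g A"
proof -
  interpret Q: abelian_monoid "quot_module M K" by (rule quot_abelian_monoid[OF K])
  have car: "K +>\<^bsub>M\<^esub> u \<in> carrier (quot_module M K)" if "u \<in> carrier M" for u
    unfolding quot_module_def A_RCOSETS_def' using that by auto
  have ops: "add (quot_module M K) = set_add M" "zero (quot_module M K) = K"
    by (simp_all add: quot_module_def)
  show ?thesis using assms(2,3)
  proof (induction A)
    case empty
    show ?case using rcos_zero[OF K] by (simp add: ops)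
  next
    case (insert i A)
    have g: "g i \<in> carrier M" "g \<in> A \<rightarrow> carrier M" using insert.prems by auto
    have "finsum (quot_module M K) (\<lambda>i. K +>\<^bsub>M\<^esub> g i) (insert i A) =
        (K +>\<^bsub>M\<^esub> g i) <+>\<^bsub>M\<^esub> finsum (quot_module M K) (\<lambda>i. K +>\<^bsub>M\<^esub> g i) A"
      unfolding ops(1)[symmetric] using insert.hyps insert.prems car by (intro Q.finsum_insert) auto
    also have "\<dots> = (K +>\<^bsub>M\<^esub> g i) <+>\<^bsub>M\<^esub> (K +>\<^bsub>M\<^esub> finsum M g A)" using insert by simp
    also have "\<dots> = K +>\<^bsub>M\<^esub> (g i \<oplus>\<^bsub>M\<^esub> finsum M g A)" by (rule rcos_add[OF K g(1) M.finsum_closed[OF g(2)]])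
    also have "g i \<oplus>\<^bsub>M\<^esub> finsum M g A = finsum M g (insert i A)"
      using insert.hyps g by (intro M.finsum_insert[symmetric]) auto
    finally show ?case .
  qed
qed

end

section \<open>The three surjections from the Rees module\<close>

context rees_data
begin

text \<open>With the identity, whose kernel is zero, the Rees module is treated by
  \<open>le_grade_iff\<close> on the same footing as its two quotients.\<close>

lemma module_epi_self: "module_epi S N S N (\<lambda>f. f) (\<lambda>f. f)"
  by unfold_locales simp_all

lemma module_epi_base: "module_epi S N R M (\<lambda>f. f 0) (\<lambda>f. f 0)"
proof (intro module_epi.intro module_epi_axioms.intro N_module)
  have "a \<in> (\<lambda>f. f 0) ` carrier S" if "a \<in> carrier R" for a
  proof
    show "rmono a 0 \<in> carrier S" by (rule rmono_closed[OF R_P0[OF that]])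
  qed (simp add: rmono_def)
  thus "(\<lambda>f. f 0) ` carrier S = carrier R" using S_R by blast
  have "x \<in> (\<lambda>f. f 0) ` carrier N" if "x \<in> carrier M" for x
  proof
    show "nmono x 0 \<in> carrier N" by (rule nmono_closed[OF M_MM0[OF that]])
  qed (simp add: nmono_def)
  thus "(\<lambda>f. f 0) ` carrier N = carrier M" using N_M by blast
  show "(u \<oplus>\<^bsub>N\<^esub> v) 0 = u 0 \<oplus>\<^bsub>M\<^esub> v 0" for u v by (simp add: N_add)
  show "\<zero>\<^bsub>N\<^esub> 0 = \<zero>\<^bsub>M\<^esub>" by (simp add: N_zero)
  show "(r \<odot>\<^bsub>N\<^esub> u) 0 = r 0 \<odot>\<^bsub>M\<^esub> u 0" if "r \<in> carrier S" "u \<in> carrier N" for r u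
    using S_R[OF that(1), of 0] N_M[OF that(2), of 0] by (simp add: N_smult)
qed

abbreviation (input) "phiG \<equiv> \<lambda>f n. P (Suc n) +>\<^bsub>R\<^esub> f n"
abbreviation (input) "piG \<equiv> \<lambda>f n. MM (Suc n) +>\<^bsub>M\<^esub> f n"

lemma R_rcos_zero: "P n +>\<^bsub>R\<^esub> \<zero>\<^bsub>R\<^esub> = P n"
  by (rule R.a_coset_add_zero) (use P_carrier in blast)

lemma phiG_closed: "f \<in> carrier S \<Longrightarrow> phiG f \<in> carrier (assoc_graded_ring R I)"
proof -
  assume f: "f \<in> carrier S"
  obtain d where d: "\<And>n. n > d \<Longrightarrow> f n = \<zero>\<^bsub>R\<^esub>" using S_bound[OF f] by blast
  have "{n. phiG f n \<noteq> P (Suc n)} \<subseteq> {..d}"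
  proof
    fix n assume n: "n \<in> {n. phiG f n \<noteq> P (Suc n)}"
    show "n \<in> {..d}"
    proof (rule ccontr)
      assume "n \<notin> {..d}"
      hence "f n = \<zero>\<^bsub>R\<^esub>" using d by simp
      hence "phiG f n = P (Suc n)" using R_rcos_zero[of "Suc n"] by simp
      thus False using n by blast
    qed
  qed
  hence "finite {n. phiG f n \<noteq> P (Suc n)}" by (rule finite_subset) simp
  moreover have "\<exists>a\<in>P n. phiG f n = P (Suc n) +>\<^bsub>R\<^esub> a" for n using S_P[OF f] by blast
  ultimately show ?thesis unfolding assoc_graded_ring_def by simp
qed

lemma phiG_surj:
  assumes F: "F \<in> carrier (assoc_graded_ring R I)"
  shows "\<exists>f\<in>carrier S. F = phiG f"
proof -
  have F1: "\<exists>a\<in>P n. F n = P (Suc n) +>\<^bsub>R\<^esub> a" and F2: "finite {n. F n \<noteq> P (Suc n)}" for n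
    using F unfolding assoc_graded_ring_def by simp_all
  \<comment> \<open>Choosing zero as the representative of the zero coset keeps the support of the
    lift finite.\<close>
  have "\<exists>a. a \<in> P n \<and> F n = P (Suc n) +>\<^bsub>R\<^esub> a \<and> (F n = P (Suc n) \<longrightarrow> a = \<zero>\<^bsub>R\<^esub>)" for n
  proof (cases "F n = P (Suc n)")
    case True
    thus ?thesis using P_zero[of n] R_rcos_zero[of "Suc n"] by metis
  next
    case False
    thus ?thesis using F1[of n] by blast
  qed
  then obtain f where f: "\<And>n. f n \<in> P n" "\<And>n. F n = P (Suc n) +>\<^bsub>R\<^esub> f n" "\<And>n. F n = P (Suc n) \<Longrightarrow> f n = \<zero>\<^bsub>R\<^esub>"
    by metis
  obtain d where d: "\<forall>n\<in>{n. F n \<noteq> P (Suc n)}. n \<le> d"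
    using F2 finite_nat_set_iff_bounded_le by blast
  have "f m = \<zero>\<^bsub>R\<^esub>" if "d < m" for m
  proof (rule f(3), rule ccontr)
    assume "F m \<noteq> P (Suc m)"
    thus False using d that by force
  qed
  hence "bound \<zero>\<^bsub>R\<^esub> d f" by (rule bound.intro)
  hence "f \<in> up R" using P_carrier[OF f(1)] by (intro mem_upI) blast+
  hence "f \<in> carrier S" unfolding S_carrier using f(1) by blast
  moreover have "F = phiG f" using f(2) by (rule ext)
  ultimately show ?thesis by blast
qed

lemma piG_closed: "f \<in> carrier N \<Longrightarrow> piG f \<in> carrier (assoc_graded_module R I M)"
proof -
  assume f: "f \<in> carrier N"
  obtain d where d: "\<And>n. n > d \<Longrightarrow> f n = \<zero>\<^bsub>M\<^esub>" using N_bound[OF f] by blast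
  have "{n. piG f n \<noteq> MM (Suc n)} \<subseteq> {..d}"
  proof
    fix n assume n: "n \<in> {n. piG f n \<noteq> MM (Suc n)}"
    show "n \<in> {..d}"
    proof (rule ccontr)
      assume "n \<notin> {..d}"
      hence "f n = \<zero>\<^bsub>M\<^esub>" using d by simp
      hence "piG f n = MM (Suc n)" using rcos_zero[OF MM_submodule, of "Suc n"] by simp
      thus False using n by blast
    qed
  qed
  hence "finite {n. piG f n \<noteq> MM (Suc n)}" by (rule finite_subset) simp
  moreover have "\<exists>a\<in>MM n. piG f n = MM (Suc n) +>\<^bsub>M\<^esub> a" for n using N_MM[OF f] by blast
  ultimately show ?thesis unfolding assoc_graded_module_def by simp
qed

lemma piG_surj:
  assumes F: "F \<in> carrier (assoc_graded_module R I M)"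
  shows "\<exists>f\<in>carrier N. F = piG f"
proof -
  have F1: "\<exists>a\<in>MM n. F n = MM (Suc n) +>\<^bsub>M\<^esub> a" and F2: "finite {n. F n \<noteq> MM (Suc n)}" for n
    using F unfolding assoc_graded_module_def by simp_all
  have "\<exists>a. a \<in> MM n \<and> F n = MM (Suc n) +>\<^bsub>M\<^esub> a \<and> (F n = MM (Suc n) \<longrightarrow> a = \<zero>\<^bsub>M\<^esub>)" for n
  proof (cases "F n = MM (Suc n)")
    case True
    thus ?thesis using submodule_zero[OF MM_submodule, of n] rcos_zero[OF MM_submodule, of "Suc n"] by metis
  next
    case False
    thus ?thesis using F1[of n] by blast
  qed
  then obtain f where f: "\<And>n. f n \<in> MM n" "\<And>n. F n = MM (Suc n) +>\<^bsub>M\<^esub> f n" "\<And>n. F n = MM (Suc n) \<Longrightarrow> f n = \<zero>\<^bsub>M\<^esub>"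
    by metis
  obtain d where d: "\<forall>n\<in>{n. F n \<noteq> MM (Suc n)}. n \<le> d"
    using F2 finite_nat_set_iff_bounded_le by blast
  have f0: "f m = \<zero>\<^bsub>M\<^esub>" if "d < m" for m
  proof (rule f(3), rule ccontr)
    assume "F m \<noteq> MM (Suc m)"
    thus False using d that by force
  qed
  have "f \<in> carrier N" by (rule N_carrierI[where d = d]) (fact f(1) f0)+
  moreover have "F = piG f" using f(2) by (rule ext)
  ultimately show ?thesis by blast
qed

text \<open>With representatives \<open>p + r\<close> and \<open>u + x\<close>, every product
  differs from that of \<open>r\<close> and \<open>x\<close> by an element of
  \<open>MM (Suc n)\<close>. So the union runs over equal cosets, and it is not empty.\<close>

lemma graded_smult_term:
  assumes r: "r \<in> P i" and x: "x \<in> MM k" and n: "i + k = n"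
  shows "(\<Union>a\<in>P (Suc i) +>\<^bsub>R\<^esub> r. coset_smult M (MM (Suc n)) a (MM (Suc k) +>\<^bsub>M\<^esub> x)) =
    MM (Suc n) +>\<^bsub>M\<^esub> (r \<odot>\<^bsub>M\<^esub> x)"
proof -
  let ?K = "MM (Suc n)"
  note rc = P_carrier[OF r] and xc = MM_carrier[OF x]
  have eq: "?K +>\<^bsub>M\<^esub> (a \<odot>\<^bsub>M\<^esub> z) = ?K +>\<^bsub>M\<^esub> (r \<odot>\<^bsub>M\<^esub> x)"
    if a: "a \<in> P (Suc i) +>\<^bsub>R\<^esub> r" and z: "z \<in> MM (Suc k) +>\<^bsub>M\<^esub> x" for a z
  proof -
    obtain p where p: "p \<in> P (Suc i)" "a = p \<oplus> r" using a unfolding a_r_coset_def' by blast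
    obtain u where u: "u \<in> MM (Suc k)" "z = u \<oplus>\<^bsub>M\<^esub> x" using z unfolding a_r_coset_def' by blast
    note pc = P_carrier[OF p(1)] and uc = MM_carrier[OF u(1)]
    have zc: "z \<in> MM k" unfolding u(2)
      using submoduleE(5)[OF MM_submodule _ x] u(1) MM_Suc_subset by blast
    have 1: "p \<odot>\<^bsub>M\<^esub> z \<in> ?K" using P_MM[OF p(1) zc] n by simp
    have 2: "r \<odot>\<^bsub>M\<^esub> u \<in> ?K" using P_MM[OF r u(1)] n by simp
    have "a \<odot>\<^bsub>M\<^esub> z = p \<odot>\<^bsub>M\<^esub> z \<oplus>\<^bsub>M\<^esub> (r \<odot>\<^bsub>M\<^esub> u \<oplus>\<^bsub>M\<^esub> r \<odot>\<^bsub>M\<^esub> x)"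
      using pc rc uc xc MM_carrier[OF zc] by (simp add: p(2) smult_l_distr smult_r_distr[OF rc uc xc, folded u(2)])
    also have "\<dots> = (p \<odot>\<^bsub>M\<^esub> z \<oplus>\<^bsub>M\<^esub> r \<odot>\<^bsub>M\<^esub> u) \<oplus>\<^bsub>M\<^esub> r \<odot>\<^bsub>M\<^esub> x"
      using MM_carrier[OF 1] MM_carrier[OF 2] rc xc by (simp add: M.a_assoc)
    finally show ?thesis
      using rcos_eqI[OF MM_submodule submoduleE(5)[OF MM_submodule 1 2], of "r \<odot>\<^bsub>M\<^esub> x"] rc xc by simp
  qed
  have r1: "r \<in> P (Suc i) +>\<^bsub>R\<^esub> r"
    using P_zero[of "Suc i"] rc unfolding a_r_coset_def' by force
  have x1: "x \<in> MM (Suc k) +>\<^bsub>M\<^esub> x"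
    using submodule_zero[OF MM_submodule, of "Suc k"] xc unfolding a_r_coset_def' by force
  show ?thesis unfolding coset_smult_def using eq r1 x1 by blast
qed

lemma module_epi_graded:
  "module_epi S N (assoc_graded_ring R I) (assoc_graded_module R I M) phiG piG"
proof (intro module_epi.intro module_epi_axioms.intro N_module)
  show "phiG ` carrier S = carrier (assoc_graded_ring R I)" using phiG_closed phiG_surj by blast
  show "piG ` carrier N = carrier (assoc_graded_module R I M)" using piG_closed piG_surj by blast
  show "piG (u \<oplus>\<^bsub>N\<^esub> v) = piG u \<oplus>\<^bsub>assoc_graded_module R I M\<^esub> piG v"
    if "u \<in> carrier N" "v \<in> carrier N" for u v
  proof -
    have add: "x \<oplus>\<^bsub>assoc_graded_module R I M\<^esub> z = (\<lambda>n. x n <+>\<^bsub>M\<^esub> z n)" for x z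
      by (simp add: assoc_graded_module_def)
    show ?thesis unfolding add N_add
      by (rule ext) (rule rcos_add[OF MM_submodule N_M[OF that(1)] N_M[OF that(2)], symmetric])
  qed
  show "piG \<zero>\<^bsub>N\<^esub> = \<zero>\<^bsub>assoc_graded_module R I M\<^esub>"
  proof -
    have zero: "\<zero>\<^bsub>assoc_graded_module R I M\<^esub> = (\<lambda>n. MM (Suc n))"
      by (simp add: assoc_graded_module_def)
    show ?thesis unfolding zero N_zero by (rule ext) (rule rcos_zero[OF MM_submodule])
  qed
  show "piG (r \<odot>\<^bsub>N\<^esub> u) = phiG r \<odot>\<^bsub>assoc_graded_module R I M\<^esub> piG u"
    if r: "r \<in> carrier S" and u: "u \<in> carrier N" for r u
  proof
    fix n
    let ?Q = "quot_module M (MM (Suc n))"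
    interpret Q: abelian_monoid ?Q by (rule quot_abelian_monoid[OF MM_submodule])
    have car: "MM (Suc n) +>\<^bsub>M\<^esub> z \<in> carrier ?Q" if "z \<in> carrier M" for z
      unfolding quot_module_def A_RCOSETS_def' using that by auto
    have tc: "r i \<odot>\<^bsub>M\<^esub> u (n - i) \<in> carrier M" for i by (rule smult_closed[OF S_R[OF r] N_M[OF u]])
    have "(phiG r \<odot>\<^bsub>assoc_graded_module R I M\<^esub> piG u) n =
      finsum ?Q (\<lambda>i. \<Union>a\<in>phiG r i. coset_smult M (MM (Suc n)) a (piG u (n - i))) {..n}"
      by (simp add: assoc_graded_module_def)
    also have "\<dots> = finsum ?Q (\<lambda>i. MM (Suc n) +>\<^bsub>M\<^esub> (r i \<odot>\<^bsub>M\<^esub> u (n - i))) {..n}"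
    proof (rule Q.finsum_cong')
      fix i assume "i \<in> {..n}"
      hence "i + (n - i) = n" by simp
      thus "(\<Union>a\<in>phiG r i. coset_smult M (MM (Suc n)) a (piG u (n - i))) = MM (Suc n) +>\<^bsub>M\<^esub> (r i \<odot>\<^bsub>M\<^esub> u (n - i))"
        by (rule graded_smult_term[OF S_P[OF r] N_MM[OF u]])
    qed (use car tc in auto)
    also have "\<dots> = MM (Suc n) +>\<^bsub>M\<^esub> finsum M (\<lambda>i. r i \<odot>\<^bsub>M\<^esub> u (n - i)) {..n}"
      by (rule finsum_quot[OF MM_submodule]) (use tc in auto)
    also have "\<dots> = piG (r \<odot>\<^bsub>N\<^esub> u) n" by (simp add: N_smult)
    finally show "piG (r \<odot>\<^bsub>N\<^esub> u) n = (phiG r \<odot>\<^bsub>assoc_graded_module R I M\<^esub> piG u) n" by simp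
  qed
qed

lemma P_1: "P (Suc 0) = I"
proof
  show "P (Suc 0) \<subseteq> I" using R.ideal_prod_inter[OF P_ideal[of 0] I] P_Suc[of 0] by auto
qed (use I_mem_P in blast)

end

section \<open>Images of the graded maximal ideal\<close>

context rees_gens
begin

lemma phi_base_J: "(\<lambda>f. f 0) ` J = \<mm>"
proof
  show "\<mm> \<subseteq> (\<lambda>f. f 0) ` J"
  proof
    fix a assume a: "a \<in> \<mm>"
    have "rmono a 0 \<in> J"
      unfolding J_mem using a rmono_closed[OF R_P0[OF ideal.Icarr[OF m_ideal a]]] by (simp add: rmono_def)
    moreover have "a = rmono a 0 0" by (simp add: rmono_def)
    ultimately show "a \<in> (\<lambda>f. f 0) ` J" by blast
  qed
qed (use J_mem in blast)

lemma phiG_J: "phiG ` J = assoc_graded_max_ideal R \<mm> I"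
proof
  show "phiG ` J \<subseteq> assoc_graded_max_ideal R \<mm> I"
  proof
    fix F assume "F \<in> phiG ` J"
    then obtain f where f: "f \<in> J" "F = phiG f" by blast
    have fS: "f \<in> carrier S" "f 0 \<in> \<mm>" using f(1) J_mem by simp_all
    have "F 0 = I +>\<^bsub>R\<^esub> f 0" unfolding f(2) P_1 ..
    thus "F \<in> assoc_graded_max_ideal R \<mm> I"
      unfolding assoc_graded_max_ideal_def using phiG_closed[OF fS(1)] f(2) fS(2) by blast
  qed
  show "assoc_graded_max_ideal R \<mm> I \<subseteq> phiG ` J"
  proof
    fix F assume "F \<in> assoc_graded_max_ideal R \<mm> I"
    then obtain a where F: "F \<in> carrier (assoc_graded_ring R I)" and a: "a \<in> \<mm>" "F 0 = I +>\<^bsub>R\<^esub> a"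
      unfolding assoc_graded_max_ideal_def by blast
    obtain f where f: "f \<in> carrier S" "F = phiG f" using phiG_surj[OF F] by blast
    note aR = ideal.Icarr[OF m_ideal a(1)]
    \<comment> \<open>\<open>f 0\<close> is known to agree with \<open>a\<close> modulo
      \<open>I\<close>; replacing it by \<open>a\<close> puts the lift into \<open>J\<close> and
      does not change its image.\<close>
    define g where "g = (\<lambda>n. if n = 0 then a else f n)"
    have "g \<in> carrier S"
    proof -
      have gP: "g n \<in> P n" for n
      proof (cases "n = 0")
        case True
        show ?thesis unfolding g_def True if_P[OF refl] by (rule R_P0[OF aR])
      next
        case False
        show ?thesis unfolding g_def if_not_P[OF False] by (rule S_P[OF f(1)])
      qed
      obtain d where d: "\<And>n. n > d \<Longrightarrow> f n = \<zero>\<^bsub>R\<^esub>" using S_bound[OF f(1)] by blast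
      have "g n = \<zero>\<^bsub>R\<^esub>" if "d < n" for n using d that by (simp add: g_def)
      hence "bound \<zero>\<^bsub>R\<^esub> d g" by (rule bound.intro)
      hence "g \<in> up R" using P_carrier[OF gP] by (intro mem_upI) blast+
      thus ?thesis unfolding S_carrier using gP by blast
    qed
    moreover have "g 0 = a" by (simp add: g_def)
    ultimately have "g \<in> J" unfolding J_mem using a(1) by simp
    moreover have "F = phiG g"
    proof
      fix n
      show "F n = phiG g n"
      proof (cases "n = 0")
        case True
        show ?thesis unfolding True P_1 using a(2) by (simp add: g_def)
      next
        case False
        thus ?thesis unfolding f(2) by (simp add: g_def)
      qed
    qed
    ultimately show "F \<in> phiG ` J" by blast
  qed
qed

end

section \<open>Depth of the Rees module\<close>

context rees_gens
begin

text \<open>Elements of positive degree are sums of multiples by \<open>a t\<close> with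
  \<open>a\<close> in \<open>I\<close>, and these \<open>a t\<close> lie in \<open>J\<close>. Hence
  \<open>N_pos\<close> does not enlarge \<open>J N\<close>, which transfers properness from
  \<open>N\<close> to \<open>M\<close>.\<close>

lemma N_pos_subset_adjoin: "N_pos \<subseteq> adjoin S N {\<zero>\<^bsub>N\<^esub>} J"
proof
  let ?U = "adjoin S N {\<zero>\<^bsub>N\<^esub>} J"
  have Jc: "J \<subseteq> carrier S" using J_mem by blast
  have U: "submodule ?U S N" by (rule N.adjoin_submodule[OF _ Jc]) simp
  have mono: "\<forall>x\<in>MM (Suc n). nmono x (Suc n) \<in> ?U" for n
  proof -
    let ?K = "{x \<in> MM (Suc n). nmono x (Suc n) \<in> ?U}"
    have "submodule ?K R M"
    proof (rule submoduleI_diff)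
      show "?K \<subseteq> carrier M" using MM_carrier by blast
      show "\<zero>\<^bsub>M\<^esub> \<in> ?K"
        unfolding mem_Collect_eq nmono_zero using N.submodule_zero[OF U] submodule_zero[OF MM_submodule] by blast
      show "a \<ominus>\<^bsub>M\<^esub> b \<in> ?K" if ab: "a \<in> ?K" "b \<in> ?K" for a b
      proof -
        have m: "a \<in> MM (Suc n)" "b \<in> MM (Suc n)" "nmono a (Suc n) \<in> ?U" "nmono b (Suc n) \<in> ?U"
          using ab by blast+
        have "nmono (a \<ominus>\<^bsub>M\<^esub> b) (Suc n) \<in> ?U"
          unfolding nmono_diff[OF m(2), symmetric] by (rule N.submodule_diff[OF U m(3,4)])
        thus ?thesis using submodule_diff[OF MM_submodule m(1,2)] by blast
      qed
      show "r \<odot>\<^bsub>M\<^esub> a \<in> ?K" if r: "r \<in> carrier R" and a: "a \<in> ?K" for r a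
      proof -
        have m: "a \<in> MM (Suc n)" "nmono a (Suc n) \<in> ?U" using a by blast+
        have "rmono r 0 \<odot>\<^bsub>N\<^esub> nmono a (Suc n) \<in> ?U"
          by (rule N.submoduleE(4)[OF U rmono_closed[OF R_P0[OF r]] m(2)])
        hence "nmono (r \<odot>\<^bsub>M\<^esub> a) (Suc n) \<in> ?U" unfolding rmono_nmono[OF R_P0[OF r] m(1)] add_0 .
        thus ?thesis using submoduleE(4)[OF MM_submodule r m(1)] by blast
      qed
    qed
    moreover have "a \<odot>\<^bsub>M\<^esub> z \<in> ?K" if a: "a \<in> I" and z: "z \<in> MM n" for a z
    proof -
      have "rmono a (Suc 0) 0 = \<zero>\<^bsub>R\<^esub>" by (simp add: rmono_def)
      hence "rmono a (Suc 0) \<in> J" unfolding J_mem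
        using rmono_closed[OF I_mem_P[OF a]] additive_subgroup.zero_closed[OF ideal.axioms(1)[OF m_ideal]] by simp
      hence "rmono a (Suc 0) \<odot>\<^bsub>N\<^esub> nmono z n \<in> ?U" by (rule adjoin_mem[OF _ nmono_closed[OF z]])
      hence "nmono (a \<odot>\<^bsub>M\<^esub> z) (Suc n) \<in> ?U" using rmono_nmono[OF I_mem_P[OF a] z] by simp
      thus ?thesis using P_MM[OF I_mem_P[OF a] z] by simp
    qed
    ultimately have "MM (Suc n) \<subseteq> ?K" by (rule MM_Suc_minimal)
    thus ?thesis by blast
  qed
  fix f assume "f \<in> N_pos"
  hence f: "f \<in> carrier N" "f 0 = \<zero>\<^bsub>M\<^esub>" unfolding N_pos_def by simp_all
  show "f \<in> ?U"
  proof (rule N_graded_induct[OF f(1)])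
    show "\<zero>\<^bsub>N\<^esub> \<in> ?U" by (rule N.submodule_zero[OF U])
    show "u \<oplus>\<^bsub>N\<^esub> v \<in> ?U" if "u \<in> ?U" "v \<in> ?U" for u v by (rule N.submoduleE(5)[OF U that])
    show "nmono (f n) n \<in> ?U" for n
    proof (cases n)
      case 0
      show ?thesis unfolding 0 f(2) nmono_zero by (rule N.submodule_zero[OF U])
    next
      case (Suc k)
      show ?thesis unfolding Suc using mono N_MM[OF f(1)] by blast
    qed
  qed
qed

theorem depth_rees_eq:
  assumes less: "depth_assoc_graded R \<mm> I M < depth R \<mm> M"
  shows "depth_rees R \<mm> I M = depth_assoc_graded R \<mm> I M + 1"
proof -
  interpret E0: module_epi S N S N "\<lambda>f. f" "\<lambda>f. f" by (rule module_epi_self)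
  interpret E1: module_epi S N R M "\<lambda>f. f 0" "\<lambda>f. f 0" by (rule module_epi_base)
  interpret EG: module_epi S N "assoc_graded_ring R I" "assoc_graded_module R I M" phiG piG
    by (rule module_epi_graded)
  have k0: "E0.ker = {\<zero>\<^bsub>N\<^esub>}" unfolding E0.ker_def using N.M.zero_closed by blast
  have k1: "E1.ker = N_pos" unfolding E1.ker_def N_pos_def ..
  have kG: "EG.ker = N_gr"
  proof -
    have "piG f = \<zero>\<^bsub>assoc_graded_module R I M\<^esub> \<longleftrightarrow> (\<forall>n. f n \<in> MM (Suc n))" if f: "f \<in> carrier N" for f
    proof -
      have "piG f = \<zero>\<^bsub>assoc_graded_module R I M\<^esub> \<longleftrightarrow> (\<forall>n. MM (Suc n) +>\<^bsub>M\<^esub> f n = MM (Suc n))"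
        unfolding fun_eq_iff by (simp add: assoc_graded_module_def)
      thus ?thesis using rcos_eq_iff[OF MM_submodule N_M[OF f]] by blast
    qed
    thus ?thesis unfolding EG.ker_def N_gr_def by blast
  qed
  have d0: "depth_rees R \<mm> I M = grade S ((\<lambda>f. f) ` J) N" unfolding depth_rees_def by simp
  have d1: "depth R \<mm> M = grade R ((\<lambda>f. f 0) ` J) M" unfolding depth_def phi_base_J ..
  have dG: "depth_assoc_graded R \<mm> I M = grade (assoc_graded_ring R I) (phiG ` J) (assoc_graded_module R I M)"
    unfolding depth_assoc_graded_def phiG_J ..
  have Jc: "J \<subseteq> carrier S" using J_mem by blast
  have LGc: "N_gr \<subseteq> carrier N" using N_gr_carrier by blast
  have zLG: "{\<zero>\<^bsub>N\<^esub>} \<subseteq> N_gr" using EG.ker_submodule[unfolded kG] N.submodule_zero by blast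
  \<comment> \<open>A depth strictly below another one is finite, so the convention of infinite
    grade is not in force for the associated graded module.\<close>
  have neG: "adjoin S N N_gr J \<noteq> carrier N"
  proof
    assume "adjoin S N N_gr J = carrier N"
    hence "depth_assoc_graded R \<mm> I M = \<infinity>" using EG.grade_image[OF Jc] unfolding kG dG by simp
    thus False using less by simp
  qed
  have sub0: "submodule (adjoin S N {\<zero>\<^bsub>N\<^esub>} J) S N" by (rule N.adjoin_submodule[OF _ Jc]) simp
  have ne0: "adjoin S N {\<zero>\<^bsub>N\<^esub>} J \<noteq> carrier N"
  proof
    assume "adjoin S N {\<zero>\<^bsub>N\<^esub>} J = carrier N"
    hence "carrier N \<subseteq> adjoin S N N_gr J" using N.adjoin_mono[OF LGc zLG Jc order_refl] by simp
    moreover have "adjoin S N N_gr J \<subseteq> carrier N" by (rule N.submoduleE(1)[OF N.adjoin_submodule[OF LGc Jc]])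
    ultimately show False using neG by blast
  qed
  have neM: "adjoin S N N_pos J \<noteq> carrier N"
  proof
    assume "adjoin S N N_pos J = carrier N"
    moreover have "adjoin S N N_pos J \<subseteq> adjoin S N {\<zero>\<^bsub>N\<^esub>} J"
      by (rule adjoin_minimal[OF sub0 N_pos_subset_adjoin]) (rule adjoin_mem)
    ultimately show False using ne0 N.submoduleE(1)[OF sub0] by blast
  qed
  have g0: "enat n \<le> depth_rees R \<mm> I M \<longleftrightarrow> (\<forall>d<int n. koszul_exact N y s {\<zero>\<^bsub>N\<^esub>} d)" for n
    unfolding d0 k0[symmetric]
    by (rule E0.le_grade_iff[OF y_closed J_gen N_chain_cond]) (use ne0 k0 in simp_all)
  have g1: "enat n \<le> depth R \<mm> M \<longleftrightarrow> (\<forall>d<int n. koszul_exact N y s N_pos d)" for n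
    unfolding d1 k1[symmetric]
    by (rule E1.le_grade_iff[OF y_closed J_gen N_chain_cond]) (use neM k1 in simp_all)
  have gG: "enat n \<le> depth_assoc_graded R \<mm> I M \<longleftrightarrow> (\<forall>d<int n. koszul_exact N y s N_gr d)" for n
    unfolding dG kG[symmetric]
    by (rule EG.le_grade_iff[OF y_closed J_gen N_chain_cond]) (use neG kG in simp_all)
  obtain g where g: "depth_assoc_graded R \<mm> I M = enat g"
    using less by (cases "depth_assoc_graded R \<mm> I M") simp_all
  have exG: "koszul_exact N y s N_gr d" if "d < int g" for d using gG[of g] g that by simp
  have nexG: "\<not> koszul_exact N y s N_gr (int g)"
  proof
    assume h: "koszul_exact N y s N_gr (int g)"
    have "koszul_exact N y s N_gr d" if "d < int (Suc g)" for d
      using exG[of d] h that by (cases "d = int g") simp_all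
    hence "enat (Suc g) \<le> enat g" using gG[of "Suc g"] g by simp
    thus False by simp
  qed
  \<comment> \<open>Strictness gives one more degree: the cohomology of \<open>M\<close> vanishes up
    to and including degree \<open>g\<close>.\<close>
  have "enat (Suc g) \<le> depth R \<mm> M" using less unfolding g by (simp add: Suc_ile_eq)
  hence exM: "koszul_exact N y s N_pos d" if "d < int (Suc g)" for d using g1[of "Suc g"] that by blast
  have ex0: "koszul_exact N y s {\<zero>\<^bsub>N\<^esub>} d" if "d < int (Suc g)" for d
    by (rule koszul_exact_rees[OF exM[OF that] exG]) (use that in simp)
  have ge: "enat (Suc g) \<le> depth_rees R \<mm> I M" using g0[of "Suc g"] ex0 by blast
  \<comment> \<open>Vanishing for \<open>N\<close> in degree \<open>g + 1\<close> would force
    vanishing for the associated graded module in degree \<open>g\<close>, against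
    \<open>nexG\<close>.\<close>
  have "\<not> enat (Suc (Suc g)) \<le> depth_rees R \<mm> I M"
  proof
    assume "enat (Suc (Suc g)) \<le> depth_rees R \<mm> I M"
    hence h: "koszul_exact N y s {\<zero>\<^bsub>N\<^esub>} (int g + 1)" using g0[of "Suc (Suc g)"] by simp
    have "koszul_exact N y s N_gr (int g)" by (rule koszul_exact_assoc_graded[OF exM ex0 h]) simp_all
    thus False using nexG by blast
  qed
  hence "depth_rees R \<mm> I M = enat (Suc g)"
    using ge by (cases "depth_rees R \<mm> I M") simp_all
  thus ?thesis unfolding g by (simp add: one_enat_def)
qed

end

theorem proposition4p6:
  fixes A :: "('a, 'r) ring_scheme" and M :: "('a, 'm, 's) module_scheme"
    and \<mm> I :: "'a set"
  assumes "noetherian_local_ring A \<mm>"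
    and "fin_gen_module A M"
    and "ideal I A" and "I \<noteq> carrier A"
    and "grade A I M > 0"
    and "depth_assoc_graded A \<mm> I M < depth A \<mm> M"
  shows "depth_rees A \<mm> I M = depth_assoc_graded A \<mm> I M + 1"
proof -
  have A: "noetherian_ring A" and m: "ideal \<mm> A"
    using assms(1) maximalideal.axioms(1) unfolding noetherian_local_ring_def by blast+
  \<comment> \<open>Finite generating sets of both ideals supply the homogeneous elements on which
    the Koszul complex is built.\<close>
  obtain X where X: "X \<subseteq> carrier A" "finite X" "\<mm> = Idl\<^bsub>A\<^esub> X"
    using noetherian_ring.finetely_gen[OF A m] by blast
  obtain Y where Y: "Y \<subseteq> carrier A" "finite Y" "I = Idl\<^bsub>A\<^esub> Y"
    using noetherian_ring.finetely_gen[OF A assms(3)] by blast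
  obtain xs ys where xs: "set xs = X" "set ys = Y" using X(2) Y(2) finite_list by metis
  have "module A M" using assms(2) unfolding fin_gen_module_def by blast
  then interpret rees_gens A M I \<mm> xs ys
    by (intro rees_gens.intro rees_data.intro rees_data_axioms.intro rees_gens_axioms.intro)
      (use X Y xs A assms(2,3) in simp_all)
  show ?thesis by (rule depth_rees_eq[OF assms(6)])
qed

end
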